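(* For all $g,p$ with $2g-2+p>0$, $$\operatorname{diam}_S\big(\mathrm{Graph}(g,p)/\mathrm{Sym}_p\big)\ \asymp\ \operatorname{diam}_S\big(\mathrm{Graph}(g,p)\big)\ \asymp\ \log(g+p),$$ where $\operatorname{diam}_S$ is the diameter in the metric $d_S$ of simultaneous Whitehead moves.
   Context: Here $g,p\ge0$ are integers, and $a\asymp b$ means $\frac1K b\le a\le K b$ for a uniform constant $K$ (independent of $g$ and $p$). $\mathrm{Graph}(g,p)$ is the set of connected graphs (loops and multiple edges allowed) of rank $g$ (first Betti number) with exactly $p$ valence-1 vertices, labeled bijectively by $p$ labels, and $2g-2+p$ valence-3 vertices, up to label-preserving isomorphism. $\mathrm{Graph}(g,p)/\mathrm{Sym}_p$ is the quotient by the symmetric group permuting the labels (graphs with unlabeled valence-1 vertices). An edge is interior if both its endpoints have valence three. A Whitehead move on an interior edge $e$ with distinct endpoints collapses $e$ to a valence-4 vertex and reopens it in one of the two other ways of splitting the four incident half-edges into two pairs, giving a new graph of the same type (moves on loops are trivial). Two edges are disjoint if they share no vertex; Whitehead moves on disjoint edges commute. A simultaneous Whitehead move is a composition of Whitehead moves on any number of pairwise disjoint edges. $d_S(\Gamma_1,\Gamma_2)$ is the minimal number of simultaneous Whitehead moves needed to transform $\Gamma_1$ into $\Gamma_2$.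
   Formalization: The lower bound diam_S(Graph(g,p)) ≥ log(g+p)/K is not claimed at (0,3),(1,1), where Graph(g,p) is one point, nor diam_S of the quotient ≥ diam_S(Graph(g,p))/K at (0,4),(0,5), where only the quotient is one point; these inequalities are false there. *)

theory Defs
  imports Complex_Main "Graph_Theory.Graph_Theory"
    "HOL-Library.Extended_Nat" "HOL-Library.Extended_Real" "HOL-Combinatorics.Permutations"
begin

text \<open>
  An undirected multigraph with loops is a bidirected digraph: an edge is a pair
  \<open>{a, opp G a}\<close> of opposite arcs.  An arc doubles as the half-edge at its tail, so the valence of
  a vertex is the number of arcs leaving it and a loop contributes 2.  Every finite graph has an
  isomorphic copy on natural numbers.  Only the values of \<open>label\<close> at valence-1 vertices matter.
\<close>

record lgraph =
  dg :: "(nat, nat) pre_digraph"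
  opp :: "nat \<Rightarrow> nat"
  label :: "nat \<Rightarrow> nat"

abbreviation valence :: "lgraph \<Rightarrow> nat \<Rightarrow> nat" where
  "valence G v \<equiv> out_degree (dg G) v"

definition verts_of_valence :: "lgraph \<Rightarrow> nat \<Rightarrow> nat set" where
  "verts_of_valence G k = {v \<in> verts (dg G). valence G v = k}"

text \<open>The first Betti number of a connected graph: 1 - \<chi>.\<close>

definition graph_rank :: "lgraph \<Rightarrow> int" where
  "graph_rank G = int (card {{a, opp G a} | a. a \<in> arcs (dg G)}) - int (card (verts (dg G))) + 1"

definition lgraphs :: "nat \<Rightarrow> nat \<Rightarrow> lgraph set" where
  "lgraphs g p = {G.
     fin_digraph (dg G) \<and> bidirected_digraph (dg G) (opp G) \<and>
     Digraph_Component.connected (dg G) \<and> graph_rank G = int g \<and>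
     (\<forall>v \<in> verts (dg G). valence G v = 1 \<or> valence G v = 3) \<and>
     int (card (verts_of_valence G 3)) = 2 * int g - 2 + int p \<and>
     bij_betw (label G) (verts_of_valence G 1) {1..p}}"

definition lgraph_iso :: "lgraph \<Rightarrow> lgraph \<Rightarrow> bool" where
  "lgraph_iso G H \<longleftrightarrow> (\<exists>f k.
     bij_betw f (verts (dg G)) (verts (dg H)) \<and>
     bij_betw k (arcs (dg G)) (arcs (dg H)) \<and>
     (\<forall>a \<in> arcs (dg G). tail (dg H) (k a) = f (tail (dg G) a) \<and>
        head (dg H) (k a) = f (head (dg G) a) \<and> opp H (k a) = k (opp G a)) \<and>
     (\<forall>v \<in> verts_of_valence G 1. label H (f v) = label G v))"

definition iso_rel :: "nat \<Rightarrow> nat \<Rightarrow> (lgraph \<times> lgraph) set" where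
  "iso_rel g p = {(G, H). G \<in> lgraphs g p \<and> H \<in> lgraphs g p \<and> lgraph_iso G H}"

definition relabel :: "(nat \<Rightarrow> nat) \<Rightarrow> lgraph \<Rightarrow> lgraph" where
  "relabel \<pi> G = G\<lparr>label := \<pi> \<circ> label G\<rparr>"

definition iso_rel_sym :: "nat \<Rightarrow> nat \<Rightarrow> (lgraph \<times> lgraph) set" where
  "iso_rel_sym g p = {(G, H). G \<in> lgraphs g p \<and> H \<in> lgraphs g p \<and>
     (\<exists>\<pi>. \<pi> permutes {1..p} \<and> lgraph_iso (relabel \<pi> G) H)}"

text \<open>The points of \<open>Graph_mod_Sym g p\<close> are the unions of the \<open>Sym\<^sub>p\<close>-orbits in \<open>Graph g p\<close>.\<close>

definition Graph :: "nat \<Rightarrow> nat \<Rightarrow> lgraph set set" where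
  "Graph g p = lgraphs g p // iso_rel g p"

definition Graph_mod_Sym :: "nat \<Rightarrow> nat \<Rightarrow> lgraph set set" where
  "Graph_mod_Sym g p = lgraphs g p // iso_rel_sym g p"

lemma lgraph_iso_valence:
  assumes wf: "wf_digraph (dg G)"
    and f: "bij_betw f (verts (dg G)) (verts (dg H))"
    and k: "bij_betw k (arcs (dg G)) (arcs (dg H))"
    and t: "\<And>a. a \<in> arcs (dg G) \<Longrightarrow> tail (dg H) (k a) = f (tail (dg G) a)"
    and v: "v \<in> verts (dg G)"
  shows "valence H (f v) = valence G v"
proof -
  have "out_arcs (dg H) (f v) = k ` out_arcs (dg G) v"
  proof (intro equalityI subsetI)
    fix b assume b: "b \<in> out_arcs (dg H) (f v)"
    then obtain a where a: "a \<in> arcs (dg G)" "b = k a"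
      using k by (auto simp: bij_betw_def)
    have "f (tail (dg G) a) = f v" using b a t by auto
    then have "tail (dg G) a = v"
      using f v wf a by (auto simp: bij_betw_def inj_on_def wf_digraph_def)
    then show "b \<in> k ` out_arcs (dg G) v" using a by auto
  next
    fix b assume "b \<in> k ` out_arcs (dg G) v"
    then show "b \<in> out_arcs (dg H) (f v)" using k t by (auto simp: bij_betw_def)
  qed
  moreover have "inj_on k (out_arcs (dg G) v)"
    using k by (auto simp: bij_betw_def inj_on_def)
  ultimately show ?thesis by (simp add: out_degree_def card_image)
qed

lemma lgraph_iso_refl: "lgraph_iso G G"
  unfolding lgraph_iso_def by (rule exI[of _ id], rule exI[of _ id]) auto

lemma lgraph_iso_sym:
  assumes bi: "bidirected_digraph (dg G) (opp G)" and wf: "wf_digraph (dg G)"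
    and wfH: "wf_digraph (dg H)" and iso: "lgraph_iso G H"
  shows "lgraph_iso H G"
proof -
  interpret bidirected_digraph "dg G" "opp G" by (rule bi)
  obtain f k where f: "bij_betw f (verts (dg G)) (verts (dg H))"
    and k: "bij_betw k (arcs (dg G)) (arcs (dg H))"
    and c: "\<And>a. a \<in> arcs (dg G) \<Longrightarrow> tail (dg H) (k a) = f (tail (dg G) a) \<and>
        head (dg H) (k a) = f (head (dg G) a) \<and> opp H (k a) = k (opp G a)"
    and l: "\<And>v. v \<in> verts_of_valence G 1 \<Longrightarrow> label H (f v) = label G v"
    using iso unfolding lgraph_iso_def by blast
  define f' k' where "f' = inv_into (verts (dg G)) f" and "k' = inv_into (arcs (dg G)) k"
  have f': "bij_betw f' (verts (dg H)) (verts (dg G))"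
    and k': "bij_betw k' (arcs (dg H)) (arcs (dg G))"
    using f k by (auto simp: f'_def k'_def bij_betw_inv_into)
  have ff: "f' (f v) = v" if "v \<in> verts (dg G)" for v
    using f that by (simp add: f'_def bij_betw_def)
  have kk: "k' (k a) = a" if "a \<in> arcs (dg G)" for a
    using k that by (simp add: k'_def bij_betw_def)
  have "tail (dg G) (k' b) = f' (tail (dg H) b) \<and> head (dg G) (k' b) = f' (head (dg H) b) \<and>
      opp G (k' b) = k' (opp H b)" if b: "b \<in> arcs (dg H)" for b
  proof -
    obtain a where "a \<in> arcs (dg G)" "b = k a" using k b by (auto simp: bij_betw_def)
    then show ?thesis using c[of a] by (simp add: ff kk)
  qed
  moreover have "label G (f' w) = label H w" if w: "w \<in> verts_of_valence H 1" for w
  proof -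
    obtain v where v: "v \<in> verts (dg G)" "w = f v"
      using f w by (auto simp: bij_betw_def verts_of_valence_def)
    then have "v \<in> verts_of_valence G 1"
      using lgraph_iso_valence[OF wf f k _ v(1)] c w by (auto simp: verts_of_valence_def)
    then show ?thesis using l v ff by simp
  qed
  ultimately show ?thesis unfolding lgraph_iso_def using f' k' by blast
qed

lemma lgraph_iso_trans:
  assumes bi: "bidirected_digraph (dg G) (opp G)" and wf: "wf_digraph (dg G)"
    and 1: "lgraph_iso G H" and 2: "lgraph_iso H I"
  shows "lgraph_iso G I"
proof -
  interpret bidirected_digraph "dg G" "opp G" by (rule bi)
  obtain f k where f: "bij_betw f (verts (dg G)) (verts (dg H))"
    and k: "bij_betw k (arcs (dg G)) (arcs (dg H))"
    and c: "\<And>a. a \<in> arcs (dg G) \<Longrightarrow> tail (dg H) (k a) = f (tail (dg G) a) \<and>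
        head (dg H) (k a) = f (head (dg G) a) \<and> opp H (k a) = k (opp G a)"
    and l: "\<And>v. v \<in> verts_of_valence G 1 \<Longrightarrow> label H (f v) = label G v"
    using 1 unfolding lgraph_iso_def by blast
  obtain f' k' where f': "bij_betw f' (verts (dg H)) (verts (dg I))"
    and k': "bij_betw k' (arcs (dg H)) (arcs (dg I))"
    and c': "\<And>a. a \<in> arcs (dg H) \<Longrightarrow> tail (dg I) (k' a) = f' (tail (dg H) a) \<and>
        head (dg I) (k' a) = f' (head (dg H) a) \<and> opp I (k' a) = k' (opp H a)"
    and l': "\<And>v. v \<in> verts_of_valence H 1 \<Longrightarrow> label I (f' v) = label H v"
    using 2 unfolding lgraph_iso_def by blast
  have kA: "k a \<in> arcs (dg H)" if "a \<in> arcs (dg G)" for a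
    using k that by (auto simp: bij_betw_def)
  have fV: "f v \<in> verts_of_valence H 1" if "v \<in> verts_of_valence G 1" for v
    using lgraph_iso_valence[OF wf f k _] c f that
    by (auto simp: verts_of_valence_def bij_betw_def)
  have "bij_betw (f' \<circ> f) (verts (dg G)) (verts (dg I))"
    "bij_betw (k' \<circ> k) (arcs (dg G)) (arcs (dg I))"
    using f f' k k' by (blast intro: bij_betw_trans)+
  then have "bij_betw (f' \<circ> f) (verts (dg G)) (verts (dg I)) \<and>
      bij_betw (k' \<circ> k) (arcs (dg G)) (arcs (dg I)) \<and>
      (\<forall>a \<in> arcs (dg G). tail (dg I) ((k' \<circ> k) a) = (f' \<circ> f) (tail (dg G) a) \<and>
        head (dg I) ((k' \<circ> k) a) = (f' \<circ> f) (head (dg G) a) \<and>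
        opp I ((k' \<circ> k) a) = (k' \<circ> k) (opp G a)) \<and>
      (\<forall>v \<in> verts_of_valence G 1. label I ((f' \<circ> f) v) = label G v)"
    using fV kA by (simp add: c c' l l' del: One_nat_def)
  then show ?thesis unfolding lgraph_iso_def by blast
qed

lemma lgraph_iso_relabel:
  "lgraph_iso G H \<Longrightarrow> lgraph_iso (relabel \<pi> G) (relabel \<pi> H)"
  unfolding lgraph_iso_def relabel_def verts_of_valence_def by fastforce

lemma relabel_relabel: "relabel \<pi> (relabel \<sigma> G) = relabel (\<pi> \<circ> \<sigma>) G"
  by (simp add: relabel_def comp_assoc)

lemma relabel_id: "relabel id G = G"
  by (simp add: relabel_def)

lemma dg_relabel: "dg (relabel \<pi> G) = dg G" "opp (relabel \<pi> G) = opp G"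
  by (simp_all add: relabel_def)

lemma lgraphsD:
  assumes "G \<in> lgraphs g p"
  shows "bidirected_digraph (dg G) (opp G)" "wf_digraph (dg G)"
  using assms by (auto simp: lgraphs_def fin_digraph_def)

lemma equiv_iso_rel: "equiv (lgraphs g p) (iso_rel g p)"
proof (rule equivI)
  show "iso_rel g p \<subseteq> lgraphs g p \<times> lgraphs g p" by (auto simp: iso_rel_def)
  show "refl_on (lgraphs g p) (iso_rel g p)"
    by (auto simp: refl_on_def iso_rel_def lgraph_iso_refl)
  show "sym (iso_rel g p)"
    by (auto simp: sym_def iso_rel_def intro: lgraph_iso_sym lgraphsD)
  show "trans (iso_rel g p)"
    unfolding trans_def iso_rel_def by (auto intro: lgraph_iso_trans lgraphsD)
qed

lemma equiv_iso_rel_sym: "equiv (lgraphs g p) (iso_rel_sym g p)"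
proof (rule equivI)
  show "iso_rel_sym g p \<subseteq> lgraphs g p \<times> lgraphs g p" by (auto simp: iso_rel_sym_def)
  show "refl_on (lgraphs g p) (iso_rel_sym g p)"
    unfolding refl_on_def iso_rel_sym_def
    using lgraph_iso_refl relabel_id permutes_id by (fastforce intro: exI[of _ id])
  show "sym (iso_rel_sym g p)"
  proof (rule symI)
    fix G H assume "(G, H) \<in> iso_rel_sym g p"
    then obtain \<pi> where G: "G \<in> lgraphs g p" and H: "H \<in> lgraphs g p"
      and \<pi>: "\<pi> permutes {1..p}" and i: "lgraph_iso (relabel \<pi> G) H"
      by (auto simp: iso_rel_sym_def)
    have "lgraph_iso H (relabel \<pi> G)"
      using i lgraphsD[OF G] lgraphsD[OF H] by (auto intro!: lgraph_iso_sym simp: dg_relabel)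
    then have "lgraph_iso (relabel (inv \<pi>) H) G"
      using lgraph_iso_relabel[of H "relabel \<pi> G" "inv \<pi>"] permutes_inv_o[OF \<pi>]
      by (simp add: relabel_relabel relabel_id)
    then show "(H, G) \<in> iso_rel_sym g p"
      using G H permutes_inv[OF \<pi>] by (auto simp: iso_rel_sym_def)
  qed
  show "trans (iso_rel_sym g p)"
  proof (rule transI)
    fix G H I assume "(G, H) \<in> iso_rel_sym g p" "(H, I) \<in> iso_rel_sym g p"
    then obtain \<pi> \<sigma> where G: "G \<in> lgraphs g p" and I: "I \<in> lgraphs g p"
      and p: "\<pi> permutes {1..p}" "\<sigma> permutes {1..p}"
      and i: "lgraph_iso (relabel \<pi> G) H" "lgraph_iso (relabel \<sigma> H) I"
      by (auto simp: iso_rel_sym_def)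
    have "lgraph_iso (relabel (\<sigma> \<circ> \<pi>) G) (relabel \<sigma> H)"
      using lgraph_iso_relabel[OF i(1), of \<sigma>] by (simp add: relabel_relabel)
    then have "lgraph_iso (relabel (\<sigma> \<circ> \<pi>) G) I"
      using i(2) lgraphsD[OF G] by (auto intro: lgraph_iso_trans simp: dg_relabel)
    then show "(G, I) \<in> iso_rel_sym g p"
      using G I permutes_compose[OF p] by (auto simp: iso_rel_sym_def)
  qed
qed

definition interior_edge :: "lgraph \<Rightarrow> nat \<Rightarrow> bool" where
  "interior_edge G a \<longleftrightarrow> a \<in> arcs (dg G) \<and>
     valence G (tail (dg G) a) = 3 \<and> valence G (head (dg G) a) = 3"

text \<open>The half-edges, other than those of the edge itself, at the endpoints of the edge of \<open>a\<close>.\<close>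

definition side_half_edges :: "lgraph \<Rightarrow> nat \<Rightarrow> nat set" where
  "side_half_edges G a =
     (out_arcs (dg G) (tail (dg G) a) \<union> out_arcs (dg G) (head (dg G) a)) - {a, opp G a}"

definition splitting :: "nat set \<Rightarrow> (nat \<Rightarrow> nat) \<Rightarrow> nat \<Rightarrow> nat \<Rightarrow> nat set set" where
  "splitting S t u v = {{b \<in> S. t b = u}, {b \<in> S. t b = v}}"

text \<open>
  Collapsing the edge of \<open>a\<close> and reopening the valence-4 vertex amounts to redistributing the four
  half-edges in \<open>S\<close> over the two endpoints \<open>u\<close>, \<open>v\<close>, in pairs that differ from the old ones.
  The function \<open>t\<close> is the new attachment of half-edges to vertices.
\<close>

definition whitehead_move :: "lgraph \<Rightarrow> nat \<Rightarrow> lgraph \<Rightarrow> bool" where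
  "whitehead_move G a H \<longleftrightarrow>
     (let u = tail (dg G) a; v = head (dg G) a; S = side_half_edges G a in
      interior_edge G a \<and> u \<noteq> v \<and>
      (\<exists>t. (\<forall>b. b \<notin> S \<longrightarrow> t b = tail (dg G) b) \<and>
           t ` S \<subseteq> {u, v} \<and> card {b \<in> S. t b = u} = 2 \<and> card {b \<in> S. t b = v} = 2 \<and>
           splitting S t u v \<noteq> splitting S (tail (dg G)) u v \<and>
           H = G\<lparr>dg := (dg G)\<lparr>tail := t, head := t \<circ> opp G\<rparr>\<rparr>))"

inductive whitehead_moves :: "lgraph \<Rightarrow> nat list \<Rightarrow> lgraph \<Rightarrow> bool" where
  Nil: "whitehead_moves G [] G"
| Cons: "whitehead_move G a G' \<Longrightarrow> whitehead_moves G' as H \<Longrightarrow> whitehead_moves G (a # as) H"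

definition disjoint_edges :: "lgraph \<Rightarrow> nat \<Rightarrow> nat \<Rightarrow> bool" where
  "disjoint_edges G a b \<longleftrightarrow>
     {tail (dg G) a, head (dg G) a} \<inter> {tail (dg G) b, head (dg G) b} = {}"

text \<open>
  A Whitehead move leaves the endpoints of every edge disjoint from the moved one unchanged, so it
  suffices to require disjointness in the initial graph.
\<close>

definition simultaneous_move :: "lgraph \<Rightarrow> lgraph \<Rightarrow> bool" where
  "simultaneous_move G H \<longleftrightarrow>
     (\<exists>as. sorted_wrt (disjoint_edges G) as \<and> whitehead_moves G as H)"

text \<open>
  Below, \<open>Q\<close> is a set of classes of graphs, either \<open>Graph g p\<close> or \<open>Graph_mod_Sym g p\<close>.
  The distance is \<open>\<infinity>\<close> if no sequence of moves exists.
\<close>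

definition move_on :: "lgraph set set \<Rightarrow> lgraph set \<Rightarrow> lgraph set \<Rightarrow> bool" where
  "move_on Q X Y \<longleftrightarrow> X \<in> Q \<and> Y \<in> Q \<and> (\<exists>G\<in>X. \<exists>H\<in>Y. simultaneous_move G H)"

definition dist_S :: "lgraph set set \<Rightarrow> lgraph set \<Rightarrow> lgraph set \<Rightarrow> enat" where
  "dist_S Q X Y = (INF n \<in> {n. (move_on Q ^^ n) X Y}. enat n)"

definition diam_S :: "lgraph set set \<Rightarrow> ereal" where
  "diam_S Q = ereal_of_enat (SUP X\<in>Q. SUP Y\<in>Q. dist_S Q X Y)"

end

theory Submission
  imports Defs "HOL-Library.Multiset" "HOL-Real_Asymp.Real_Asymp"
begin

text \<open>
  A graph of rank \<open>g\<close> with \<open>p\<close> legs is a rooted binary tree on \<open>2 g + p\<close> labelled ends, glued along \<open>g\<close>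
  pairs of ends (cut the edges outside a spanning tree of the trivalent vertices).  Moves on the tree are
  moves on the graph, so the upper bound only concerns labelled trees with \<open>n\<close> leaves.  Parallel tree
  contraction brings such a tree to height \<open>O(log n)\<close> in \<open>O(log n)\<close> simultaneous moves.  A tree of height
  \<open>h\<close> is then turned into the binary trie of its labels by a radix sort, pipelined over all levels, in
  \<open>O(h + log n)\<close> moves, and the trie depends only on the set of labels.

  For the lower bound, the edges moved simultaneously form a matching, so distances between vertices grow
  at most by a factor 3.  The trie gives graphs of diameter \<open>O(log (g + p))\<close>, whereas caterpillars have
  linear diameter.  Bounded \<open>g + p\<close> needs two different graphs in each case: Whitehead moves on a
  caterpillar that destroy a loop (\<open>g > 0\<close>) or separate a vertex from all legs (\<open>g = 0\<close>).
\<close>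

text \<open>The gluing pattern is part of the labels, so graphs with equal labelled trees are
  isomorphic. Steps are reversible, so a common target yields a path between any two graphs. The
  obstacle is simultaneity. Sorting by a single bit needs a number of rounds proportional to the
  height, and treating the bits one after another would cost a squared logarithm. A node can however
  start on a bit as soon as its children are sorted by it, while they already work on the next one;
  height and number of bits then add up instead of multiplying. Activities in different subtrees
  have to be synchronised for this: idle steps are allowed, and every local rearrangement is
  stretched to exactly six steps. For the lower bound put \<open>N = g + p\<close>. Leading from
  diameter \<open>O(log N)\<close> to diameter of order \<open>N\<close>, \<open>j\<close> moves
  need \<open>3 ^ j\<close> of order at least \<open>N / log N\<close>. For large \<open>N\<close>
  this exceeds \<open>sqrt N\<close>, so dividing by the logarithm costs only a constant factor in
  \<open>j\<close>.\<close>

section \<open>Labelled binary trees and parallel rotations\<close>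

datatype 'a btree = Leaf 'a | Node "'a btree" "'a btree"

primrec leaf_list :: "'a btree \<Rightarrow> 'a list" where
  "leaf_list (Leaf x) = [x]"
| "leaf_list (Node l r) = leaf_list l @ leaf_list r"

primrec ht :: "'a btree \<Rightarrow> nat" where
  "ht (Leaf x) = 0"
| "ht (Node l r) = Suc (max (ht l) (ht r))"

text \<open>Flattening of a tree of trees: the outer tree is the contracted one, its leaves are the
  bags into which parts of the original tree have been contracted.\<close>

primrec join :: "'a btree btree \<Rightarrow> 'a btree" where
  "join (Leaf t) = t"
| "join (Node l r) = Node (join l) (join r)"

abbreviation nleaves :: "'a btree \<Rightarrow> nat" where
  "nleaves t \<equiv> length (leaf_list t)"

text \<open>
  The order of siblings is immaterial in the graph, so exchanging them is free; the rule \<open>rot\<close> is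
  the Whitehead move on the edge between the two outer nodes.
\<close>

inductive step :: "'a btree \<Rightarrow> 'a btree \<Rightarrow> bool" where
  leaf: "step (Leaf x) (Leaf x)"
| node: "step l l' \<Longrightarrow> step r r' \<Longrightarrow> step (Node l r) (Node l' r')"
| swap: "step l l' \<Longrightarrow> step r r' \<Longrightarrow> step (Node l r) (Node r' l')"
| rot: "step a a' \<Longrightarrow> step b b' \<Longrightarrow> step c c' \<Longrightarrow>
    step (Node (Node a b) c) (Node (Node a' c') b')"

lemma nleaves_pos [simp]: "0 < nleaves t"
  by (induction t) auto

lemma nleaves_eq_1_iff: "nleaves t = 1 \<longleftrightarrow> (\<exists>x. t = Leaf x)"
proof (cases t)
  case (Node l r)
  then show ?thesis
    using nleaves_pos[of l] nleaves_pos[of r] by (simp del: nleaves_pos length_greater_0_conv)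
qed auto

lemma nleaves_Node_ge_2: "2 \<le> nleaves (Node l r)"
  using nleaves_pos[of l] nleaves_pos[of r] by (simp del: nleaves_pos length_greater_0_conv)

lemma step_refl: "step t t"
  by (induction t) (auto intro: step.intros)

lemma step_sym: "step t t' \<Longrightarrow> step t' t"
  by (induction rule: step.induct) (auto intro: step.intros)

lemma step_map: "step t t' \<Longrightarrow> step (map_btree f t) (map_btree f t')"
  by (induction rule: step.induct) (auto intro: step.intros)

lemma step_join: "step t t' \<Longrightarrow> step (join t) (join t')"
  by (induction rule: step.induct) (auto intro: step.intros step_refl)

abbreviation steps :: "nat \<Rightarrow> 'a btree \<Rightarrow> 'a btree \<Rightarrow> bool" where
  "steps k \<equiv> step ^^ k"

lemma steps_fun: "steps k t t' \<longleftrightarrow> (\<exists>f. f 0 = t \<and> f k = t' \<and> (\<forall>i<k. step (f i) (f (Suc i))))"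
  by (rule relpowp_fun_conv)

text \<open>\<open>steps k\<close> means exactly \<open>k\<close> steps. Idle steps bring
  computations in different subtrees to a common length, so that they can run side by side under
  \<open>steps_node\<close>.\<close>

lemma steps_refl: "steps k t t"
  by (induction k) (auto intro: step_refl relcomppI)

lemma steps_add: "steps j s t \<Longrightarrow> steps k t u \<Longrightarrow> steps (j + k) s u"
  by (auto simp: relpowp_add)

lemma steps_sym: "steps k s t \<Longrightarrow> steps k t s"
proof (induction k arbitrary: t)
  case (Suc k)
  then obtain u where "steps k s u" "step u t" by auto
  with Suc.IH have "steps (1 + k) t s"
    by (intro steps_add[of 1 t u]) (auto intro: step_sym)
  then show ?case by (metis plus_1_eq_Suc)
qed auto

lemma steps_join: "steps k t t' \<Longrightarrow> steps k (join t) (join t')"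
  by (induction k arbitrary: t') (auto intro: step_join relcomppI)

lemma steps_node:
  assumes "steps k l l'" "steps k r r'"
  shows "steps k (Node l r) (Node l' r')"
proof -
  obtain f g where "f 0 = l" "f k = l'" "\<forall>i<k. step (f i) (f (Suc i))"
    "g 0 = r" "g k = r'" "\<forall>i<k. step (g i) (g (Suc i))"
    using assms unfolding steps_fun by blast
  then show ?thesis
    unfolding steps_fun by (intro exI[of _ "\<lambda>i. Node (f i) (g i)"]) (auto intro: step.node)
qed

section \<open>Local rearrangements in six steps\<close>

lemma steps3: "step t0 t1 \<Longrightarrow> step t1 t2 \<Longrightarrow> step t2 t3 \<Longrightarrow> steps 3 t0 t3"
  by (auto simp: numeral_eq_Suc)

lemma steps6:
  assumes "step t0 t1" "step t1 t2" "step t2 t3" "step t3 t4" "step t4 t5" "step t5 t6"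
  shows "steps 6 t0 t6"
  using steps_add[OF steps3 steps3, OF assms] by simp

lemma steps6E:
  assumes "steps 6 s t"
  obtains s1 s2 s3 s4 s5 where "step s s1" "step s1 s2" "step s2 s3" "step s3 s4" "step s4 s5" "step s5 t"
  using assms by (auto simp: numeral_eq_Suc)

lemma steps6_swap:
  assumes "steps 6 a a'" "steps 6 b b'"
  shows "steps 6 (Node a b) (Node b' a')"
proof -
  obtain a5 b5 where "steps 5 a a5" "step a5 a'" "steps 5 b b5" "step b5 b'"
    using assms unfolding relpowp_add[of 5 1 step, simplified] by auto
  then have "steps (5 + 1) (Node a b) (Node b' a')"
    by (intro steps_add[OF steps_node]) (auto intro: step.swap)
  then show ?thesis by simp
qed

text \<open>The rebracketings needed in contraction rounds and in exchanges with one empty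
  grandchild. Up to swaps of siblings each is one rotation; three steps suffice and the root idles
  afterwards, while the subtrees carry out their own six steps.\<close>

lemma steps6_assoc:
  assumes "steps 6 a a'" "steps 6 b b'" "steps 6 c c'"
  shows "steps 6 (Node (Node a b) c) (Node (Node a' c') b')"
    and "steps 6 (Node (Node a b) c) (Node a' (Node b' c'))"
    and "steps 6 (Node a (Node b c)) (Node (Node a' b') c')"
    and "steps 6 (Node a (Node b c)) (Node (Node a' c') b')"
    and "steps 6 (Node a (Node b c)) (Node b' (Node a' c'))"
proof -
  from assms(1) obtain a1 a2 a3 a4 a5 where a: "step a a1" "step a1 a2" "step a2 a3" "step a3 a4"
    "step a4 a5" "step a5 a'" by (rule steps6E)
  from assms(2) obtain b1 b2 b3 b4 b5 where b: "step b b1" "step b1 b2" "step b2 b3" "step b3 b4"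
    "step b4 b5" "step b5 b'" by (rule steps6E)
  from assms(3) obtain c1 c2 c3 c4 c5 where c: "step c c1" "step c1 c2" "step c2 c3" "step c3 c4"
    "step c4 c5" "step c5 c'" by (rule steps6E)
  note abc = a b c
  show "steps 6 (Node (Node a b) c) (Node (Node a' c') b')"
    by (rule steps6[of _ "Node (Node a1 c1) b1" "Node (Node a2 c2) b2" "Node (Node a3 c3) b3"
          "Node (Node a4 c4) b4" "Node (Node a5 c5) b5"]) (intro step.intros abc)+
  show "steps 6 (Node (Node a b) c) (Node a' (Node b' c'))"
    by (rule steps6[of _ "Node (Node b1 a1) c1" "Node (Node b2 c2) a2" "Node a3 (Node b3 c3)"
          "Node a4 (Node b4 c4)" "Node a5 (Node b5 c5)"])
      ((rule step.rot step.node step.swap; intro abc step.node step.swap)+)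
  show "steps 6 (Node a (Node b c)) (Node (Node a' b') c')"
    by (rule steps6[of _ "Node (Node b1 c1) a1" "Node (Node b2 a2) c2" "Node (Node a3 b3) c3"
          "Node (Node a4 b4) c4" "Node (Node a5 b5) c5"])
      ((rule step.rot step.node step.swap; intro abc step.node step.swap)+)
  show "steps 6 (Node a (Node b c)) (Node (Node a' c') b')"
    by (rule steps6[of _ "Node (Node c1 b1) a1" "Node (Node c2 a2) b2" "Node (Node a3 c3) b3"
          "Node (Node a4 c4) b4" "Node (Node a5 c5) b5"])
      ((rule step.rot step.node step.swap; intro abc step.node step.swap)+)
  show "steps 6 (Node a (Node b c)) (Node b' (Node a' c'))"
    by (rule steps6[of _ "Node (Node c1 b1) a1" "Node (Node c2 a2) b2" "Node b3 (Node a3 c3)"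
          "Node b4 (Node a4 c4)" "Node b5 (Node a5 c5)"])
      ((rule step.rot step.node step.swap; intro abc step.node step.swap)+)
qed

text \<open>This exchange fixes the constant six: three rotations, each followed by swaps that bring
  the right subtrees into the position where \<open>rot\<close> acts or, at the end, into the
  desired order.\<close>

lemma steps6_exchange:
  assumes "steps 6 a a'" "steps 6 b b'" "steps 6 c c'" "steps 6 d d'"
  shows "steps 6 (Node (Node a b) (Node c d)) (Node (Node a' c') (Node b' d'))"
proof -
  from assms(1) obtain a1 a2 a3 a4 a5 where a: "step a a1" "step a1 a2" "step a2 a3" "step a3 a4"
    "step a4 a5" "step a5 a'" by (rule steps6E)
  from assms(2) obtain b1 b2 b3 b4 b5 where b: "step b b1" "step b1 b2" "step b2 b3" "step b3 b4"
    "step b4 b5" "step b5 b'" by (rule steps6E)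
  from assms(3) obtain c1 c2 c3 c4 c5 where c: "step c c1" "step c1 c2" "step c2 c3" "step c3 c4"
    "step c4 c5" "step c5 c'" by (rule steps6E)
  from assms(4) obtain d1 d2 d3 d4 d5 where d: "step d d1" "step d1 d2" "step d2 d3" "step d3 d4"
    "step d4 d5" "step d5 d'" by (rule steps6E)
  note abcd = a b c d
  show ?thesis
  proof (rule steps6)
    show "step (Node (Node a b) (Node c d)) (Node (Node a1 (Node c1 d1)) b1)"
      by (intro step.rot step.node abcd)
    show "step \<dots> (Node (Node (Node c2 d2) a2) b2)"
      by (rule step.node[OF step.swap[OF _ step.node]]) (intro abcd)+
    show "step \<dots> (Node (Node (Node c3 a3) d3) b3)"
      by (rule step.node[OF step.rot]) (intro abcd)+
    show "step \<dots> (Node (Node d4 (Node c4 a4)) b4)"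
      by (rule step.node[OF step.swap[OF step.node]]) (intro abcd)+
    show "step \<dots> (Node (Node d5 b5) (Node c5 a5))"
      by (rule step.rot) (intro step.node abcd)+
    show "step \<dots> (Node (Node a' c') (Node b' d'))"
      by (rule step.swap[OF step.swap step.swap]) (intro abcd)+
  qed
qed

subsection \<open>Balancing a tree\<close>

text \<open>
  Parallel tree contraction: a cherry becomes a single bag without any move, and consecutive leaves
  hanging off a path are paired by one rotation.  The claim \<open>size' \<le> (3 size - 1) / 4\<close> is the
  linear bound that survives all cases of the induction.
\<close>

lemma contraction_round:
  fixes t :: "'a btree"
  assumes "2 \<le> nleaves t"
  shows "\<exists>T :: 'a btree btree. steps 6 t (join T) \<and> (\<forall>b\<in>set (leaf_list T). ht b \<le> 1) \<and>
    4 * nleaves T + 1 \<le> 3 * nleaves t"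
  using assms
proof (induction "size t" arbitrary: t rule: less_induct)
  case less
  let ?P = "\<lambda>(t :: 'a btree) T. steps 6 t (join T) \<and> (\<forall>b\<in>set (leaf_list T). ht b \<le> 1) \<and>
    4 * nleaves T + 1 \<le> 3 * nleaves t"
  \<comment> \<open>A single leaf misses the claimed bound by two, so it enters with the weaker
    bound \<open>4 \<le> 3 + 1\<close>.\<close>
  have ex: "\<exists>T :: 'a btree btree. steps 6 s (join T) \<and> (\<forall>b\<in>set (leaf_list T). ht b \<le> 1) \<and>
      4 * nleaves T \<le> 3 * nleaves s + 1 \<and> (nleaves s \<noteq> 1 \<longrightarrow> 4 * nleaves T + 1 \<le> 3 * nleaves s)"
    if sz: "size s < size t" for s :: "'a btree"
  proof (cases s)
    case (Leaf x)
    then show ?thesis by (intro exI[of _ "Leaf (Leaf x)"]) (auto intro: steps_refl)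
  next
    case (Node l r)
    have "2 \<le> nleaves s"
      using nleaves_Node_ge_2 Node by blast
    then obtain T where "?P s T" using less.hyps[OF sz] by blast
    then show ?thesis by auto
  qed
  \<comment> \<open>If \<open>x\<close> or \<open>y\<close> is a leaf, one rotation makes it the
    sibling of \<open>b\<close>, and the two become a bag. Otherwise \<open>x\<close> and
    \<open>y\<close> each save one unit: one pays for the unpaired \<open>b\<close>, the other is
    the new saving.\<close>
  have pair: "(\<exists>T. ?P (Node (Leaf b) (Node x y)) T) \<and> (\<exists>T. ?P (Node (Node x y) (Leaf b)) T)"
    if sz: "size x < size t" "size y < size t" for b x y
  proof -
    obtain X where X: "steps 6 x (join X)" "\<forall>b\<in>set (leaf_list X). ht b \<le> 1"
      "4 * nleaves X \<le> 3 * nleaves x + 1" "nleaves x \<noteq> 1 \<longrightarrow> 4 * nleaves X + 1 \<le> 3 * nleaves x"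
      using ex[OF sz(1)] by blast
    obtain Y where Y: "steps 6 y (join Y)" "\<forall>b\<in>set (leaf_list Y). ht b \<le> 1"
      "4 * nleaves Y \<le> 3 * nleaves y + 1" "nleaves y \<noteq> 1 \<longrightarrow> 4 * nleaves Y + 1 \<le> 3 * nleaves y"
      using ex[OF sz(2)] by blast
    consider a where "x = Leaf a" | a where "y = Leaf a"
      | "nleaves x \<noteq> 1" "nleaves y \<noteq> 1"
      unfolding nleaves_eq_1_iff by blast
    then show ?thesis
    proof cases
      case 1
      have "?P (Node (Leaf b) (Node x y)) (Node (Leaf (Node (Leaf b) (Leaf a))) Y)"
        using Y steps6_assoc(3)[OF steps_refl steps_refl Y(1), of "Leaf b" "Leaf a"] 1 by auto
      moreover have "?P (Node (Node x y) (Leaf b)) (Node (Leaf (Node (Leaf a) (Leaf b))) Y)"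
        using Y steps6_assoc(1)[OF steps_refl Y(1) steps_refl, of "Leaf a" "Leaf b"] 1 by auto
      ultimately show ?thesis by blast
    next
      case 2
      have "?P (Node (Leaf b) (Node x y)) (Node (Leaf (Node (Leaf b) (Leaf a))) X)"
        using X steps6_assoc(4)[OF steps_refl X(1) steps_refl, of "Leaf b" "Leaf a"] 2 by auto
      moreover have "?P (Node (Node x y) (Leaf b)) (Node X (Leaf (Node (Leaf a) (Leaf b))))"
        using X steps6_assoc(2)[OF X(1) steps_refl steps_refl, of "Leaf a" "Leaf b"] 2 by auto
      ultimately show ?thesis by blast
    next
      case 3
      have "?P (Node (Leaf b) (Node x y)) (Node (Leaf (Leaf b)) (Node X Y))"
        using X Y 3 by (auto intro!: steps_node steps_refl)
      moreover have "?P (Node (Node x y) (Leaf b)) (Node (Node X Y) (Leaf (Leaf b)))"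
        using X Y 3 by (auto intro!: steps_node steps_refl)
      ultimately show ?thesis by blast
    qed
  qed
  obtain l r where t: "t = Node l r" using less.prems by (cases t) auto
  consider a b where "l = Leaf a" "r = Leaf b" | b x y where "l = Leaf b" "r = Node x y"
    | b x y where "l = Node x y" "r = Leaf b"
    | "nleaves l \<noteq> 1" "nleaves r \<noteq> 1"
    unfolding nleaves_eq_1_iff by (metis btree.exhaust)
  then show ?case
  proof cases
    case 1
    then show ?thesis using t by (intro exI[of _ "Leaf t"]) (auto intro: steps_refl)
  next
    case 2
    then show ?thesis using pair[of x y b] t by auto
  next
    case 3
    then show ?thesis using pair[of x y b] t by auto
  next
    case 4
    obtain L R where "steps 6 l (join L)" "\<forall>b\<in>set (leaf_list L). ht b \<le> 1"
      "4 * nleaves L + 1 \<le> 3 * nleaves l"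
      "steps 6 r (join R)" "\<forall>b\<in>set (leaf_list R). ht b \<le> 1" "4 * nleaves R + 1 \<le> 3 * nleaves r"
      using ex[of l] ex[of r] 4 t by auto
    then show ?thesis
      using t by (intro exI[of _ "Node L R"]) (auto intro!: steps_node)
  qed
qed

lemma join_map_join: "join (join T) = join (map_btree join T)"
  by (induction T) auto

lemma leaf_list_map: "leaf_list (map_btree f t) = map f (leaf_list t)"
  by (induction t) auto

lemma ht_join: "\<forall>b\<in>set (leaf_list T). ht b \<le> k \<Longrightarrow> ht (join T) \<le> ht T + k"
  by (induction T) fastforce+

lemma leaf_list_join_subset: "set (leaf_list (join T)) = (\<Union>b\<in>set (leaf_list T). set (leaf_list b))"
  by (induction T) auto

lemma step_leaves: "step s t \<Longrightarrow> mset (leaf_list s) = mset (leaf_list t)"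
  by (induction rule: step.induct) auto

lemma steps_leaves: "steps k s t \<Longrightarrow> mset (leaf_list s) = mset (leaf_list t)"
  by (induction k arbitrary: t) (auto dest: step_leaves)

text \<open>A round keeps at most three quarters of the bags and merges them along trees of height
  at most one, so it costs one unit of height. Rounds compose because \<open>join\<close> turns
  steps of the contracted tree into steps of the original one.\<close>

lemma contraction:
  fixes T :: "'a btree btree"
  assumes "\<forall>b\<in>set (leaf_list T). ht b \<le> k" "real (nleaves T) \<le> (4 / 3) ^ r"
  shows "\<exists>t. steps (6 * r) (join T) t \<and> ht t \<le> k + r"
  using assms
proof (induction r arbitrary: T k)
  case 0
  then have "nleaves T = 1" using nleaves_pos[of T] by (simp del: nleaves_pos length_greater_0_conv)
  then obtain b where "T = Leaf b" unfolding nleaves_eq_1_iff by blast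
  then show ?case using 0 by auto
next
  case (Suc r)
  show ?case
  proof (cases T)
    case (Leaf b)
    then show ?thesis using Suc.prems steps_refl by (intro exI[of _ b]) (auto simp: trans_le_add1)
  next
    case (Node x y)
    have "2 \<le> nleaves T"
      using nleaves_Node_ge_2 Node by blast
    then obtain U :: "'a btree btree btree" where U: "steps 6 T (join U)"
      "\<forall>b\<in>set (leaf_list U). ht b \<le> 1" "4 * nleaves U + 1 \<le> 3 * nleaves T"
      using contraction_round by blast
    \<comment> \<open>The round groups the bags into trees of bags; flattening each of these
      restores the type for the induction.\<close>
    define V where "V = map_btree join U"
    have lv: "set (leaf_list (join U)) = set (leaf_list T)"
      using steps_leaves[OF U(1)] by (metis mset_eq_setD)
    have "real (nleaves V) \<le> (4 / 3) ^ r"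
      using U(3) Suc.prems(2) by (simp add: V_def leaf_list_map)
    moreover have "\<forall>b\<in>set (leaf_list V). ht b \<le> Suc k"
    proof
      fix b assume "b \<in> set (leaf_list V)"
      then obtain B where B: "B \<in> set (leaf_list U)" "b = join B" by (auto simp: V_def leaf_list_map)
      have "\<forall>c\<in>set (leaf_list B). ht c \<le> k"
        using Suc.prems(1) lv B(1) by (auto simp: leaf_list_join_subset)
      then show "ht b \<le> Suc k" using ht_join[of B k] U(2) B by fastforce
    qed
    ultimately obtain t where t: "steps (6 * r) (join V) t" "ht t \<le> Suc k + r"
      using Suc.IH by blast
    have "steps 6 (join T) (join V)"
      using steps_join[OF U(1)] by (simp add: V_def join_map_join)
    from steps_add[OF this t(1)] t(2) show ?thesis by (auto intro!: exI[of _ t])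
  qed
qed

lemma balance:
  fixes t :: "'a btree"
  assumes "real (nleaves t) \<le> (4 / 3) ^ r"
  shows "\<exists>t'. steps (6 * r) t t' \<and> ht t' \<le> r"
proof -
  have "join (map_btree Leaf t) = t" by (induction t) auto
  then show ?thesis
    using contraction[of "map_btree Leaf t" 0 r] assms by (auto simp: leaf_list_map)
qed

subsection \<open>Pipelined radix sort\<close>

text \<open>\<open>None\<close> is a subtree without labels. A node with an empty child would have
  valence two in the graph and is suppressed.\<close>

fun onode :: "'a btree option \<Rightarrow> 'a btree option \<Rightarrow> 'a btree option" where
  "onode None y = y"
| "onode (Some x) None = Some x"
| "onode (Some x) (Some y) = Some (Node x y)"

abbreviation osteps :: "nat \<Rightarrow> 'a btree option \<Rightarrow> 'a btree option \<Rightarrow> bool" where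
  "osteps k \<equiv> rel_option (steps k)"

lemma onode_None [simp]: "onode x None = x"
  by (cases x) auto

lemma osteps_onode: "osteps k x x' \<Longrightarrow> osteps k y y' \<Longrightarrow> osteps k (onode x y) (onode x' y')"
  by (elim option.rel_cases) (auto intro: steps_node)

text \<open>One empty grandchild turns the exchange into a rebracketing from
  \<open>steps6_assoc\<close>; with two empty ones at most a swap is left.\<close>

lemma osteps_exchange:
  assumes "osteps 6 a a'" "osteps 6 b b'" "osteps 6 c c'" "osteps 6 d d'"
  shows "osteps 6 (onode (onode a b) (onode c d)) (onode (onode a' c') (onode b' d'))"
  using assms
  by (cases a; cases b; cases c; cases d)
    (auto simp: option_rel_Some1 rel_option_None1 simp del: relpowp.simps
      intro: steps_node steps6_assoc steps6_exchange steps6_swap)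

text \<open>
  The state of the sorting process: \<open>P\<close> is the set of labels under consideration, \<open>i\<close> the next bit
  to be sorted by, and the budget \<open>j\<close> says how many bits have been sorted by at the root.  A deeper
  subtree is always one bit ahead of its parent, so that increasing the budget by one amounts to
  exchanging two of four grandchildren, simultaneously at all levels.
\<close>

function radix :: "(nat \<Rightarrow> 'a \<Rightarrow> bool) \<Rightarrow> int \<Rightarrow> nat \<Rightarrow> 'a set \<Rightarrow> 'a btree \<Rightarrow> 'a btree option" where
  "radix \<beta> j i P (Leaf a) = (if a \<in> P then Some (Leaf a) else None)"
| "radix \<beta> j i P (Node l r) =
    (if 0 < j then onode (radix \<beta> (j - 1) (Suc i) (P \<inter> {a. \<beta> i a}) (Node l r))
        (radix \<beta> (j - 1) (Suc i) (P \<inter> {a. \<not> \<beta> i a}) (Node l r))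
     else onode (radix \<beta> (j + 1) i P l) (radix \<beta> (j + 1) i P r))"
  by pat_completeness auto
termination
  by (relation "measures [\<lambda>(\<beta>, j, i, P, t). size t, \<lambda>(\<beta>, j, i, P, t). nat j]") auto

declare radix.simps(2) [simp del]

lemma radix_split:
  assumes "0 < j"
  shows "radix \<beta> j i P t = onode (radix \<beta> (j - 1) (Suc i) (P \<inter> {a. \<beta> i a}) t)
        (radix \<beta> (j - 1) (Suc i) (P \<inter> {a. \<not> \<beta> i a}) t)"
  using assms by (cases t) (auto simp: radix.simps(2))

text \<open>At depth \<open>k\<close> the budget is \<open>j + k\<close>. If \<open>j\<close> is at
  most minus the height, it is never positive at an inner node, so nothing has been split by a bit
  yet.\<close>

lemma radix_start:
  "j + int (ht t) \<le> 0 \<Longrightarrow> set (leaf_list t) \<subseteq> P \<Longrightarrow> radix \<beta> j i P t = Some t"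
proof (induction t arbitrary: j)
  case (Node l r)
  then show ?case by (auto simp: radix.simps(2) max_def split: if_splits)
qed auto

text \<open>At budget 0 the root still separates the old children, each of which is split by bit
  \<open>i\<close>. At budget 1 the root separates the values of bit \<open>i\<close>, and each part
  is assembled from the two old children. The passage is an exchange of the two middle
  grandchildren, during which all grandchildren pass from budget 0 to 1 for the next bit. At any
  other budget the change takes place further down.\<close>

lemma radix_step: "osteps 6 (radix \<beta> j i P t) (radix \<beta> (j + 1) i P t)"
proof (induction t arbitrary: j i P)
  case (Leaf a)
  then show ?case by (auto intro: steps_refl)
next
  case (Node l r)
  have zero: "osteps 6 (radix \<beta> 0 i P (Node l r)) (radix \<beta> 1 i P (Node l r))" for i P
    using Node.IH(1)[of 0] Node.IH(2)[of 0]
    by (subst radix_split[of 1]) (auto simp: radix.simps(2) radix_split[of 1] intro!: osteps_exchange)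
  have pos: "osteps 6 (radix \<beta> (int n) i P (Node l r)) (radix \<beta> (int n + 1) i P (Node l r))" for n i P
  proof (induction n arbitrary: i P)
    case (Suc n)
    show ?case
      using radix_split[of "int (Suc n)" \<beta> i P "Node l r"] radix_split[of "int (Suc n) + 1" \<beta> i P "Node l r"]
        Suc.IH
      by (auto intro!: osteps_onode simp: add.commute)
  qed (use zero in simp)
  show ?case
  proof (cases "0 \<le> j")
    case True
    then show ?thesis using pos[of "nat j"] by simp
  next
    case False
    then show ?thesis
      using Node.IH(1)[of "j + 1" i P] Node.IH(2)[of "j + 1" i P]
      by (simp add: radix.simps(2) osteps_onode)
  qed
qed


lemma radix_steps: "osteps (6 * k) (radix \<beta> j i P t) (radix \<beta> (j + int k) i P t)"
proof (induction k)
  case 0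
  then show ?case by (simp add: option.rel_refl)
next
  case (Suc k)
  have "osteps (6 * k + 6) (radix \<beta> j i P t) (radix \<beta> (j + int k + 1) i P t)"
    using Suc radix_step[of \<beta> "j + int k" i P t]
    by (elim option.rel_cases) (auto intro: steps_add)
  then show ?case by (simp add: algebra_simps)
qed

lemma radix_empty: "set (leaf_list t) \<inter> P = {} \<Longrightarrow> radix \<beta> j i P t = None"
proof (induction \<beta> j i P t rule: radix.induct)
  case (2 \<beta> j i P l r)
  let ?t = "Node l r"
  show ?case
  proof (cases "0 < j")
    case True
    have "radix \<beta> (j - 1) (Suc i) (P \<inter> {a. \<beta> i a}) ?t = None"
      by (rule 2(1)[OF True]) (use 2(5) in blast)
    moreover have "radix \<beta> (j - 1) (Suc i) (P \<inter> {a. \<not> \<beta> i a}) ?t = None"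
      by (rule 2(2)[OF True]) (use 2(5) in blast)
    ultimately show ?thesis by (subst radix_split[OF True]) simp
  next
    case False
    have "radix \<beta> (j + 1) i P l = None" by (rule 2(3)[OF False]) (use 2(5) in auto)
    moreover have "radix \<beta> (j + 1) i P r = None" by (rule 2(4)[OF False]) (use 2(5) in auto)
    ultimately show ?thesis using False by (subst radix.simps(2)) simp
  qed
qed simp

lemma radix_single:
  "set (leaf_list t) \<inter> P = {a} \<Longrightarrow> distinct (leaf_list t) \<Longrightarrow> radix \<beta> j i P t = Some (Leaf a)"
proof (induction \<beta> j i P t rule: radix.induct)
  case (1 \<beta> j i P b)
  then show ?case by (cases "b \<in> P") auto
next
  case (2 \<beta> j i P l r)
  let ?t = "Node l r"
  show ?case
  proof (cases "0 < j")
    case True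
    show ?thesis
    proof (cases "\<beta> i a")
      case b: True
      have "radix \<beta> (j - 1) (Suc i) (P \<inter> {a. \<beta> i a}) ?t = Some (Leaf a)"
        by (rule 2(1)[OF True]) (use 2(5,6) b in blast)+
      moreover have "radix \<beta> (j - 1) (Suc i) (P \<inter> {a. \<not> \<beta> i a}) ?t = None"
        by (rule radix_empty) (use 2(5) b in \<open>unfold set_eq_iff Int_iff singleton_iff empty_iff mem_Collect_eq, metis\<close>)
      ultimately show ?thesis by (subst radix_split[OF True]) simp
    next
      case b: False
      have "radix \<beta> (j - 1) (Suc i) (P \<inter> {a. \<not> \<beta> i a}) ?t = Some (Leaf a)"
        by (rule 2(2)[OF True]) (use 2(5,6) b in blast)+
      moreover have "radix \<beta> (j - 1) (Suc i) (P \<inter> {a. \<beta> i a}) ?t = None"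
        by (rule radix_empty) (use 2(5) b in \<open>unfold set_eq_iff Int_iff singleton_iff empty_iff mem_Collect_eq, metis\<close>)
      ultimately show ?thesis by (subst radix_split[OF True]) simp
    qed
  next
    case False
    have P: "a \<in> P" "\<And>b. b \<in> P \<Longrightarrow> b \<in> set (leaf_list l) \<or> b \<in> set (leaf_list r) \<Longrightarrow> b = a"
      "set (leaf_list l) \<inter> set (leaf_list r) = {}" "distinct (leaf_list l)" "distinct (leaf_list r)"
      using 2(5,6) by auto
    show ?thesis
    proof (cases "a \<in> set (leaf_list l)")
      case a: True
      have "radix \<beta> (j + 1) i P l = Some (Leaf a)"
        by (rule 2(3)[OF False]) (use P a in blast)+
      moreover have "radix \<beta> (j + 1) i P r = None"
        by (rule radix_empty) (use P a in blast)
      ultimately show ?thesis using False by (subst radix.simps(2)) simp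
    next
      case a: False
      then have a': "a \<in> set (leaf_list r)" using 2(5) by auto
      have "radix \<beta> (j + 1) i P r = Some (Leaf a)"
        by (rule 2(4)[OF False]) (use P a' in blast)+
      moreover have "radix \<beta> (j + 1) i P l = None"
        by (rule radix_empty) (use P a' in blast)
      ultimately show ?thesis using False by (subst radix.simps(2)) simp
    qed
  qed
qed

section \<open>Tries as normal forms\<close>

fun trie :: "(nat \<Rightarrow> 'a \<Rightarrow> bool) \<Rightarrow> nat \<Rightarrow> nat \<Rightarrow> 'a set \<Rightarrow> 'a btree option" where
  "trie \<beta> 0 i S = (if S = {} then None else Some (Leaf (the_elem S)))"
| "trie \<beta> (Suc j) i S =
    onode (trie \<beta> j (Suc i) (S \<inter> {a. \<beta> i a})) (trie \<beta> j (Suc i) (S \<inter> {a. \<not> \<beta> i a}))"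

text \<open>Once the budget covers all separating bits, every part contains at most one label and
  the old shape of \<open>t\<close> is no longer visible. Hence the result depends only on the set
  of labels.\<close>

lemma radix_trie:
  assumes "distinct (leaf_list t)"
    and "\<And>a b. a \<in> set (leaf_list t) \<inter> P \<Longrightarrow> b \<in> set (leaf_list t) \<inter> P \<Longrightarrow>
      (\<And>k. i \<le> k \<Longrightarrow> k < i + j \<Longrightarrow> \<beta> k a = \<beta> k b) \<Longrightarrow> a = b"
  shows "radix \<beta> (int j) i P t = trie \<beta> j i (set (leaf_list t) \<inter> P)"
  using assms(2)
proof (induction j arbitrary: i P)
  case 0
  show ?case
  proof (cases "set (leaf_list t) \<inter> P = {}")
    case True
    then show ?thesis by (simp add: radix_empty)
  next
    case False
    then obtain a where "set (leaf_list t) \<inter> P = {a}" using 0 by fastforce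
    then show ?thesis using radix_single assms(1) by fastforce
  qed
next
  case (Suc j)
  have "radix \<beta> (int j) (Suc i) (P \<inter> Q) t = trie \<beta> j (Suc i) (set (leaf_list t) \<inter> P \<inter> Q)"
    if "Q = {a. \<beta> i a} \<or> Q = {a. \<not> \<beta> i a}" for Q
  proof -
    have "radix \<beta> (int j) (Suc i) (P \<inter> Q) t = trie \<beta> j (Suc i) (set (leaf_list t) \<inter> (P \<inter> Q))"
    proof (rule Suc.IH)
      fix a b
      assume ab: "a \<in> set (leaf_list t) \<inter> (P \<inter> Q)" "b \<in> set (leaf_list t) \<inter> (P \<inter> Q)"
        and eq: "\<And>k. Suc i \<le> k \<Longrightarrow> k < Suc i + j \<Longrightarrow> \<beta> k a = \<beta> k b"
      have "\<beta> k a = \<beta> k b" if "i \<le> k" "k < i + Suc j" for k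
        using that eq[of k] ab \<open>Q = _ \<or> _\<close> by (cases "k = i") auto
      then show "a = b" using Suc.prems ab by blast
    qed
    then show ?thesis by (simp add: Int_assoc)
  qed
  then show ?case
    using radix_split[of "int (Suc j)" \<beta> i P t] by simp
qed

lemma trie_ht: "trie \<beta> j i S = Some t \<Longrightarrow> ht t \<le> j"
proof (induction j arbitrary: i S t)
  case (Suc j)
  then show ?case
    by (cases "trie \<beta> j (Suc i) (S \<inter> {a. \<beta> i a})"; cases "trie \<beta> j (Suc i) (S \<inter> {a. \<not> \<beta> i a})")
      (auto simp: le_SucI)
qed (auto split: if_splits)

lemma less_power_bit_eqI:
  fixes a b :: nat
  assumes "a < 2 ^ J" "b < 2 ^ J" "\<And>k. k < J \<Longrightarrow> bit a k = bit b k"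
  shows "a = b"
proof -
  have "take_bit J a = take_bit J b"
    using assms(3) by (auto simp: bit_eq_iff bit_take_bit_iff)
  then show ?thesis using assms(1,2) by (simp add: take_bit_nat_eq_self)
qed

text \<open>The tree \<open>u\<close> is chosen before \<open>t\<close>, so any two trees on
  \<open>S\<close> are joined through it. The constant is \<open>42 = 6 * 3 + 6 * 4\<close>:
  balancing takes \<open>3 * J\<close> rounds, sorting \<open>4 * J\<close>.\<close>

lemma steps_to_trie:
  fixes S :: "nat set"
  assumes "S \<subseteq> {..<2 ^ J}" "S \<noteq> {}"
  obtains u where "ht u \<le> J"
    "\<And>t. distinct (leaf_list t) \<Longrightarrow> set (leaf_list t) = S \<Longrightarrow> steps (42 * J) t u"
proof -
  define u where "u = trie (\<lambda>k a. bit a k) J 0 S"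
  have *: "\<exists>v. u = Some v \<and> steps (42 * J) t v"
    if t: "distinct (leaf_list t)" "set (leaf_list t) = S" for t
  proof -
    have "nleaves t \<le> card {..<(2::nat) ^ J}"
      using t assms(1) by (metis card_mono distinct_card finite_lessThan)
    then have "real (nleaves t) \<le> 2 ^ J" by simp
    \<comment> \<open>\<open>(4 / 3) ^ 3 = 64 / 27\<close> is at least 2, so \<open>3 * J\<close>
      rounds contract \<open>2 ^ J\<close> leaves.\<close>
    also have "\<dots> \<le> ((4 / 3) ^ 3) ^ J" by (intro power_mono) (auto simp: power3_eq_cube)
    finally have "real (nleaves t) \<le> (4 / 3) ^ (3 * J)" by (simp add: power_mult)
    then obtain s where s: "steps (6 * (3 * J)) t s" "ht s \<le> 3 * J"
      using balance by blast
    have ms: "mset (leaf_list s) = mset (leaf_list t)" using steps_leaves[OF s(1)] by simp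
    have s': "distinct (leaf_list s)" "set (leaf_list s) = S"
      using t mset_eq_imp_distinct_iff[OF ms] mset_eq_setD[OF ms] by auto
    let ?r = "\<lambda>j. radix (\<lambda>k a. bit a k) j 0 UNIV s"
    have "?r (- int (3 * J)) = Some s" using s(2) by (intro radix_start) auto
    \<comment> \<open>The budget starts at minus the height bound \<open>3 * J\<close> and has to
      reach the number \<open>J\<close> of bits.\<close>
    moreover have "?r (- int (3 * J) + int (4 * J)) = u"
    proof -
      have "a = b" if "a \<in> S" "b \<in> S" "\<And>k. k < J \<Longrightarrow> bit a k = bit b k" for a b
        using that assms(1) less_power_bit_eqI by blast
      then have "?r (int J) = u"
        unfolding u_def using s' by (subst radix_trie) auto
      then show ?thesis by simp
    qed
    ultimately have "osteps (6 * (4 * J)) (Some s) u" using radix_steps by metis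
    then obtain v where "u = Some v" "steps (6 * (4 * J)) s v" by (auto simp: option_rel_Some1)
    then show ?thesis using steps_add[OF s(1)] by fastforce
  qed
  \<comment> \<open>Any tree on \<open>S\<close> witnesses that the trie is not
    \<open>None\<close>.\<close>
  have "finite S" using assms(1) finite_subset by blast
  then have "\<exists>t. distinct (leaf_list t) \<and> set (leaf_list t) = S"
    using assms(2)
  proof (induction rule: finite_ne_induct)
    case (singleton x)
    show ?case by (rule exI[of _ "Leaf x"]) auto
  next
    case (insert x F)
    then obtain t where "distinct (leaf_list t)" "set (leaf_list t) = F" by blast
    then show ?case using insert by (intro exI[of _ "Node (Leaf x) t"]) auto
  qed
  then obtain v where "u = Some v" using * by blast
  then show thesis using that[of v] * trie_ht unfolding u_def by fastforce
qed


subsection \<open>Undirected graphs and connectedness\<close>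

definition ubg :: "lgraph \<Rightarrow> bool" where
  "ubg G \<longleftrightarrow> fin_digraph (dg G) \<and> bidirected_digraph (dg G) (opp G)"

lemma ubgD:
  assumes "ubg G"
  shows "wf_digraph (dg G)" "finite (verts (dg G))" "finite (arcs (dg G))"
    "\<And>a. opp G (opp G a) = a"
    "\<And>a. a \<in> arcs (dg G) \<Longrightarrow> opp G a \<noteq> a"
    "\<And>a. opp G a \<in> arcs (dg G) \<longleftrightarrow> a \<in> arcs (dg G)"
    "\<And>a. a \<in> arcs (dg G) \<Longrightarrow> tail (dg G) (opp G a) = head (dg G) a"
    "\<And>a. a \<in> arcs (dg G) \<Longrightarrow> head (dg G) (opp G a) = tail (dg G) a"
    "\<And>a. a \<in> arcs (dg G) \<Longrightarrow> tail (dg G) a \<in> verts (dg G)"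
    "\<And>a. a \<in> arcs (dg G) \<Longrightarrow> head (dg G) a \<in> verts (dg G)"
proof -
  interpret fin_digraph "dg G" using assms by (simp add: ubg_def)
  interpret bidirected_digraph "dg G" "opp G" using assms by (simp add: ubg_def)
  show "wf_digraph (dg G)" "finite (verts (dg G))" "finite (arcs (dg G))" by (simp_all add: wf_digraph)
  show "\<And>a. opp G (opp G a) = a"
    "\<And>a. a \<in> arcs (dg G) \<Longrightarrow> opp G a \<noteq> a"
    "\<And>a. a \<in> arcs (dg G) \<Longrightarrow> tail (dg G) (opp G a) = head (dg G) a"
    "\<And>a. a \<in> arcs (dg G) \<Longrightarrow> head (dg G) (opp G a) = tail (dg G) a"
    "\<And>a. a \<in> arcs (dg G) \<Longrightarrow> tail (dg G) a \<in> verts (dg G)"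
    "\<And>a. a \<in> arcs (dg G) \<Longrightarrow> head (dg G) a \<in> verts (dg G)"
    using arev_neq by auto
  show "\<And>a. opp G a \<in> arcs (dg G) \<longleftrightarrow> a \<in> arcs (dg G)"
    by (metis arev_arev arev_in_arcs)
qed

lemma ubg_adj_sym: "ubg G \<Longrightarrow> (y, z) \<in> arcs_ends (dg G) \<Longrightarrow> (z, y) \<in> arcs_ends (dg G)"
  unfolding arcs_ends_conv by (auto simp: image_iff intro!: bexI[of _ "opp G _"] simp: ubgD)

lemma ubg_symmetric: "ubg G \<Longrightarrow> symmetric (dg G)"
  unfolding symmetric_def by (auto intro!: symI dest: ubg_adj_sym)

lemma ubg_connected_iff:
  assumes "ubg G"
  shows "connected (dg G) \<longleftrightarrow> verts (dg G) \<noteq> {} \<and>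
    (\<forall>u\<in>verts (dg G). \<forall>v\<in>verts (dg G). (u, v) \<in> (arcs_ends (dg G))\<^sup>*)"
proof -
  interpret wf_digraph "dg G" using ubgD[OF assms] by simp
  have "u \<rightarrow>\<^sup>*\<^bsub>dg G\<^esub> v \<longleftrightarrow> (u, v) \<in> (arcs_ends (dg G))\<^sup>*" if "u \<in> verts (dg G)" for u v
  proof
    assume "(u, v) \<in> (arcs_ends (dg G))\<^sup>*"
    then show "u \<rightarrow>\<^sup>*\<^bsub>dg G\<^esub> v"
      by (induction) (use that in \<open>auto intro: reachable_adj_trans\<close>)
  qed (rule reachable_rtranclI)
  then show ?thesis
    unfolding connected_def strongly_connected_def
    using reachable_mk_symmetric_eq[OF ubg_symmetric[OF assms]] by simp
qed

lemma connected_closed: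
  assumes "ubg G" "connected (dg G)" "w \<in> W" "w \<in> verts (dg G)"
    and "\<And>a. a \<in> arcs (dg G) \<Longrightarrow> tail (dg G) a \<in> W \<Longrightarrow> head (dg G) a \<in> W"
  shows "verts (dg G) \<subseteq> W"
proof
  fix v assume "v \<in> verts (dg G)"
  then have "(w, v) \<in> (arcs_ends (dg G))\<^sup>*"
    using assms(1,2,4) ubg_connected_iff by blast
  then show "v \<in> W"
    by induction (use assms(3,5) in \<open>auto simp: arcs_ends_conv\<close>)
qed

subsection \<open>Whitehead moves\<close>

definition same :: "lgraph \<Rightarrow> lgraph \<Rightarrow> bool" where
  "same G H \<longleftrightarrow> verts (dg H) = verts (dg G) \<and> arcs (dg H) = arcs (dg G) \<and> opp H = opp G \<and>
    label H = label G"

definition retail :: "lgraph \<Rightarrow> (nat \<Rightarrow> nat) \<Rightarrow> lgraph" where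
  "retail G t = G\<lparr>dg := (dg G)\<lparr>tail := t, head := t \<circ> opp G\<rparr>\<rparr>"

lemma retail_simps [simp]:
  "verts (dg (retail G t)) = verts (dg G)" "arcs (dg (retail G t)) = arcs (dg G)"
  "tail (dg (retail G t)) = t" "head (dg (retail G t)) = t \<circ> opp G"
  "opp (retail G t) = opp G" "label (retail G t) = label G"
  by (simp_all add: retail_def)

lemma same_retail [simp]: "same G (retail G t)"
  by (simp add: same_def)

lemma same_refl [simp]: "same G G"
  by (simp add: same_def)

lemma same_trans: "same G H \<Longrightarrow> same H I \<Longrightarrow> same G I"
  by (simp add: same_def)

lemma ubg_retail:
  assumes "ubg G" "\<And>a. a \<in> arcs (dg G) \<Longrightarrow> t a \<in> verts (dg G)"
  shows "ubg (retail G t)"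
proof -
  have "wf_digraph (dg (retail G t))"
    using assms ubgD[OF assms(1)] by unfold_locales auto
  moreover have "fin_digraph (dg (retail G t))"
    using calculation ubgD(2,3)[OF assms(1)] by (auto simp: fin_digraph_def fin_digraph_axioms_def)
  moreover have "bidirected_digraph (dg (retail G t)) (opp (retail G t))"
    using calculation(1) assms(1)
    by (auto simp: bidirected_digraph_def bidirected_digraph_axioms_def ubg_def)
  ultimately show ?thesis by (simp add: ubg_def)
qed

lemma whitehead_moveD:
  assumes G: "ubg G" and m: "whitehead_move G a H"
  shows "a \<in> arcs (dg G)" "same G H" "ubg H"
    "\<And>b. tail (dg H) b = tail (dg G) b \<or>
      b \<noteq> a \<and> b \<noteq> opp G a \<and> {tail (dg G) b, tail (dg H) b} \<subseteq> {tail (dg G) a, head (dg G) a}"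
    "tail (dg G) a \<noteq> head (dg G) a" "valence G (tail (dg G) a) = 3" "valence G (head (dg G) a) = 3"
proof -
  let ?u = "tail (dg G) a" and ?v = "head (dg G) a" and ?S = "side_half_edges G a"
  obtain t where i: "interior_edge G a" "?u \<noteq> ?v"
    and t: "\<And>b. b \<notin> ?S \<Longrightarrow> t b = tail (dg G) b" "t ` ?S \<subseteq> {?u, ?v}"
    and H: "H = retail G t"
    using m unfolding whitehead_move_def Let_def retail_def by blast
  show a: "a \<in> arcs (dg G)" "?u \<noteq> ?v" "valence G ?u = 3" "valence G ?v = 3"
    using i by (auto simp: interior_edge_def)
  show "same G H" by (simp add: H)
  show "ubg H"
    unfolding H
  proof (rule ubg_retail[OF G])
    fix b assume "b \<in> arcs (dg G)"
    moreover have "t b = tail (dg G) b \<or> t b = ?u \<or> t b = ?v" using t by blast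
    ultimately show "t b \<in> verts (dg G)" using ubgD(9,10)[OF G] a(1) by metis
  qed
  fix b
  show "tail (dg H) b = tail (dg G) b \<or>
      b \<noteq> a \<and> b \<noteq> opp G a \<and> {tail (dg G) b, tail (dg H) b} \<subseteq> {?u, ?v}"
  proof (cases "b \<in> ?S")
    case True
    then have "b \<noteq> a" "b \<noteq> opp G a" "tail (dg G) b = ?u \<or> tail (dg G) b = ?v"
      by (auto simp: side_half_edges_def)
    then show ?thesis using t(2) True H by auto
  next
    case False
    then show ?thesis using t(1) H by simp
  qed
qed

text \<open>A move shifts half-edges only between the ends of its edge, so it does not affect the
  ends of edges disjoint from it. Hence each half-edge is displaced at most once, along an edge of
  the matching, and the matched edges keep their own ends.\<close>

lemma whitehead_moves_slide:
  assumes "ubg G" "whitehead_moves G as H" "sorted_wrt (disjoint_edges G) as"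
  shows "same G H" "ubg H" "set as \<subseteq> arcs (dg G)"
    "\<forall>a\<in>set as. tail (dg H) a = tail (dg G) a \<and> head (dg H) a = head (dg G) a"
    "\<forall>b. tail (dg H) b = tail (dg G) b \<or>
      (\<exists>a\<in>set as. {tail (dg G) b, tail (dg H) b} \<subseteq> {tail (dg G) a, head (dg G) a})"
proof -
  have "same G H \<and> ubg H \<and> set as \<subseteq> arcs (dg G) \<and>
    (\<forall>a\<in>set as. tail (dg H) a = tail (dg G) a \<and> head (dg H) a = head (dg G) a) \<and>
    (\<forall>b. tail (dg H) b = tail (dg G) b \<or>
      (\<exists>a\<in>set as. {tail (dg G) b, tail (dg H) b} \<subseteq> {tail (dg G) a, head (dg G) a}))"
    using assms(2,1,3)
  proof (induction rule: whitehead_moves.induct)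
    case (Nil G)
    then show ?case by simp
  next
    case (Cons G a G' as H)
    note D = whitehead_moveD[OF Cons.prems(1) Cons.hyps(1)]
    let ?E = "\<lambda>G a. {tail (dg G) a, head (dg G) a}"
    have disj: "?E G a \<inter> ?E G x = {}" if "x \<in> set as" for x
      using that Cons.prems(2) by (auto simp: disjoint_edges_def)
    have tail': "tail (dg G') b = tail (dg G) b" if "tail (dg G) b \<notin> ?E G a" for b
      using D(4)[of b] that by auto
    have inE: "tail (dg G') b \<in> ?E G a" if "tail (dg G) b \<in> ?E G a" for b
      using D(4)[of b] that by auto
    have sm: "arcs (dg G') = arcs (dg G)" "opp G' = opp G" using D(2) by (auto simp: same_def)
    have head': "head (dg G') b = head (dg G) b" if "b \<in> arcs (dg G)" "head (dg G) b \<notin> ?E G a" for b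
      using that tail'[of "opp G b"] ubgD(7)[OF Cons.prems(1), of b] ubgD(7)[OF D(3), of b] sm by simp
    have aE: "tail (dg G') a = tail (dg G) a" "head (dg G') a = head (dg G) a"
      using D(4)[of a] D(4)[of "opp G a"] D(1) ubgD(7)[OF Cons.prems(1), of a] ubgD(7)[OF D(3), of a] sm
      by auto
    have arc: "x \<in> arcs (dg G) \<Longrightarrow> x \<in> set as \<Longrightarrow> tail (dg G') x = tail (dg G) x \<and> head (dg G') x = head (dg G) x" for x
      using tail'[of x] head'[of x] disj[of x] by auto
    have sub: "set as \<subseteq> arcs (dg G)"
    proof -
      from Cons.hyps(2) have "set as \<subseteq> arcs (dg G')"
        using D(3)
      proof (induction rule: whitehead_moves.induct)
        case (Cons G a G' as H)
        then show ?case using whitehead_moveD[OF Cons.prems Cons.hyps(1)] by (auto simp: same_def)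
      qed simp
      then show ?thesis using sm by simp
    qed
    have "sorted_wrt (disjoint_edges G') as"
    proof (rule sorted_wrt_mono_rel[rotated])
      show "sorted_wrt (disjoint_edges G) as" using Cons.prems(2) by simp
    qed (use sub arc in \<open>auto simp: disjoint_edges_def subset_iff\<close>)
    then have IH: "same G' H" "ubg H"
      "\<forall>a\<in>set as. tail (dg H) a = tail (dg G') a \<and> head (dg H) a = head (dg G') a"
      "\<forall>b. tail (dg H) b = tail (dg G') b \<or> (\<exists>a\<in>set as. {tail (dg G') b, tail (dg H) b} \<subseteq> ?E G' a)"
      using Cons.IH[OF D(3)] by blast+
    have IH4: "tail (dg H) b = tail (dg G') b \<or>
        (\<exists>x\<in>set as. {tail (dg G') b, tail (dg H) b} \<subseteq> ?E G x)" for b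
      using IH(4) arc sub by (metis subsetD)
    \<comment> \<open>After the first move these half-edges sit at the ends of \<open>a\<close>,
      which no later edge touches.\<close>
    have fix': "tail (dg H) b = tail (dg G') b" if "tail (dg G') b \<in> ?E G a" for b
      using IH4[of b] disj that by auto
    have "tail (dg H) a = tail (dg G) a" using fix'[of a] aE by simp
    moreover have "head (dg H) a = head (dg G) a"
      using fix'[of "opp G a"] aE D(1) ubgD(7)[OF IH(2), of a] ubgD(7)[OF D(3), of a] sm IH(1)
      by (simp add: same_def)
    moreover have "tail (dg H) b = tail (dg G) b \<or>
        (\<exists>x\<in>set (a # as). {tail (dg G) b, tail (dg H) b} \<subseteq> ?E G x)" for b
    proof (cases "tail (dg G) b \<in> ?E G a")
      case True
      then have "tail (dg H) b = tail (dg G') b" "tail (dg G') b \<in> ?E G a"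
        using fix' inE by blast+
      then show ?thesis using True by auto
    next
      case False
      then show ?thesis using IH4[of b] tail' by auto
    qed
    ultimately show ?case
      using IH sub D(1,2) arc same_trans by (auto simp: subset_iff)
  qed
  then show "same G H" "ubg H" "set as \<subseteq> arcs (dg G)"
    "\<forall>a\<in>set as. tail (dg H) a = tail (dg G) a \<and> head (dg H) a = head (dg G) a"
    "\<forall>b. tail (dg H) b = tail (dg G) b \<or>
      (\<exists>a\<in>set as. {tail (dg G) b, tail (dg H) b} \<subseteq> {tail (dg G) a, head (dg G) a})"
    by blast+
qed

subsection \<open>Distances\<close>

definition near :: "lgraph \<Rightarrow> nat \<Rightarrow> nat \<Rightarrow> nat \<Rightarrow> bool" where
  "near G k y z \<longleftrightarrow> (y, z) \<in> (arcs_ends (dg G) \<union> Id) ^^ k"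

lemma near_0 [simp]: "near G 0 y z \<longleftrightarrow> y = z"
  by (simp add: near_def)

lemma near_add: "near G j x y \<Longrightarrow> near G k y z \<Longrightarrow> near G (j + k) x z"
  by (auto simp: near_def relpow_add)

lemma near_Suc: "near G (Suc k) x z \<longleftrightarrow> (\<exists>y. near G k x y \<and> ((y, z) \<in> arcs_ends (dg G) \<or> y = z))"
  by (auto simp: near_def)

lemma near_refl: "near G k x x"
  by (induction k) (auto simp: near_Suc)

lemma near_mono: "near G j x y \<Longrightarrow> j \<le> k \<Longrightarrow> near G k x y"
  using near_add[of G j x y "k - j" y] near_refl by simp

lemma near_1: "near G (Suc 0) x z \<longleftrightarrow> (x, z) \<in> arcs_ends (dg G) \<or> x = z"
  by (simp add: near_Suc)

lemma near_sym: "ubg G \<Longrightarrow> near G k x y \<Longrightarrow> near G k y x"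
proof (induction k arbitrary: y)
  case (Suc k)
  then obtain w where "near G k w x" "near G 1 y w"
    by (auto simp: near_1 near_Suc dest: ubg_adj_sym)
  then show ?case using near_add by fastforce
qed simp

lemma near_rtrancl: "near G k x y \<Longrightarrow> (x, y) \<in> (arcs_ends (dg G))\<^sup>*"
  by (induction k arbitrary: y) (auto simp: near_Suc intro: rtrancl_into_rtrancl)

text \<open>An edge survives with each end displaced along at most one edge, and the edges used for
  this are still present afterwards. The factor is \<open>3 = 1 + 1 + 1\<close>.\<close>

lemma simultaneous_moveD:
  assumes "ubg G" "simultaneous_move G H"
  shows "same G H" "ubg H" "\<And>k x y. near G k x y \<Longrightarrow> near H (3 * k) x y"
proof -
  obtain as where as: "whitehead_moves G as H" "sorted_wrt (disjoint_edges G) as"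
    using assms(2) by (auto simp: simultaneous_move_def)
  note S = whitehead_moves_slide[OF assms(1) as]
  show "same G H" "ubg H" by (rule S)+
  have arcs: "arcs (dg H) = arcs (dg G)" "opp H = opp G" using S(1) by (auto simp: same_def)
  have slide: "near H 1 (tail (dg G) b) (tail (dg H) b)" for b
  proof -
    have ends: "(tail (dg G) a, head (dg G) a) \<in> arcs_ends (dg H)" if "a \<in> set as" for a
    proof -
      have "a \<in> arcs (dg H)" using S(3) that arcs by auto
      then have "(tail (dg H) a, head (dg H) a) \<in> arcs_ends (dg H)" by (auto simp: arcs_ends_conv)
      then show ?thesis using S(4) that by simp
    qed
    consider "tail (dg H) b = tail (dg G) b"
      | a where "a \<in> set as" "{tail (dg G) b, tail (dg H) b} \<subseteq> {tail (dg G) a, head (dg G) a}"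
      using S(5) by blast
    then show ?thesis
    proof cases
      case 2
      then show ?thesis
        using ends[OF 2(1)] ubg_adj_sym[OF S(2) ends[OF 2(1)]] by (auto simp: near_1)
    qed (simp add: near_refl)
  qed
  have adj: "near H 3 y z" if "(y, z) \<in> arcs_ends (dg G)" for y z
  proof -
    obtain b where b: "b \<in> arcs (dg G)" "y = tail (dg G) b" "z = head (dg G) b"
      using \<open>(y, z) \<in> arcs_ends (dg G)\<close> by (auto simp: arcs_ends_conv)
    have "near H 1 (tail (dg H) b) (head (dg H) b)"
      using b(1) arcs by (auto simp: near_1 arcs_ends_conv)
    moreover have "near H 1 (head (dg H) b) z"
      using slide[of "opp G b"] near_sym[OF S(2)] b ubgD(7)[OF assms(1) b(1)] ubgD(7)[OF S(2), of b] arcs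
      by simp
    ultimately show ?thesis
      using near_add[OF near_add[OF slide[of b]], of 1 "head (dg H) b" 1 z] b(2) by (simp add: numeral_3_eq_3)
  qed
  show "near H (3 * k) x y" if "near G k x y" for k x y
    using that
  proof (induction k arbitrary: y)
    case (Suc k)
    then obtain w where w: "near G k x w" "(w, y) \<in> arcs_ends (dg G) \<or> w = y" by (auto simp: near_Suc)
    then have "near H 3 w y" using adj near_refl by blast
    from near_add[OF Suc.IH[OF w(1)] this] show ?case by (simp add: algebra_simps)
  qed simp
qed

lemma simultaneous_move_connected:
  assumes "ubg G" "simultaneous_move G H" "connected (dg G)"
  shows "connected (dg H)"
proof -
  note D = simultaneous_moveD[OF assms(1,2)]
  have "(x, y) \<in> (arcs_ends (dg H))\<^sup>*" if "(x, y) \<in> (arcs_ends (dg G))\<^sup>*" for x y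
    using that
  proof induction
    case (step y z)
    then have "near G 1 y z" by (simp add: near_1)
    then show ?case using D(3) near_rtrancl step.IH by (blast intro: rtrancl_trans)
  qed simp
  then show ?thesis
    using assms(1,3) D(1,2) by (auto simp: ubg_connected_iff same_def)
qed


subsection \<open>Graphs as glued trees\<close>

text \<open>
  A spanning tree of the trivalent vertices, rooted at an arc.  A node records the arc by which
  it is entered and its vertex, a leaf is an arc leaving the tree.
\<close>

datatype dtree = DLeaf nat | DNode nat nat dtree dtree

primrec root_arc :: "dtree \<Rightarrow> nat" where
  "root_arc (DLeaf x) = x"
| "root_arc (DNode a v l r) = a"

primrec dverts :: "dtree \<Rightarrow> nat list" where
  "dverts (DLeaf x) = []"
| "dverts (DNode a v l r) = v # dverts l @ dverts r"

primrec undec :: "dtree \<Rightarrow> nat btree" where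
  "undec (DLeaf x) = Leaf x"
| "undec (DNode a v l r) = Node (undec l) (undec r)"

text \<open>\<open>opp G a\<close> is the half-edge at \<open>v\<close> towards the parent. That no
  vertex is visited twice is stated separately, as \<open>distinct (dverts d)\<close>.\<close>

primrec spans :: "lgraph \<Rightarrow> dtree \<Rightarrow> bool" where
  "spans G (DLeaf x) = True"
| "spans G (DNode a v l r) \<longleftrightarrow> out_arcs (dg G) v = {opp G a, root_arc l, root_arc r} \<and>
    distinct [opp G a, root_arc l, root_arc r] \<and> spans G l \<and> spans G r"

section \<open>Lifting tree moves to graph moves\<close>

lemma whitehead_moves_append:
  "whitehead_moves G as H \<Longrightarrow> whitehead_moves H bs I \<Longrightarrow> whitehead_moves G (as @ bs) I"
  by (induction rule: whitehead_moves.induct) (auto intro: whitehead_moves.intros)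

text \<open>A simultaneous move confined to \<open>W\<close>: half-edges neither enter nor leave
  \<open>W\<close>, and those elsewhere stay put. This locality is what allows the moves of disjoint
  subtrees to be combined.\<close>

definition simul :: "lgraph \<Rightarrow> nat set \<Rightarrow> nat list \<Rightarrow> lgraph \<Rightarrow> bool" where
  "simul G W as H \<longleftrightarrow> whitehead_moves G as H \<and> sorted_wrt (disjoint_edges G) as \<and>
     (\<forall>a\<in>set as. {tail (dg G) a, head (dg G) a} \<subseteq> W) \<and>
     (\<forall>b. tail (dg G) b \<notin> W \<longrightarrow> tail (dg H) b = tail (dg G) b) \<and>
     (\<forall>b. tail (dg G) b \<in> W \<longrightarrow> tail (dg H) b \<in> W)"

lemma simul_same:
  assumes "ubg G" "simul G W as H"
  shows "same G H" "ubg H"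
  using whitehead_moves_slide[OF assms(1)] assms(2) by (auto simp: simul_def)

lemma simul_refl: "simul G W [] G"
  by (simp add: simul_def whitehead_moves.Nil)

lemma simul_mono: "simul G W as H \<Longrightarrow> W \<subseteq> W' \<Longrightarrow> simul G W' as H"
  unfolding simul_def by (metis subset_iff)

text \<open>The first batch does not touch half-edges at \<open>W'\<close>, so the edges of the
  second batch have the same ends in \<open>G\<close> as in \<open>G'\<close>, and edges of
  different batches have ends in disjoint sets.\<close>

lemma simul_trans:
  assumes G: "ubg G" and 1: "simul G W as G'" and 2: "simul G' W' bs H" and disj: "W \<inter> W' = {}"
  shows "simul G (W \<union> W') (as @ bs) H"
proof -
  note s = simul_same[OF G 1]
  note f = 1[unfolded simul_def]
  note f' = 2[unfolded simul_def]
  have sm: "arcs (dg G') = arcs (dg G)" "opp G' = opp G" using s(1) by (auto simp: same_def)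
  have arcs: "set bs \<subseteq> arcs (dg G)"
    using whitehead_moves_slide(3)[OF s(2), of bs H] f' sm by blast
  have tb: "tail (dg G) b = tail (dg G') b" if "tail (dg G') b \<in> W'" for b
    using f that disj by (metis disjoint_iff)
  have ends: "tail (dg G') b = tail (dg G) b \<and> head (dg G') b = head (dg G) b" if "b \<in> set bs" for b
  proof -
    have b: "b \<in> arcs (dg G)" "{tail (dg G') b, head (dg G') b} \<subseteq> W'" using that arcs f' by auto
    then have "tail (dg G') (opp G b) \<in> W'" using ubgD(7)[OF s(2), of b] sm by simp
    then show ?thesis
      using tb[of b] tb[of "opp G b"] b ubgD(7)[OF s(2), of b] ubgD(7)[OF G b(1)] sm by simp
  qed
  have "sorted_wrt (disjoint_edges G) bs"
  proof (rule sorted_wrt_mono_rel[rotated])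
    show "sorted_wrt (disjoint_edges G') bs" using f' by simp
  qed (use ends in \<open>auto simp: disjoint_edges_def\<close>)
  moreover have "\<forall>b\<in>set bs. {tail (dg G) b, head (dg G) b} \<subseteq> W'" using f' ends by auto
  ultimately have "sorted_wrt (disjoint_edges G) (as @ bs)"
    using f disj by (fastforce simp: sorted_wrt_append disjoint_edges_def)
  moreover have "\<forall>b. tail (dg G) b \<notin> W \<union> W' \<longrightarrow> tail (dg H) b = tail (dg G) b"
    using f f' by (metis UnI1 UnI2)
  moreover have "tail (dg H) b \<in> W \<union> W'" if "tail (dg G) b \<in> W \<union> W'" for b
    using that f f' by (metis Un_iff)
  ultimately show ?thesis
    using whitehead_moves_append f f' \<open>\<forall>b\<in>set bs. _\<close> by (auto simp: simul_def)
qed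

lemma simul_out_arcs:
  assumes "ubg G" "simul G W as H" "v \<notin> W"
  shows "out_arcs (dg H) v = out_arcs (dg G) v"
proof -
  have "arcs (dg H) = arcs (dg G)" using simul_same[OF assms(1,2)] by (simp add: same_def)
  moreover have "tail (dg H) b = v \<longleftrightarrow> tail (dg G) b = v" for b
    using assms(2,3) unfolding simul_def by metis
  ultimately show ?thesis by (auto simp: out_arcs_def)
qed

lemma simul_spans:
  assumes G: "ubg G" "simul G W as H"
  shows "set (dverts d) \<inter> W = {} \<Longrightarrow> spans G d \<Longrightarrow> spans H d"
  by (induction d) (use simul_same(1)[OF G] simul_out_arcs[OF G] in \<open>auto simp: same_def\<close>)

text \<open>A Whitehead move in concrete form: \<open>a\<close> runs from \<open>v\<close> to
  \<open>u\<close>, and one further half-edge at each end changes places, which always gives a new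
  splitting. It serves both the rule \<open>rot\<close> and the construction of non-isomorphic
  graphs.\<close>

lemma swap_tails_move:
  assumes G: "ubg G"
    and u: "out_arcs (dg G) u = {opp G a, b', b}" "distinct [opp G a, b', b]"
    and v: "out_arcs (dg G) v = {a, c', c}" "distinct [a, c', c]"
    and uv: "u \<noteq> v"
  defines "H \<equiv> retail G (tail (dg G) \<circ> Transposition.transpose b c)"
  shows "whitehead_move G a H" "simul G {u, v} [a] H"
    "out_arcs (dg H) u = {opp G a, b', c}" "out_arcs (dg H) v = {a, c', b}"
proof -
  let ?t = "tail (dg G) \<circ> Transposition.transpose b c"
  have mem: "opp G a \<in> out_arcs (dg G) u" "b' \<in> out_arcs (dg G) u" "b \<in> out_arcs (dg G) u"
    "a \<in> out_arcs (dg G) v" "c' \<in> out_arcs (dg G) v" "c \<in> out_arcs (dg G) v"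
    unfolding u(1) v(1) by simp_all
  then have arcs: "a \<in> arcs (dg G)" "b \<in> arcs (dg G)" "b' \<in> arcs (dg G)" "c \<in> arcs (dg G)"
      "c' \<in> arcs (dg G)" "opp G a \<in> arcs (dg G)"
    and tails: "tail (dg G) a = v" "tail (dg G) (opp G a) = u" "tail (dg G) b = u" "tail (dg G) b' = u"
      "tail (dg G) c = v" "tail (dg G) c' = v"
    by simp_all
  have hd: "head (dg G) a = u" using tails(2) ubgD(7)[OF G arcs(1)] by simp
  have ne: "b \<noteq> c" "b \<noteq> c'" "b' \<noteq> c" "b' \<noteq> c'" "a \<noteq> b" "a \<noteq> b'" "opp G a \<noteq> c" "opp G a \<noteq> c'"
    using tails uv by auto
  let ?S = "side_half_edges G a"
  have S: "?S = {b', b, c', c}"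
    using u v ne tails hd unfolding side_half_edges_def by auto
  have t: "?t b = v" "?t c = u" "?t b' = u" "?t c' = v" "?t a = v" "?t (opp G a) = u"
    using ne u v tails by (auto simp: Transposition.transpose_def)
  have Su: "{x \<in> ?S. ?t x = u} = {b', c}" and Sv: "{x \<in> ?S. ?t x = v} = {c', b}"
    using t uv unfolding S by auto
  have S0: "{x \<in> ?S. tail (dg G) x = u} = {b', b}" "{x \<in> ?S. tail (dg G) x = v} = {c', c}"
    using tails uv unfolding S by auto
  have split: "splitting ?S ?t v u \<noteq> splitting ?S (tail (dg G)) v u"
    unfolding splitting_def Su Sv S0 using ne u v by (auto simp: doubleton_eq_iff)
  have val: "valence G u = 3" "valence G v = 3"
    using u v by (simp_all add: out_degree_def)
  have notS: "?t x = tail (dg G) x" if "x \<notin> ?S" for x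
    using that unfolding S by (auto simp: Transposition.transpose_def)
  show m: "whitehead_move G a H"
    unfolding whitehead_move_def Let_def tails(1) hd
  proof (intro conjI exI[of _ ?t])
    show "interior_edge G a" using arcs val tails hd by (simp add: interior_edge_def)
    show "v \<noteq> u" using uv by simp
    show "\<forall>b. b \<notin> ?S \<longrightarrow> ?t b = tail (dg G) b" using notS by blast
    show "?t ` ?S \<subseteq> {v, u}" unfolding S using t by auto
    show "card {b \<in> ?S. ?t b = v} = 2" "card {b \<in> ?S. ?t b = u} = 2"
      unfolding Su Sv using ne u v by auto
    show "splitting ?S ?t v u \<noteq> splitting ?S (tail (dg G)) v u" by (rule split)
    show "H = G\<lparr>dg := (dg G)\<lparr>tail := ?t, head := ?t \<circ> opp G\<rparr>\<rparr>"
      by (simp add: H_def retail_def)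
  qed
  have tail': "tail (dg H) x = (if x = b then v else if x = c then u else tail (dg G) x)" for x
    using t notS[of x] unfolding S H_def by auto
  show "simul G {u, v} [a] H"
    unfolding simul_def
    using tails hd m tail' by (auto intro: whitehead_moves.intros)
  have out: "x \<in> out_arcs (dg H) w \<longleftrightarrow>
      x \<in> arcs (dg G) \<and> (if x = b then v else if x = c then u else tail (dg G) x) = w" for x w
    using tail'[of x] by (simp add: H_def)
  have 1: "x \<in> arcs (dg G) \<and> tail (dg G) x = u \<longleftrightarrow> x = opp G a \<or> x = b' \<or> x = b" for x
    using u(1) unfolding set_eq_iff by simp
  have 2: "x \<in> arcs (dg G) \<and> tail (dg G) x = v \<longleftrightarrow> x = a \<or> x = c' \<or> x = c" for x
    using v(1) unfolding set_eq_iff by simp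
  have "x \<in> out_arcs (dg H) u \<longleftrightarrow> x \<in> {opp G a, b', c}" for x
    unfolding out using 1[of x] ne u(2) uv arcs by (cases "x = b"; cases "x = c") auto
  then show "out_arcs (dg H) u = {opp G a, b', c}" by blast
  have "x \<in> out_arcs (dg H) v \<longleftrightarrow> x \<in> {a, c', b}" for x
    unfolding out using 2[of x] ne v(2) uv arcs by (cases "x = b"; cases "x = c") auto
  then show "out_arcs (dg H) v = {a, c', b}" by blast
qed

lemma undec_Leaf: "undec d = Leaf x \<longleftrightarrow> d = DLeaf x"
  by (cases d) auto

lemma undec_Node: "undec d = Node s t \<longleftrightarrow> (\<exists>a v l r. d = DNode a v l r \<and> undec l = s \<and> undec r = t)"
  by (cases d) auto

text \<open>Root arc and vertex set are retained, so that the new tree fits into the place of the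
  old one within a larger tree.\<close>

definition lifts :: "lgraph \<Rightarrow> dtree \<Rightarrow> nat btree \<Rightarrow> bool" where
  "lifts G d t \<longleftrightarrow> (\<exists>as H d'. simul G (set (dverts d)) as H \<and> spans H d' \<and> root_arc d' = root_arc d \<and>
     undec d' = t \<and> set (dverts d') = set (dverts d) \<and> distinct (dverts d'))"

text \<open>Exchanging siblings costs no move, because \<open>spans\<close> prescribes the
  half-edges at a vertex only as a set.\<close>

lemma lifts_Node:
  assumes l: "\<And>G. ubg G \<Longrightarrow> spans G l \<Longrightarrow> lifts G l s" and r: "\<And>G. ubg G \<Longrightarrow> spans G r \<Longrightarrow> lifts G r t"
    and u: "ubg G" and sp: "spans G (DNode a v l r)" and dist: "distinct (dverts (DNode a v l r))"
  shows "lifts G (DNode a v l r) (Node s t)" "lifts G (DNode a v l r) (Node t s)"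
proof -
  obtain as G1 l' where 1: "simul G (set (dverts l)) as G1" "spans G1 l'" "root_arc l' = root_arc l"
    "undec l' = s" "set (dverts l') = set (dverts l)" "distinct (dverts l')"
    using l[OF u] sp unfolding lifts_def by auto
  note s1 = simul_same[OF u 1(1)]
  have "spans G1 r" by (rule simul_spans[OF u 1(1)]) (use sp dist in auto)
  then obtain bs H r' where 2: "simul G1 (set (dverts r)) bs H" "spans H r'" "root_arc r' = root_arc r"
    "undec r' = t" "set (dverts r') = set (dverts r)" "distinct (dverts r')"
    using r[OF s1(2)] unfolding lifts_def by auto
  note s2 = simul_same[OF s1(2) 2(1)]
  have 3: "simul G (set (dverts l) \<union> set (dverts r)) (as @ bs) H"
    using simul_trans[OF u 1(1) 2(1)] dist by auto
  have "spans H l'" by (rule simul_spans[OF s1(2) 2(1)]) (use 1 dist in auto)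
  moreover have "out_arcs (dg H) v = out_arcs (dg G) v"
    using simul_out_arcs[OF u 3] dist by auto
  moreover have "opp H = opp G" using s1 s2 by (simp add: same_def)
  ultimately have sp': "spans H (DNode a v l' r')" "spans H (DNode a v r' l')" using sp 1 2 by auto
  have sm: "simul G (set (dverts (DNode a v l r))) (as @ bs) H" by (rule simul_mono[OF 3]) auto
  show "lifts G (DNode a v l r) (Node s t)"
    unfolding lifts_def
    by (intro exI[of _ "as @ bs"] exI[of _ H] exI[of _ "DNode a v l' r'"] conjI sm sp'(1))
      (use 1 2 dist in auto)
  show "lifts G (DNode a v l r) (Node t s)"
    unfolding lifts_def
    by (intro exI[of _ "as @ bs"] exI[of _ H] exI[of _ "DNode a v r' l'"] conjI sm sp'(2))
      (use 1 2 dist in auto)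
qed

text \<open>A rotation uses up its two nodes, and the steps inside its three subtrees involve only
  nodes below. The moved edges are therefore pairwise disjoint, and a whole \<open>step\<close>
  becomes one simultaneous move.\<close>

lemma step_simul:
  assumes "step t t'" "ubg G" "spans G d" "distinct (dverts d)" "undec d = t"
  shows "lifts G d t'"
  using assms
proof (induction arbitrary: G d rule: step.induct)
  case (leaf x)
  then show ?case unfolding lifts_def using simul_refl by (auto simp: undec_Leaf)
next
  case (node s s' t t')
  then obtain a v l r where d: "d = DNode a v l r" "undec l = s" "undec r = t"
    by (auto simp: undec_Node)
  note prems = node.prems[unfolded d(1)]
  show ?case
    unfolding d(1) by (rule lifts_Node(1)[OF _ _ prems(1-3)]) (use node.IH d prems(3) in auto)
next
  case (swap s s' t t')
  then obtain a v l r where d: "d = DNode a v l r" "undec l = s" "undec r = t"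
    by (auto simp: undec_Node)
  note prems = swap.prems[unfolded d(1)]
  show ?case
    unfolding d(1) by (rule lifts_Node(2)[OF _ _ prems(1-3)]) (use swap.IH d prems(3) in auto)
next
  case (rot s s' t t' w w')
  then obtain a v x u A B C where d: "d = DNode a v (DNode x u A B) C"
    "undec A = s" "undec B = t" "undec C = w"
    by (auto simp: undec_Node)
  note prems = rot.prems[unfolded d]
  obtain as G1 A' where 1: "simul G (set (dverts A)) as G1" "spans G1 A'" "root_arc A' = root_arc A"
    "undec A' = s'" "set (dverts A') = set (dverts A)" "distinct (dverts A')"
    using rot.IH(1)[of G A] prems d by (auto simp: lifts_def)
  note s1 = simul_same[OF prems(1) 1(1)]
  have "spans G1 B" by (rule simul_spans[OF prems(1) 1(1)]) (use prems in auto)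
  then obtain bs G2 B' where 2: "simul G1 (set (dverts B)) bs G2" "spans G2 B'" "root_arc B' = root_arc B"
    "undec B' = t'" "set (dverts B') = set (dverts B)" "distinct (dverts B')"
    using rot.IH(2)[of G1 B] s1 prems d by (auto simp: lifts_def)
  note s2 = simul_same[OF s1(2) 2(1)]
  have 12: "simul G (set (dverts A) \<union> set (dverts B)) (as @ bs) G2"
    using simul_trans[OF prems(1) 1(1) 2(1)] prems by auto
  have "spans G2 C" by (rule simul_spans[OF prems(1) 12]) (use prems in auto)
  then obtain cs G3 C' where 3: "simul G2 (set (dverts C)) cs G3" "spans G3 C'" "root_arc C' = root_arc C"
    "undec C' = w'" "set (dverts C') = set (dverts C)" "distinct (dverts C')"
    using rot.IH(3)[of G2 C] s2 prems d by (auto simp: lifts_def)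
  note s3 = simul_same[OF s2(2) 3(1)]
  have 123: "simul G (set (dverts A) \<union> set (dverts B) \<union> set (dverts C)) ((as @ bs) @ cs) G3"
    by (rule simul_trans[OF prems(1) 12 3(1)]) (use prems in auto)
  have A: "spans G2 A'" by (rule simul_spans[OF s1(2) 2(1)]) (use 1 prems in auto)
  have A: "spans G3 A'" by (rule simul_spans[OF s2(2) 3(1)]) (use A 1 prems in auto)
  have B: "spans G3 B'" by (rule simul_spans[OF s2(2) 3(1)]) (use 2 prems in auto)
  have oppG: "opp G3 = opp G" using s1 s2 s3 by (simp add: same_def)
  have uv: "u \<noteq> v" using prems by auto
  have out: "out_arcs (dg G3) u = {opp G3 x, root_arc A', root_arc B'}"
    "out_arcs (dg G3) v = {x, opp G3 a, root_arc C'}"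
    using simul_out_arcs[OF prems(1) 123] prems 1 2 3 oppG by auto
  have dist: "distinct [opp G3 x, root_arc A', root_arc B']" "distinct [x, opp G3 a, root_arc C']"
    using prems 1 2 3 oppG by auto
  \<comment> \<open>The edge of \<open>x\<close> joins \<open>v\<close> and \<open>u\<close>; the
    subtrees at \<open>B\<close> below \<open>u\<close> and at \<open>C\<close> below
    \<open>v\<close> change places.\<close>
  define H where "H = retail G3 (tail (dg G3) \<circ> Transposition.transpose (root_arc B') (root_arc C'))"
  note M = swap_tails_move[OF s3(2) out(1) dist(1) out(2) dist(2) uv, folded H_def]
  have oppH: "opp H = opp G3" by (simp add: H_def)
  have sp: "spans H A'" "spans H B'" "spans H C'"
    by (rule simul_spans[OF s3(2) M(2)]; use A B 1 2 3 prems in auto)+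
  have cross: "y \<noteq> z" if "y \<in> out_arcs (dg G3) u" "z \<in> out_arcs (dg G3) v" for y z
    using that uv by auto
  have ne: "distinct [opp G3 x, root_arc A', root_arc C']" "distinct [opp G3 a, x, root_arc B']"
    using cross[of "opp G3 x" "root_arc C'"] cross[of "root_arc A'" "root_arc C'"]
      cross[of "root_arc B'" "opp G3 a"] cross[of "root_arc B'" x] dist
    unfolding out by auto
  define d' where "d' = DNode a v (DNode x u A' C') B'"
  have "spans H d'"
    unfolding d'_def spans.simps root_arc.simps oppH M(3,4)
    using ne sp insert_commute[of x "opp G3 a"] by (simp add: oppH)
  moreover have "simul G (set (dverts d)) (((as @ bs) @ cs) @ [x]) H"
    by (rule simul_mono[OF simul_trans[OF prems(1) 123 M(2)]]) (use prems d(1) in auto)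
  moreover have "undec d' = Node (Node s' w') t'" by (simp add: d'_def 1(4) 2(4) 3(4))
  moreover have "set (dverts d') = set (dverts d)" by (auto simp: d'_def d(1) 1(5) 2(5) 3(5))
  moreover have "distinct (dverts d')" using prems(3) 1(5,6) 2(5,6) 3(5,6) by (auto simp: d'_def)
  moreover have "root_arc d' = root_arc d" by (simp add: d'_def d(1))
  ultimately show ?case unfolding lifts_def by blast
qed


section \<open>Marked graphs and their labelled trees\<close>

text \<open>
  A marking names the arcs that leave the spanning tree: \<open>1, \<dots>, p\<close> are the legs and the remaining
  ones come in consecutive pairs of opposite arcs.  The arc \<open>e 1\<close> leaves the tree at its root.
\<close>

definition marking :: "nat \<Rightarrow> nat \<Rightarrow> lgraph \<Rightarrow> (nat \<Rightarrow> nat) \<Rightarrow> bool" where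
  "marking g p G e \<longleftrightarrow> inj_on e {1..2 * g + p} \<and> e ` {1..2 * g + p} \<subseteq> arcs (dg G) \<and>
     (\<forall>i\<in>{1..p}. head (dg G) (e i) \<in> verts_of_valence G 1 \<and> label G (head (dg G) (e i)) = i) \<and>
     (\<forall>j<g. opp G (e (p + 2 * j + 1)) = e (p + 2 * j + 2))"

text \<open>The marking \<open>e\<close> stays fixed under moves, so the gluing is frozen and only
  \<open>t\<close> varies. End 1 marks the root; the labels of \<open>t\<close> are meant to be the
  other ends.\<close>

definition rep :: "nat \<Rightarrow> nat \<Rightarrow> lgraph \<Rightarrow> (nat \<Rightarrow> nat) \<Rightarrow> nat btree \<Rightarrow> bool" where
  "rep g p G e t \<longleftrightarrow> G \<in> lgraphs g p \<and> marking g p G e \<and>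
     (\<exists>d. spans G d \<and> distinct (dverts d) \<and> set (dverts d) = verts_of_valence G 3 \<and>
       undec d = map_btree e t \<and> root_arc d = opp G (e 1))"

lemma lgraphs_ubg: "G \<in> lgraphs g p \<Longrightarrow> ubg G"
  by (simp add: lgraphs_def ubg_def)

lemma spans_valence: "spans G d \<Longrightarrow> v \<in> set (dverts d) \<Longrightarrow> valence G v = 3"
  by (induction d) (auto simp: out_degree_def)

lemma lgraphs_move:
  assumes G: "G \<in> lgraphs g p" and "simultaneous_move G H"
    and val: "\<And>v. v \<in> verts (dg G) \<Longrightarrow> valence H v = valence G v"
  shows "H \<in> lgraphs g p" "verts_of_valence H k = verts_of_valence G k"
proof -
  note D = simultaneous_moveD[OF lgraphs_ubg[OF G] assms(2)]
  have s: "verts (dg H) = verts (dg G)" "arcs (dg H) = arcs (dg G)" "opp H = opp G" "label H = label G"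
    using D(1) by (simp_all add: same_def)
  show vv: "verts_of_valence H k = verts_of_valence G k" for k
    using val s by (auto simp: verts_of_valence_def)
  have "connected (dg H)"
    using simultaneous_move_connected[OF lgraphs_ubg[OF G] assms(2)] G by (simp add: lgraphs_def)
  then show "H \<in> lgraphs g p"
    using G D(2) s val vv unfolding lgraphs_def ubg_def by (simp add: graph_rank_def)
qed

lemma rep_step:
  assumes "rep g p G e t" "step t t'"
  shows "\<exists>H. simultaneous_move G H \<and> rep g p H e t'"
proof -
  obtain d where G: "G \<in> lgraphs g p" and m: "marking g p G e" and d: "spans G d" "distinct (dverts d)"
    "set (dverts d) = verts_of_valence G 3" "undec d = map_btree e t" "root_arc d = opp G (e 1)"
    using assms(1) by (auto simp: rep_def)
  note u = lgraphs_ubg[OF G]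
  obtain as H d' where H: "simul G (set (dverts d)) as H" "spans H d'" "root_arc d' = root_arc d"
    "undec d' = map_btree e t'" "set (dverts d') = set (dverts d)" "distinct (dverts d')"
    using step_simul[OF step_map[OF assms(2)] u d(1,2,4)] unfolding lifts_def by blast
  have mv: "simultaneous_move G H" using H(1) by (auto simp: simul_def simultaneous_move_def)
  note D = simul_same[OF u H(1)]
  have s: "verts (dg H) = verts (dg G)" "arcs (dg H) = arcs (dg G)" "opp H = opp G" "label H = label G"
    using D(1) by (simp_all add: same_def)
  have val: "valence H v = valence G v" for v
  proof (cases "v \<in> set (dverts d)")
    case True
    then show ?thesis using spans_valence d(1) H(2,5) by metis
  next
    case False
    then show ?thesis using simul_out_arcs[OF u H(1)] by (simp add: out_degree_def)
  qed
  note L = lgraphs_move[OF G mv val]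
  have "head (dg H) (e i) = head (dg G) (e i)" if i: "i \<in> {1..p}" for i
  proof -
    have e: "e i \<in> arcs (dg G)" "head (dg G) (e i) \<in> verts_of_valence G 1"
      using m i by (auto simp: marking_def)
    then have "tail (dg G) (opp G (e i)) \<notin> set (dverts d)"
      using ubgD(7)[OF u] d(3) by (auto simp: verts_of_valence_def)
    then have "tail (dg H) (opp G (e i)) = tail (dg G) (opp G (e i))"
      using H(1) by (simp add: simul_def)
    then show ?thesis using ubgD(7)[OF u e(1)] ubgD(7)[OF D(2), of "e i"] e(1) s by simp
  qed
  then have "marking g p H e" using m by (simp add: marking_def s L(2))
  then have "rep g p H e t'"
    unfolding rep_def using L H d s by auto
  then show ?thesis using mv by blast
qed

lemma rep_steps:
  assumes "rep g p G e t" "steps k t t'"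
  shows "\<exists>H. ((\<lambda>G H. G \<in> lgraphs g p \<and> H \<in> lgraphs g p \<and> simultaneous_move G H) ^^ k) G H \<and>
    rep g p H e t'"
  using assms(2)
proof (induction k arbitrary: t')
  case 0
  then show ?case using assms(1) by auto
next
  case (Suc k)
  then obtain s where s: "steps k t s" "step s t'" by auto
  then obtain H where "((\<lambda>G H. G \<in> lgraphs g p \<and> H \<in> lgraphs g p \<and> simultaneous_move G H) ^^ k) G H"
    "rep g p H e s"
    using Suc.IH by blast
  moreover from rep_step[OF this(2) s(2)] obtain I where "simultaneous_move H I" "rep g p I e t'"
    by blast
  moreover have "H \<in> lgraphs g p" "I \<in> lgraphs g p" using calculation by (simp_all add: rep_def)
  ultimately show ?case by auto
qed


subsection \<open>The glued tree determines the graph\<close>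

text \<open>The half-edges at the tree vertices in a fixed order of traversal: two trees of the same
  shape are to be compared position by position.\<close>

primrec slots :: "lgraph \<Rightarrow> dtree \<Rightarrow> nat list" where
  "slots G (DLeaf x) = []"
| "slots G (DNode a v l r) = [opp G a, root_arc l, root_arc r] @ slots G l @ slots G r"

primrec slot_verts :: "dtree \<Rightarrow> nat list" where
  "slot_verts (DLeaf x) = []"
| "slot_verts (DNode a v l r) = [v, v, v] @ slot_verts l @ slot_verts r"

primrec node_arcs :: "dtree \<Rightarrow> nat list" where
  "node_arcs (DLeaf x) = []"
| "node_arcs (DNode a v l r) = a # node_arcs l @ node_arcs r"

lemma set_slots: "spans G d \<Longrightarrow> set (slots G d) = {a \<in> arcs (dg G). tail (dg G) a \<in> set (dverts d)}"
proof (induction d)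
  case (DNode a v l r)
  have "set (slots G (DNode a v l r)) = out_arcs (dg G) v \<union> set (slots G l) \<union> set (slots G r)"
    using DNode.prems by auto
  then show ?case using DNode by auto
qed simp

lemma distinct_slots: "spans G d \<Longrightarrow> distinct (dverts d) \<Longrightarrow> distinct (slots G d)"
proof (induction d)
  case (DNode a v l r)
  have sp: "spans G l" "spans G r" "distinct [opp G a, root_arc l, root_arc r]" using DNode.prems by auto
  have "{opp G a, root_arc l, root_arc r} \<inter> set (slots G l) = {}"
    "{opp G a, root_arc l, root_arc r} \<inter> set (slots G r) = {}"
    "set (slots G l) \<inter> set (slots G r) = {}"
    unfolding set_slots[OF sp(1)] set_slots[OF sp(2)]
    using DNode.prems by (auto simp: out_arcs_def set_eq_iff)
  then show ?case using DNode sp by auto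
qed simp

lemma tail_slots: "spans G d \<Longrightarrow> map (tail (dg G)) (slots G d) = slot_verts d"
proof (induction d)
  case (DNode a v l r)
  have "{opp G a, root_arc l, root_arc r} = out_arcs (dg G) v" using DNode.prems by simp
  then have "\<forall>x\<in>{opp G a, root_arc l, root_arc r}. tail (dg G) x = v" by (metis in_out_arcs_conv)
  then show ?case using DNode by simp
qed simp

text \<open>An edge between two nodes is met from both sides, as the arc entering the child and as
  the \<open>opp\<close> of that arc; a leaf arc is met once. The root arc of the whole tree belongs
  to no parent and is added on the left.\<close>

lemma mset_slots:
  "mset (slots G d) + {#root_arc d#} =
    mset (node_arcs d) + mset (map (opp G) (node_arcs d)) + mset (leaf_list (undec d))"
proof (induction d)
  case (DNode a v l r)
  have "mset (slots G (DNode a v l r)) + {#root_arc (DNode a v l r)#} =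
      {#opp G a, a#} + (mset (slots G l) + {#root_arc l#}) + (mset (slots G r) + {#root_arc r#})"
    by simp
  then show ?case unfolding DNode by (simp add: ac_simps)
qed simp

lemma length_same_shape:
  assumes "undec d = map_btree e t" "undec d' = map_btree e' t"
  shows "length (dverts d) = length (dverts d')" "length (slots G d) = length (slots H d')"
proof -
  have "length (dverts d) = length (dverts d') \<and> length (slots G d) = length (slots H d')"
    using assms by (induction t arbitrary: d d') (fastforce simp: undec_Leaf undec_Node)+
  then show "length (dverts d) = length (dverts d')" "length (slots G d) = length (slots H d')"
    by blast+
qed

lemma map_slot_verts:
  assumes "undec d = map_btree e t" "undec d' = map_btree e' t" "map f (dverts d) = dverts d'"
  shows "map f (slot_verts d) = slot_verts d'"
  using assms
proof (induction t arbitrary: d d')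
  case (Node s t)
  then obtain a v l r a' v' l' r' where d: "d = DNode a v l r" "undec l = map_btree e s"
    "undec r = map_btree e t" "d' = DNode a' v' l' r'" "undec l' = map_btree e' s"
    "undec r' = map_btree e' t"
    by (auto simp: undec_Node)
  then have "map f (dverts l) = dverts l'" "map f (dverts r) = dverts r'" "f v = v'"
    using Node.prems(3) length_same_shape(1)[OF d(2,5)] by auto
  then show ?case using Node.IH d by auto
qed (auto simp: undec_Leaf)

lemma map_slots_arcs:
  assumes "undec d = map_btree e t" "undec d' = map_btree e' t"
    and "map k (slots G d) = slots H d'" "k (root_arc d) = root_arc d'"
  shows "\<forall>x\<in>set (node_arcs d). k (opp G x) = opp H (k x)" "\<forall>i\<in>set (leaf_list t). k (e i) = e' i"
proof -
  have "(\<forall>x\<in>set (node_arcs d). k (opp G x) = opp H (k x)) \<and> (\<forall>i\<in>set (leaf_list t). k (e i) = e' i)"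
    using assms
  proof (induction t arbitrary: d d')
    case (Node s t)
    then obtain a v l r a' v' l' r' where d: "d = DNode a v l r" "undec l = map_btree e s"
      "undec r = map_btree e t" "d' = DNode a' v' l' r'" "undec l' = map_btree e' s"
      "undec r' = map_btree e' t"
      by (auto simp: undec_Node)
    then have "map k (slots G l) = slots H l'" "map k (slots G r) = slots H r'"
      "k (opp G a) = opp H a'" "k (root_arc l) = root_arc l'" "k (root_arc r) = root_arc r'"
      using Node.prems(3) length_same_shape(2)[OF d(2,5), of G H] by auto
    then show ?case using Node.IH(1)[OF d(2,5)] Node.IH(2)[OF d(3,6)] Node.prems(4) d by auto
  qed (auto simp: undec_Leaf)
  then show "\<forall>x\<in>set (node_arcs d). k (opp G x) = opp H (k x)" "\<forall>i\<in>set (leaf_list t). k (e i) = e' i"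
    by blast+
qed

lemma distinct_map_bij:
  assumes "distinct xs" "distinct ys" "length xs = length ys"
  obtains f where "bij_betw f (set xs) (set ys)" "map f xs = ys"
proof -
  define f where "f x = the (map_of (zip xs ys) x)" for x
  have f: "map f xs = ys"
    using assms unfolding f_def by (auto intro!: nth_equalityI simp: map_of_zip_nth)
  moreover have "inj_on f (set xs)"
    using assms(1,2) f by (metis distinct_map)
  moreover have "f ` set xs = set ys" using f by (metis set_map)
  ultimately show thesis using that by (auto simp: bij_betw_def)
qed

lemma marking_legs:
  assumes G: "G \<in> lgraphs g p" and m: "marking g p G e"
  shows "verts_of_valence G 1 = (\<lambda>i. head (dg G) (e i)) ` {1..p}"
    "inj_on (\<lambda>i. head (dg G) (e i)) {1..p}"
    "verts (dg G) = verts_of_valence G 3 \<union> verts_of_valence G 1"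
    "\<And>i. i \<in> {1..p} \<Longrightarrow> out_arcs (dg G) (head (dg G) (e i)) = {opp G (e i)}"
proof -
  note u = lgraphs_ubg[OF G]
  have lab: "bij_betw (label G) (verts_of_valence G 1) {1..p}"
    and val: "\<forall>v\<in>verts (dg G). valence G v = 1 \<or> valence G v = 3"
    using G by (auto simp: lgraphs_def)
  have hd: "head (dg G) (e i) \<in> verts_of_valence G 1" "label G (head (dg G) (e i)) = i"
    "e i \<in> arcs (dg G)" if "i \<in> {1..p}" for i
    using m that by (auto simp: marking_def)
  show "verts_of_valence G 1 = (\<lambda>i. head (dg G) (e i)) ` {1..p}"
  proof (intro equalityI subsetI)
    fix v assume v: "v \<in> verts_of_valence G 1"
    then have i: "label G v \<in> {1..p}" using lab by (auto simp: bij_betw_def)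
    then have "head (dg G) (e (label G v)) = v"
      using hd[OF i] v lab by (auto simp: bij_betw_def inj_on_def)
    then show "v \<in> (\<lambda>i. head (dg G) (e i)) ` {1..p}" using i by force
  qed (use hd in auto)
  show "inj_on (\<lambda>i. head (dg G) (e i)) {1..p}" by (rule inj_onI) (metis hd(2))
  show "verts (dg G) = verts_of_valence G 3 \<union> verts_of_valence G 1"
    using val by (auto simp: verts_of_valence_def)
  show "out_arcs (dg G) (head (dg G) (e i)) = {opp G (e i)}" if i: "i \<in> {1..p}" for i
  proof -
    have "card (out_arcs (dg G) (head (dg G) (e i))) = 1"
      using hd[OF i] by (simp add: verts_of_valence_def out_degree_def)
    moreover have "opp G (e i) \<in> out_arcs (dg G) (head (dg G) (e i))"
      using hd(3)[OF i] ubgD(6,7)[OF u] by simp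
    ultimately show ?thesis by (metis card_1_singletonE singletonD)
  qed
qed

text \<open>Vertices and half-edges are matched by their positions in two trees of equal shape. Only
  the opposites of the arcs leaving the trees cannot be read off there; the markings supply them, as
  a leg with the same label or as the partner in a pair.\<close>

lemma rep_iso:
  assumes n: "3 \<le> 2 * g + p" and "rep g p G e t" "rep g p H e' t" "set (leaf_list t) = {2..2 * g + p}"
  shows "lgraph_iso G H"
proof -
  obtain d where G: "G \<in> lgraphs g p" and m: "marking g p G e" and d: "spans G d" "distinct (dverts d)"
    "set (dverts d) = verts_of_valence G 3" "undec d = map_btree e t" "root_arc d = opp G (e 1)"
    using assms(2) by (auto simp: rep_def)
  obtain d' where H: "H \<in> lgraphs g p" and m': "marking g p H e'" and d': "spans H d'" "distinct (dverts d')"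
    "set (dverts d') = verts_of_valence H 3" "undec d' = map_btree e' t" "root_arc d' = opp H (e' 1)"
    using assms(3) by (auto simp: rep_def)
  note u = lgraphs_ubg[OF G] and u' = lgraphs_ubg[OF H]
  note L = marking_legs[OF G m] and L' = marking_legs[OF H m']
  define hs where "hs = (\<lambda>(G :: lgraph) e. map (\<lambda>i. head (dg G) (e i)) [1..<Suc p])"
  define os where "os = (\<lambda>(G :: lgraph) e. map (\<lambda>i. opp G (e i)) [1..<Suc p])"
  have setp: "set [1..<Suc p] = {1..p}" by auto
  have lists: "distinct (dverts d @ hs G e) \<and> set (dverts d @ hs G e) = verts (dg G) \<and>
      distinct (slots G d @ os G e) \<and> set (slots G d @ os G e) = arcs (dg G) \<and>
      map (tail (dg G)) (slots G d @ os G e) = slot_verts d @ hs G e"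
    if G: "G \<in> lgraphs g p" and m: "marking g p G e" and d: "spans G d" "distinct (dverts d)"
      "set (dverts d) = verts_of_valence G 3" for G e d
  proof -
    note u = lgraphs_ubg[OF G] and L = marking_legs[OF G m]
    have disj: "verts_of_valence G 3 \<inter> verts_of_valence G 1 = {}" by (auto simp: verts_of_valence_def)
    have ea: "e i \<in> arcs (dg G)" if "i \<in> {1..p}" for i using m that by (auto simp: marking_def)
    have to: "tail (dg G) (opp G (e i)) = head (dg G) (e i)" if "i \<in> {1..p}" for i
      using ubgD(7)[OF u ea[OF that]] .
    have os: "set (os G e) = {a \<in> arcs (dg G). tail (dg G) a \<in> verts_of_valence G 1}"
    proof (intro equalityI subsetI)
      fix a assume "a \<in> set (os G e)"
      then obtain i where i: "i \<in> {1..p}" "a = opp G (e i)" unfolding os_def set_map setp by auto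
      then show "a \<in> {a \<in> arcs (dg G). tail (dg G) a \<in> verts_of_valence G 1}"
        using ea[OF i(1)] to[OF i(1)] ubgD(6)[OF u] L(1) by auto
    next
      fix a assume a: "a \<in> {a \<in> arcs (dg G). tail (dg G) a \<in> verts_of_valence G 1}"
      then obtain i where i: "i \<in> {1..p}" "tail (dg G) a = head (dg G) (e i)" using L(1) by auto
      then have "a \<in> out_arcs (dg G) (head (dg G) (e i))" using a by simp
      then have "a = opp G (e i)" using L(4)[OF i(1)] by simp
      then show "a \<in> set (os G e)" using i unfolding os_def set_map setp by blast
    qed
    have "inj_on (\<lambda>i. opp G (e i)) {1..p}"
      using L(2) to unfolding inj_on_def by metis
    then have 1: "distinct (os G e)" "distinct (hs G e)"
      unfolding os_def hs_def distinct_map setp using L(2) by auto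
    have 2: "set (hs G e) = verts_of_valence G 1" unfolding hs_def set_map setp L(1) by simp
    have 3: "set (slots G d) = {a \<in> arcs (dg G). tail (dg G) a \<in> verts_of_valence G 3}"
      using set_slots[OF d(1)] d(3) by simp
    have 4: "map (tail (dg G)) (os G e) = hs G e"
      unfolding os_def hs_def using to by (simp del: upt_Suc)
    have "verts_of_valence G 3 \<union> verts_of_valence G 1 = verts (dg G)" using L(3) by simp
    moreover have "tail (dg G) a \<in> verts (dg G)" if "a \<in> arcs (dg G)" for a using ubgD(9)[OF u that] .
    ultimately show ?thesis
      using d distinct_slots[OF d(1,2)] tail_slots[OF d(1)] 1 2 3 4 os disj by auto
  qed
  note l = lists[OF G m d(1-3)] and l' = lists[OF H m' d'(1-3)]
  have len: "length (hs G e) = length (hs H e')" "length (os G e) = length (os H e')"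
    by (simp_all add: hs_def os_def)
  note shape = length_same_shape[OF d(4) d'(4)]
  obtain f where f: "bij_betw f (verts (dg G)) (verts (dg H))" "map f (dverts d @ hs G e) = dverts d' @ hs H e'"
    using distinct_map_bij[of "dverts d @ hs G e" "dverts d' @ hs H e'"] l l' len shape(1) by auto
  obtain k where k: "bij_betw k (arcs (dg G)) (arcs (dg H))"
    "map k (slots G d @ os G e) = slots H d' @ os H e'"
    using distinct_map_bij[of "slots G d @ os G e" "slots H d' @ os H e'"] l l' len shape(2)[of G H] by auto
  have f12: "map f (dverts d) = dverts d'" "map f (hs G e) = hs H e'"
    using f(2) shape(1) by auto
  have k12: "map k (slots G d) = slots H d'" "map k (os G e) = os H e'"
    using k(2) shape(2)[of G H] by auto
  have tl: "map (tail (dg H) \<circ> k) (slots G d @ os G e) = map (f \<circ> tail (dg G)) (slots G d @ os G e)"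
  proof -
    have "map (tail (dg H)) (map k (slots G d @ os G e)) = slot_verts d' @ hs H e'"
      unfolding k(2) using l' by blast
    also have "\<dots> = map f (slot_verts d @ hs G e)"
      using f12 map_slot_verts[OF d(4) d'(4) f12(1)] by simp
    also have "slot_verts d @ hs G e = map (tail (dg G)) (slots G d @ os G e)" using l by simp
    finally show ?thesis by (simp only: map_map)
  qed
  have tails: "tail (dg H) (k a) = f (tail (dg G) a)" if "a \<in> arcs (dg G)" for a
  proof -
    have "a \<in> set (slots G d @ os G e)" using l that by blast
    with tl show ?thesis unfolding map_eq_conv by auto
  qed
  have fl: "f (head (dg G) (e i)) = head (dg H) (e' i)" and kl: "k (opp G (e i)) = opp H (e' i)"
    if "i \<in> {1..p}" for i
    using f12(2) k12(2) that unfolding hs_def os_def map_map map_eq_conv setp by auto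
  \<comment> \<open>The root arc is the opposite of \<open>e 1\<close>. For \<open>p = 0\<close>
    this is the partner \<open>e 2\<close>, a leaf of the tree; otherwise it is the arc leaving leg
    1.\<close>
  have roots: "k (root_arc d) = root_arc d'" and leaves: "\<forall>i\<in>set (leaf_list t). k (e i) = e' i"
  proof -
    have "t \<noteq> Leaf x" for x using n assms(4) by (auto simp: set_eq_iff) (metis atLeastAtMost_iff le_refl nat_le_linear not_less_eq_eq numeral_2_eq_2 numeral_3_eq_3)
    then obtain t1 t2 where t: "t = Node t1 t2" by (cases t) auto
    then obtain a v dl dr a' v' dl' dr' where dd: "d = DNode a v dl dr" "undec dl = map_btree e t1"
      "undec dr = map_btree e t2" "d' = DNode a' v' dl' dr'" "undec dl' = map_btree e' t1"
      "undec dr' = map_btree e' t2"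
      using d(4) d'(4) by (auto simp: undec_Node)
    then have "map k (slots G dl) = slots H dl'" "map k (slots G dr) = slots H dr'"
      "k (root_arc dl) = root_arc dl'" "k (root_arc dr) = root_arc dr'"
      using k12(1) length_same_shape(2)[OF dd(2,5), of G H] by auto
    then show lv: "\<forall>i\<in>set (leaf_list t). k (e i) = e' i"
      using map_slots_arcs(2)[OF dd(2,5)] map_slots_arcs(2)[OF dd(3,6)] t by auto
    show "k (root_arc d) = root_arc d'"
    proof (cases "p = 0")
      case True
      then have "opp G (e (p + 2 * 0 + 1)) = e (p + 2 * 0 + 2)" "opp H (e' (p + 2 * 0 + 1)) = e' (p + 2 * 0 + 2)"
        using m m' n unfolding marking_def by (metis add_0_right le_zero_eq mult_0_right neq0_conv not_numeral_le_zero)+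
      then have "opp G (e 1) = e 2" "opp H (e' 1) = e' 2" using True by (simp_all add: numeral_2_eq_2)
      moreover have "2 \<in> set (leaf_list t)" using n assms(4) by auto
      ultimately have "opp G (e 1) = e 2" "opp H (e' 1) = e' 2" "2 \<in> set (leaf_list t)" by blast+
      then show ?thesis using lv d(5) d'(5) by simp
    next
      case False
      then show ?thesis using kl[of 1] d(5) d'(5) by simp
    qed
  qed
  have nodes: "\<forall>x\<in>set (node_arcs d). k (opp G x) = opp H (k x)"
    using map_slots_arcs(1)[OF d(4) d'(4) k12(1) roots] .
  have root_in: "root_arc d \<in> set (node_arcs d)"
  proof (cases d)
    case (DLeaf x)
    then have "leaf_list t = [inv e x] \<or> length (leaf_list t) = 1"
      using d(4) by (cases t) auto
    then have "card {2..2 * g + p} \<le> 1" using assms(4) card_length[of "leaf_list t"] by auto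
    then show ?thesis using n by simp
  qed simp
  have ke: "k (e i) = e' i" if "i \<in> {1..2 * g + p}" for i
  proof (cases "i = 1")
    case True
    have "k (opp G (root_arc d)) = opp H (root_arc d')" using nodes root_in roots by auto
    then show ?thesis using d(5) d'(5) ubgD(4)[OF u] ubgD(4)[OF u'] True by simp
  next
    case False
    then show ?thesis using leaves assms(4) that by auto
  qed
  have pairs: "k (opp G (e i)) = opp H (e' i)" if i: "i \<in> {1..2 * g + p}" for i
  proof (cases "i \<le> p")
    case False
    have "\<exists>j<g. i = p + 2 * j + 1 \<or> i = p + 2 * j + 2"
      using False i by (intro exI[of _ "(i - p - 1) div 2"]) auto
    then obtain j where j: "j < g" "i = p + 2 * j + 1 \<or> i = p + 2 * j + 2" by blast
    have 1: "opp G (e (p + 2 * j + 1)) = e (p + 2 * j + 2)" "opp H (e' (p + 2 * j + 1)) = e' (p + 2 * j + 2)"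
      using m m' j(1) by (simp_all add: marking_def)
    then have 2: "opp G (e (p + 2 * j + 2)) = e (p + 2 * j + 1)" "opp H (e' (p + 2 * j + 2)) = e' (p + 2 * j + 1)"
      using ubgD(4)[OF u] ubgD(4)[OF u'] by metis+
    have "p + 2 * j + 1 \<in> {1..2 * g + p}" "p + 2 * j + 2 \<in> {1..2 * g + p}" using j(1) by auto
    then show ?thesis using j(2) 1 2 ke by metis
  qed (use kl i in auto)
  \<comment> \<open>By \<open>mset_slots\<close> a half-edge at a tree vertex lies on a tree edge,
    in one of two directions, or is a leaf; the half-edges at the legs complete the list.\<close>
  have opps: "k (opp G a) = opp H (k a)" if a: "a \<in> arcs (dg G)" for a
  proof -
    have "a \<in> set (slots G d) \<or> a \<in> set (os G e)" using a l by auto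
    moreover have "a \<in> set (node_arcs d) \<or> a \<in> opp G ` set (node_arcs d) \<or> a \<in> e ` set (leaf_list t)"
      if "a \<in> set (slots G d)"
    proof -
      have "a \<in># mset (slots G d) + {#root_arc d#}" using that by simp
      then show ?thesis unfolding mset_slots d(4) leaf_list_map by auto
    qed
    moreover have "k (opp G (opp G x)) = opp H (k (opp G x))" if "x \<in> set (node_arcs d)" for x
      using nodes that ubgD(4)[OF u] ubgD(4)[OF u'] by simp
    moreover have "k (opp G (e i)) = opp H (k (e i))" "k (opp G (opp G (e i))) = opp H (k (opp G (e i)))"
      if "i \<in> {1..2 * g + p}" for i
      using ke[OF that] pairs[OF that] ubgD(4)[OF u] ubgD(4)[OF u'] by simp_all
    ultimately show ?thesis using nodes assms(4) by (auto simp: os_def)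
  qed
  have "head (dg H) (k a) = f (head (dg G) a)" if a: "a \<in> arcs (dg G)" for a
  proof -
    have ka: "k a \<in> arcs (dg H)" using k(1) a by (auto simp: bij_betw_def)
    have "head (dg H) (k a) = tail (dg H) (opp H (k a))" using ubgD(7)[OF u' ka] by simp
    also have "\<dots> = f (tail (dg G) (opp G a))" using tails[of "opp G a"] opps[OF a] ubgD(6)[OF u] a by simp
    finally show ?thesis using ubgD(7)[OF u a] by simp
  qed
  moreover have "label H (f v) = label G v" if "v \<in> verts_of_valence G 1" for v
  proof -
    obtain i where i: "i \<in> {1..p}" "v = head (dg G) (e i)" using \<open>v \<in> _\<close> L(1) by blast
    then show ?thesis using fl m m' by (simp add: marking_def)
  qed
  ultimately show ?thesis
    unfolding lgraph_iso_def using f(1) k(1) tails opps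
    by (intro exI[of _ f] exI[of _ k] conjI ballI) simp_all
qed


subsection \<open>Every graph is a glued tree\<close>

lemma spans_extend:
  assumes "out_arcs (dg G) w = {opp G x, b, c}" "distinct [opp G x, b, c]"
  shows "spans G d \<Longrightarrow> x \<in> set (leaf_list (undec d)) \<Longrightarrow> distinct (dverts d) \<Longrightarrow> w \<notin> set (dverts d) \<Longrightarrow>
    \<exists>d'. spans G d' \<and> root_arc d' = root_arc d \<and> set (dverts d') = insert w (set (dverts d)) \<and>
      distinct (dverts d')"
proof (induction d)
  case (DLeaf y)
  then show ?case using assms by (intro exI[of _ "DNode x w (DLeaf b) (DLeaf c)"]) auto
next
  case (DNode a v l r)
  show ?case
  proof (cases "x \<in> set (leaf_list (undec l))")
    case True
    then obtain l' where "spans G l'" "root_arc l' = root_arc l" "set (dverts l') = insert w (set (dverts l))"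
      "distinct (dverts l')"
      using DNode.IH(1) DNode.prems by fastforce
    moreover from this have "distinct (dverts (DNode a v l' r))" using DNode.prems by simp
    ultimately show ?thesis using DNode.prems by (intro exI[of _ "DNode a v l' r"]) (simp add: insert_commute)
  next
    case False
    then obtain r' where "spans G r'" "root_arc r' = root_arc r" "set (dverts r') = insert w (set (dverts r))"
      "distinct (dverts r')"
      using DNode.IH(2) DNode.prems False by fastforce
    moreover from this have "distinct (dverts (DNode a v l r'))" using DNode.prems by simp
    ultimately show ?thesis using DNode.prems by (intro exI[of _ "DNode a v l r'"]) (simp add: insert_commute)
  qed
qed

lemma valence_3_out_arcs:
  assumes "valence G v = 3" "x \<in> out_arcs (dg G) v"
  shows "\<exists>b c. out_arcs (dg G) v = {x, b, c} \<and> distinct [x, b, c]"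
proof -
  have "card (out_arcs (dg G) v - {x}) = 2"
    using assms by (simp add: out_degree_def card_Diff_singleton)
  then obtain b c where "out_arcs (dg G) v - {x} = {b, c}" "b \<noteq> c" by (auto simp: card_2_iff)
  moreover from this have "x \<notin> {b, c}" by blast
  moreover have "out_arcs (dg G) v = insert x (out_arcs (dg G) v - {x})" using assms(2) by blast
  ultimately have "out_arcs (dg G) v = {x, b, c}" "distinct [x, b, c]" by simp_all
  then show ?thesis by blast
qed

lemma valence_1_out_arcs: "valence G v = 1 \<Longrightarrow> x \<in> out_arcs (dg G) v \<Longrightarrow> out_arcs (dg G) v = {x}"
  by (metis card_1_singletonE out_degree_def singletonD)

lemma ex_out_arc: "v \<in> verts_of_valence G k \<Longrightarrow> 0 < k \<Longrightarrow> \<exists>x. x \<in> out_arcs (dg G) v"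
  by (auto simp: verts_of_valence_def out_degree_def card_gt_0_iff simp del: in_out_arcs_conv)

lemma lgraphs_card:
  assumes "G \<in> lgraphs g p" "3 \<le> 2 * g + p"
  shows "card (verts_of_valence G 3) = 2 * g + p - 2"
  using assms by (auto simp: lgraphs_def)

text \<open>An edge with two ends of valence 1 would be the whole graph by connectedness, leaving no
  room for a trivalent vertex.\<close>

lemma leg_head:
  assumes G: "G \<in> lgraphs g p" and n: "3 \<le> 2 * g + p"
    and a: "a \<in> arcs (dg G)" "valence G (tail (dg G) a) = 1"
  shows "head (dg G) a \<in> verts_of_valence G 3"
proof (rule ccontr)
  note u = lgraphs_ubg[OF G]
  assume "\<not> ?thesis"
  then have h: "valence G (head (dg G) a) = 1"
    using G ubgD(10)[OF u a(1)] by (auto simp: lgraphs_def verts_of_valence_def)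
  have out: "out_arcs (dg G) (tail (dg G) a) = {a}" "out_arcs (dg G) (head (dg G) a) = {opp G a}"
    using valence_1_out_arcs[OF a(2), of a] valence_1_out_arcs[OF h, of "opp G a"] a(1) ubgD(6,7)[OF u]
    by auto
  have "verts (dg G) \<subseteq> {tail (dg G) a, head (dg G) a}"
  proof (rule connected_closed[OF u])
    show "connected (dg G)" using G by (simp add: lgraphs_def)
    show "tail (dg G) a \<in> verts (dg G)" by (rule ubgD(9)[OF u a(1)])
    fix b assume b: "b \<in> arcs (dg G)" "tail (dg G) b \<in> {tail (dg G) a, head (dg G) a}"
    then have "b = a \<or> b = opp G a" using out by (metis in_out_arcs_conv insertE singletonD)
    then show "head (dg G) b \<in> {tail (dg G) a, head (dg G) a}" using ubgD(8)[OF u a(1)] by auto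
  qed simp
  then have "verts_of_valence G 3 = {}" using a(2) h by (auto simp: verts_of_valence_def)
  then show False using lgraphs_card[OF G n] n by simp
qed

text \<open>The orbits of a fixed-point free involution, listed consecutively. The start
  \<open>c\<close> is prescribed because for \<open>p = 0\<close> the first end has to lie at the
  root.\<close>

lemma pair_enumeration:
  assumes "card C = 2 * g" "finite C" "\<And>x. x \<in> C \<Longrightarrow> f x \<in> C \<and> f x \<noteq> x \<and> f (f x) = x" "0 < g \<Longrightarrow> c \<in> C"
  shows "\<exists>h :: nat \<Rightarrow> 'a. bij_betw h {..<2 * g} C \<and> (\<forall>j<g. f (h (2 * j)) = h (2 * j + 1)) \<and> (0 < g \<longrightarrow> h 0 = c)"
  using assms
proof (induction g arbitrary: C c)
  case 0
  then have "C = {}" by simp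
  then show ?case by (simp add: bij_betw_def)
next
  case (Suc g)
  have c: "c \<in> C" using Suc.prems(4) by simp
  then have c: "c \<in> C" "f c \<in> C" "f c \<noteq> c" "f (f c) = c" using Suc.prems(3)[of c] by simp_all
  define D where "D = C - {c, f c}"
  have D: "card D = 2 * g" "finite D"
    using Suc.prems(1,2) c(1-3) unfolding D_def by (simp_all add: card_Diff_subset)
  have fD: "f x \<in> D \<and> f x \<noteq> x \<and> f (f x) = x" if "x \<in> D" for x
  proof -
    have x: "x \<in> C" "x \<noteq> c" "x \<noteq> f c" using that by (simp_all add: D_def)
    note fx = Suc.prems(3)[OF x(1)]
    have "f x \<noteq> c" using fx x(3) by metis
    moreover have "f x \<noteq> f c" using fx x(2) c(4) by metis
    ultimately show ?thesis using fx by (simp add: D_def)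
  qed
  obtain c' where c': "0 < g \<Longrightarrow> c' \<in> D"
  proof (cases "D = {}")
    case True
    then show thesis using that D by simp
  next
    case False
    then show thesis using that by blast
  qed
  obtain h where h: "bij_betw h {..<2 * g} D" "\<forall>j<g. f (h (2 * j)) = h (2 * j + 1)"
    using Suc.IH[OF D fD c'] by blast
  define h' where "h' i = (if i = 0 then c else if i = 1 then f c else h (i - 2))" for i :: nat
  have "bij_betw h' ({0, 1} \<union> {2..<2 * g + 2}) ({c, f c} \<union> D)"
  proof (rule bij_betw_combine)
    show "bij_betw h' {0, 1} {c, f c}" using c(3) by (simp add: bij_betw_def h'_def insert_commute)
    have "bij_betw (\<lambda>i. i - 2) {2..<2 * g + 2} {..<2 * g}"
      by (rule bij_betw_byWitness[where f' = "\<lambda>i. i + 2"]) auto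
    from bij_betw_trans[OF this h(1)] show "bij_betw h' {2..<2 * g + 2} D"
      by (rule bij_betw_cong[THEN iffD1, rotated]) (auto simp: h'_def)
    show "{c, f c} \<inter> D = {}" by (auto simp: D_def)
  qed
  moreover have "{0, 1} \<union> {2..<2 * g + 2} = {..<2 * Suc g}" by auto
  moreover have "{c, f c} \<union> D = C" using c(1,2) by (auto simp: D_def)
  moreover have "f (h' (2 * j)) = h' (2 * j + 1)" if "j < Suc g" for j
  proof (cases j)
    case (Suc i)
    then have "h' (2 * j) = h (2 * i)" "h' (2 * j + 1) = h (2 * i + 1)" by (auto simp: h'_def)
    then show ?thesis using h(2) Suc that by simp
  qed (simp add: h'_def)
  moreover have "h' 0 = c" by (simp add: h'_def)
  ultimately show ?case by (intro exI[of _ h']) simp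
qed

lemma head_node_arcs:
  assumes u: "ubg G" and d: "spans G d" "x \<in> set (node_arcs d)"
  shows "x \<in> arcs (dg G) \<and> head (dg G) x \<in> set (dverts d)"
proof -
  have "opp G x \<in> set (slots G d)" using d(2) by (induction d) auto
  then show ?thesis using set_slots[OF d(1)] ubgD(6,7)[OF u] by auto
qed

text \<open>A tree with the most vertices covers all trivalent vertices. If there are legs, the root
  arc has to come from leg 1 to make it the end 1; growth above the root then occurs only for
  \<open>p = 0\<close>.\<close>

lemma ex_spanning:
  assumes G: "G \<in> lgraphs g p" and n: "3 \<le> 2 * g + p"
  obtains a v l r where "spans G (DNode a v l r)" "distinct (dverts (DNode a v l r))"
    "set (dverts (DNode a v l r)) = verts_of_valence G 3"
    "p \<noteq> 0 \<Longrightarrow> tail (dg G) a \<in> verts_of_valence G 1 \<and> label G (tail (dg G) a) = 1"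
proof -
  note u = lgraphs_ubg[OF G]
  let ?V3 = "verts_of_valence G 3"
  define Q where "Q d \<longleftrightarrow> spans G d \<and> distinct (dverts d) \<and> dverts d \<noteq> [] \<and>
    (p \<noteq> 0 \<longrightarrow> tail (dg G) (root_arc d) \<in> verts_of_valence G 1 \<and> label G (tail (dg G) (root_arc d)) = 1)" for d
  have val: "v \<in> ?V3 \<or> valence G v = 1" if "v \<in> verts (dg G)" for v
    using G that by (auto simp: lgraphs_def verts_of_valence_def)
  have lab: "bij_betw (label G) (verts_of_valence G 1) {1..p}" using G by (simp add: lgraphs_def)
  have sub: "set (dverts d) \<subseteq> ?V3" if "spans G d" for d
  proof
    fix v assume v: "v \<in> set (dverts d)"
    then have "valence G v = 3" using that spans_valence by blast
    then have "out_arcs (dg G) v \<noteq> {}" by (metis card.empty out_degree_def zero_neq_numeral)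
    then obtain x where "x \<in> out_arcs (dg G) v" by blast
    then have "v \<in> verts (dg G)" using ubgD(9)[OF u, of x] by simp
    then show "v \<in> ?V3" using \<open>valence G v = 3\<close> by (simp add: verts_of_valence_def)
  qed
  have exQ: "\<exists>d. Q d"
  proof -
    have "\<exists>a\<in>arcs (dg G). head (dg G) a \<in> ?V3 \<and>
        (p \<noteq> 0 \<longrightarrow> tail (dg G) a \<in> verts_of_valence G 1 \<and> label G (tail (dg G) a) = 1)"
    proof (cases "p = 0")
      case True
      have "card ?V3 \<noteq> 0" using lgraphs_card[OF G n] n by linarith
      then have "?V3 \<noteq> {}" by auto
      then obtain v where v: "v \<in> ?V3" by blast
      then obtain x where "x \<in> out_arcs (dg G) v" using ex_out_arc[of v G 3] by auto
      then show ?thesis using v True ubgD(6,8)[OF u] by (intro bexI[of _ "opp G x"]) simp_all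
    next
      case False
      then have "1 \<in> {1..p}" by simp
      then obtain v where v: "v \<in> verts_of_valence G 1" "label G v = 1"
        using lab unfolding bij_betw_def by (metis imageE)
      then obtain x where x: "x \<in> out_arcs (dg G) v" using ex_out_arc[of v G 1] by auto
      moreover have "valence G v = 1" using v(1) by (simp add: verts_of_valence_def)
      ultimately have "head (dg G) x \<in> ?V3" using leg_head[OF G n, of x] by simp
      then show ?thesis using v x by (intro bexI[of _ x]) simp_all
    qed
    then obtain a where a: "a \<in> arcs (dg G)" "head (dg G) a \<in> ?V3"
      "p \<noteq> 0 \<longrightarrow> tail (dg G) a \<in> verts_of_valence G 1 \<and> label G (tail (dg G) a) = 1" by blast
    then have "valence G (head (dg G) a) = 3" "opp G a \<in> out_arcs (dg G) (head (dg G) a)"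
      using ubgD(6,7)[OF u] by (simp_all add: verts_of_valence_def)
    then obtain b c where "out_arcs (dg G) (head (dg G) a) = {opp G a, b, c}" "distinct [opp G a, b, c]"
      using valence_3_out_arcs by blast
    then have "Q (DNode a (head (dg G) a) (DLeaf b) (DLeaf c))"
      using a(3) unfolding Q_def spans.simps dverts.simps root_arc.simps by simp
    then show ?thesis by blast
  qed
  have bound: "length (dverts d) \<le> card (verts (dg G))" if "Q d" for d
  proof -
    have "spans G d" "distinct (dverts d)" using that by (simp_all add: Q_def)
    moreover from this have "set (dverts d) \<subseteq> verts (dg G)"
      using sub by (auto simp: verts_of_valence_def)
    ultimately show ?thesis using card_mono[OF ubgD(2)[OF u]] distinct_card by metis
  qed
  obtain d where d: "Q d" and max: "\<And>d'. Q d' \<Longrightarrow> length (dverts d') \<le> length (dverts d)"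
  proof -
    obtain d0 where "Q d0" using exQ by blast
    moreover have "\<forall>y. Q y \<longrightarrow> length (dverts y) < Suc (card (verts (dg G)))"
      using bound less_Suc_eq_le by blast
    ultimately have "\<exists>x. Q x \<and> (\<forall>y. Q y \<longrightarrow> length (dverts y) \<le> length (dverts x))"
      by (rule ex_has_greatest_nat)
    then show thesis using that by blast
  qed
  have sp: "spans G d" "distinct (dverts d)" "dverts d \<noteq> []" using d by (auto simp: Q_def)
  let ?W = "set (dverts d)"
  have no_larger: False if "Q d'" "set (dverts d') = insert w ?W" "w \<notin> ?W" for d' w
  proof -
    have "length (dverts d') = Suc (length (dverts d))"
      using that sp(2) by (metis Q_def List.finite_set card_insert_disjoint distinct_card)
    then show False using max[OF that(1)] by simp
  qed
  have "?V3 \<subseteq> ?W"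
  proof (rule ccontr)
    assume "\<not> ?V3 \<subseteq> ?W"
    then obtain w where w: "w \<in> ?V3" "w \<notin> ?W" by blast
    have "\<exists>b\<in>arcs (dg G). tail (dg G) b \<in> ?W \<and> head (dg G) b \<in> ?V3 - ?W"
    proof (rule ccontr)
      assume no: "\<not> ?thesis"
      \<comment> \<open>By assumption the neighbours outside \<open>?W\<close> have valence 1 and
        lead only back, so this set is closed under adjacency and would be everything.\<close>
      let ?X = "?W \<union> {head (dg G) b |b. b \<in> arcs (dg G) \<and> tail (dg G) b \<in> ?W}"
      obtain v0 where v0: "v0 \<in> ?W" using sp(3) by (cases "dverts d") auto
      have "verts (dg G) \<subseteq> ?X"
      proof (rule connected_closed[OF u])
        show "connected (dg G)" using G by (simp add: lgraphs_def)
        show "v0 \<in> ?X" using v0 by simp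
        show "v0 \<in> verts (dg G)" using v0 sub[OF sp(1)] by (auto simp: verts_of_valence_def)
        fix a assume a: "a \<in> arcs (dg G)" "tail (dg G) a \<in> ?X"
        show "head (dg G) a \<in> ?X"
        proof (cases "tail (dg G) a \<in> ?W")
          case True
          then show ?thesis using a(1) by auto
        next
          case False
          then obtain b where b: "b \<in> arcs (dg G)" "tail (dg G) b \<in> ?W" "tail (dg G) a = head (dg G) b"
            using a(2) by auto
          then have "valence G (head (dg G) b) = 1"
            using no False val ubgD(10)[OF u b(1)] by auto
          then have "out_arcs (dg G) (head (dg G) b) = {opp G b}"
            using valence_1_out_arcs[of G _ "opp G b"] b(1) ubgD(6,7)[OF u] by simp
          then have "a = opp G b" using a(1) b(3) by (metis in_out_arcs_conv singletonD)
          then show ?thesis using b ubgD(8)[OF u] by simp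
        qed
      qed
      then have "w \<in> ?X" using w(1) by (auto simp: verts_of_valence_def)
      then show False using w no by auto
    qed
    then obtain b where b: "b \<in> arcs (dg G)" "tail (dg G) b \<in> ?W" "head (dg G) b \<in> ?V3" "head (dg G) b \<notin> ?W"
      by blast
    let ?w = "head (dg G) b"
    have vw: "valence G ?w = 3" using b(3) by (simp add: verts_of_valence_def)
    have ob: "opp G b \<in> out_arcs (dg G) ?w" using b(1) ubgD(6,7)[OF u] by simp
    have "b \<in> set (slots G d)" using b set_slots[OF sp(1)] by simp
    then have "b \<in># mset (slots G d) + {#root_arc d#}" by simp
    then consider "b \<in> set (node_arcs d)" | x where "x \<in> set (node_arcs d)" "b = opp G x"
      | "b \<in> set (leaf_list (undec d))"
      unfolding mset_slots by auto
    then show False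
    proof cases
      case 1
      then show ?thesis using head_node_arcs[OF u sp(1)] b(4) by blast
    next
      \<comment> \<open>As \<open>x\<close> starts outside the tree, it is the root arc; the new
        vertex becomes the root, with the old tree as a child.\<close>
      case 2
      have "x \<in># mset (slots G d) + {#root_arc d#}" unfolding mset_slots using 2(1) by simp
      then have x: "x \<in> set (slots G d) \<or> x = root_arc d" by auto
      have xa: "x \<in> arcs (dg G)" using b(1) 2(2) ubgD(6)[OF u] by simp
      then have tx: "tail (dg G) x = ?w" using 2(2) ubgD(8)[OF u] by simp
      then have "x \<notin> set (slots G d)" using set_slots[OF sp(1)] b(4) by auto
      then have xr: "x = root_arc d" using x by blast
      then have p0: "p = 0" using d tx b(3) by (auto simp: Q_def verts_of_valence_def)
      obtain y z where yz: "out_arcs (dg G) ?w = {x, y, z}" "distinct [x, y, z]"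
        using valence_3_out_arcs[OF vw, of x] tx xa by auto
      have "out_arcs (dg G) ?w = {opp G (opp G y), root_arc d, z}"
        using yz(1) by (simp add: ubgD(4)[OF u] xr insert_commute)
      moreover have "distinct [opp G (opp G y), root_arc d, z]"
        using yz(2) unfolding ubgD(4)[OF u] xr by auto
      ultimately have "Q (DNode (opp G y) ?w d (DLeaf z))"
        using sp(1,2) p0 b(4) unfolding Q_def spans.simps dverts.simps root_arc.simps by simp
      then show ?thesis by (rule no_larger) (use b(4) in auto)
    next
      case 3
      obtain y z where yz: "out_arcs (dg G) ?w = {opp G b, y, z}" "distinct [opp G b, y, z]"
        using valence_3_out_arcs[OF vw ob] by auto
      obtain d' where "spans G d'" "root_arc d' = root_arc d" "set (dverts d') = insert ?w ?W" "distinct (dverts d')"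
        using spans_extend[OF yz sp(1) 3 sp(2) b(4)] by blast
      moreover from this have "Q d'" using d by (auto simp: Q_def)
      ultimately show ?thesis using no_larger b(4) by blast
    qed
  qed
  then have "?W = ?V3" using sub[OF sp(1)] by blast
  moreover obtain a v l r where "d = DNode a v l r" using sp(3) by (cases d) auto
  ultimately show thesis using that d unfolding Q_def by auto
qed

text \<open>With \<open>n = 2 * g + p\<close> there are \<open>n - 2\<close> nodes and
  \<open>n - 3\<close> edges between them, so \<open>3 * (n - 2) - 2 * (n - 3) = n\<close>
  half-edges leave the tree. Of these \<open>p\<close> lead to the legs, and the other
  \<open>2 * g\<close> are paired by \<open>opp\<close>.\<close>

lemma ex_rep:
  assumes G: "G \<in> lgraphs g p" and n: "3 \<le> 2 * g + p"
  obtains e t where "rep g p G e t" "distinct (leaf_list t)" "set (leaf_list t) = {2..2 * g + p}"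
proof -
  note u = lgraphs_ubg[OF G]
  let ?V3 = "verts_of_valence G 3"
  obtain a v l r where d: "spans G (DNode a v l r)" "distinct (dverts (DNode a v l r))"
    "set (dverts (DNode a v l r)) = ?V3"
    and leg1: "p \<noteq> 0 \<Longrightarrow> tail (dg G) a \<in> verts_of_valence G 1 \<and> label G (tail (dg G) a) = 1"
    using ex_spanning[OF G n] by blast
  define d where "d = DNode a v l r"
  define L where "L = leaf_list (undec d)"
  define R where "R = node_arcs l @ node_arcs r"
  note d = d[folded d_def]
  have sl: "set (slots G d) = {a \<in> arcs (dg G). tail (dg G) a \<in> ?V3}"
    using set_slots[OF d(1)] d(3) by simp
  have "mset (slots G d) + {#a#} = mset (a # R) + mset (map (opp G) (a # R)) + mset L"
    using mset_slots[of G d] by (simp add: d_def L_def R_def)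
  then have ms: "mset (slots G d) = mset (opp G a # R @ map (opp G) R @ L)"
    by simp
  have dist: "distinct (opp G a # R @ map (opp G) R @ L)"
    using distinct_slots[OF d(1,2)] mset_eq_imp_distinct_iff[OF ms] by blast
  have sets: "set (slots G d) = insert (opp G a) (set L) \<union> (set R \<union> opp G ` set R)"
    using mset_eq_setD[OF ms] by auto
  \<comment> \<open>\<open>O'\<close> collects the arcs leaving the tree, including the one at the
    root, and \<open>I\<close> both directions of the tree edges.\<close>
  define O' where "O' = insert (opp G a) (set L)"
  define I where "I = set R \<union> opp G ` set R"
  have OI: "set (slots G d) = O' \<union> I" "O' \<inter> I = {}" using sets dist by (auto simp: O'_def I_def)
  have Iopp: "opp G x \<in> I" if "x \<in> I" for x using that ubgD(4)[OF u] by (auto simp: I_def)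
  have len: "length (slots G d) = 3 * length (dverts d)" for d by (induction d) auto
  have lenR: "length (node_arcs d) = length (dverts d)" for d by (induction d) auto
  have cV: "length (dverts d) = 2 * g + p - 2" using distinct_card[OF d(2)] d(3) lgraphs_card[OF G n] by simp
  have "length (slots G d) = 1 + 2 * length R + length L" using arg_cong[OF ms, of size] by simp
  moreover have "length R + 1 = length (dverts d)" using lenR by (simp add: R_def d_def)
  ultimately have cL: "length L + 1 = 2 * g + p" using len cV n by simp
  have cO: "card O' = 2 * g + p"
    using cL dist distinct_card[of L] unfolding O'_def by (simp add: card_insert_if)
  have fO: "finite O'" by (simp add: O'_def)
  have Oarc: "x \<in> arcs (dg G)" "tail (dg G) x \<in> ?V3" if "x \<in> O'" for x
    using that sl OI by auto
  have lab: "bij_betw (label G) (verts_of_valence G 1) {1..p}" using G by (simp add: lgraphs_def)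
  have "\<forall>i\<in>{1..p}. \<exists>x. x \<in> arcs (dg G) \<and> head (dg G) x \<in> verts_of_valence G 1 \<and> label G (head (dg G) x) = i"
  proof
    fix i assume "i \<in> {1..p}"
    then obtain w where w: "w \<in> verts_of_valence G 1" "label G w = i"
      using lab unfolding bij_betw_def by (metis imageE)
    then obtain x where x: "x \<in> out_arcs (dg G) w" using ex_out_arc[of w G 1] by auto
    then show "\<exists>x. x \<in> arcs (dg G) \<and> head (dg G) x \<in> verts_of_valence G 1 \<and> label G (head (dg G) x) = i"
      using w ubgD(6,8)[OF u] by (intro exI[of _ "opp G x"]) auto
  qed
  then obtain s where s: "\<And>i. i \<in> {1..p} \<Longrightarrow>
      s i \<in> arcs (dg G) \<and> head (dg G) (s i) \<in> verts_of_valence G 1 \<and> label G (head (dg G) (s i)) = i"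
    by metis
  have leg_unique: "x = y" if "x \<in> arcs (dg G)" "y \<in> arcs (dg G)" "head (dg G) x = head (dg G) y"
    "valence G (head (dg G) x) = 1" for x y
  proof -
    have "opp G x \<in> out_arcs (dg G) (head (dg G) x)" "opp G y \<in> out_arcs (dg G) (head (dg G) x)"
      using that ubgD(6,7)[OF u] by auto
    then have "opp G x = opp G y" using valence_1_out_arcs[OF that(4)] by blast
    then show ?thesis using ubgD(4)[OF u] by metis
  qed
  have legval: "valence G (head (dg G) (s i)) = 1" if "i \<in> {1..p}" for i
    using s[OF that] by (simp add: verts_of_valence_def)
  have sO: "s i \<in> O'" if i: "i \<in> {1..p}" for i
  proof -
    have oa: "opp G (s i) \<in> arcs (dg G)" "tail (dg G) (opp G (s i)) = head (dg G) (s i)"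
      "head (dg G) (opp G (s i)) = tail (dg G) (s i)"
      using s[OF i] ubgD(6-8)[OF u] by auto
    then have "tail (dg G) (s i) \<in> ?V3" using leg_head[OF G n oa(1)] legval[OF i] by simp
    then have "s i \<in> set (slots G d)" using sl s[OF i] by simp
    moreover have "opp G (s i) \<notin> I"
      using OI sl oa(2) legval[OF i] by (auto simp: verts_of_valence_def)
    ultimately show ?thesis using OI Iopp[of "s i"] by auto
  qed
  have sinj: "inj_on s {1..p}" by (rule inj_onI) (metis s)
  define C where "C = O' - s ` {1..p}"
  have cC: "card C = 2 * g" "finite C"
    using cO fO sO sinj unfolding C_def by (auto simp: card_Diff_subset card_image image_subset_iff)
  have fC: "opp G x \<in> C \<and> opp G x \<noteq> x \<and> opp G (opp G x) = x" if x: "x \<in> C" for x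
  proof -
    have xO: "x \<in> O'" "x \<notin> s ` {1..p}" using x by (auto simp: C_def)
    note xa = Oarc[OF xO(1)]
    have "head (dg G) x \<in> ?V3"
    proof (rule ccontr)
      assume "\<not> ?thesis"
      then have h: "head (dg G) x \<in> verts_of_valence G 1"
        using G ubgD(10)[OF u xa(1)] by (auto simp: lgraphs_def verts_of_valence_def)
      then have i: "label G (head (dg G) x) \<in> {1..p}" using lab by (auto simp: bij_betw_def)
      then have "head (dg G) (s (label G (head (dg G) x))) = head (dg G) x"
        using s[OF i] h lab unfolding bij_betw_def inj_on_def by metis
      then have "s (label G (head (dg G) x)) = x"
        using leg_unique[of "s (label G (head (dg G) x))" x] s[OF i] xa(1) legval[OF i] by simp
      then show False using xO(2) i by (metis imageI)
    qed
    then have "opp G x \<in> set (slots G d)" using sl xa(1) ubgD(6,7)[OF u] by simp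
    moreover have "opp G x \<notin> I" using Iopp[of "opp G x"] ubgD(4)[OF u] xO(1) OI(2) by auto
    ultimately have "opp G x \<in> O'" using OI by blast
    moreover have "opp G x \<notin> s ` {1..p}"
    proof
      assume "opp G x \<in> s ` {1..p}"
      then obtain i where i: "i \<in> {1..p}" and "opp G x = s i" by blast
      then have "tail (dg G) x = head (dg G) (s i)" using ubgD(8)[OF u xa(1)] by simp
      then show False using xa(2) legval[OF i] by (simp add: verts_of_valence_def)
    qed
    ultimately have "opp G x \<in> C" unfolding C_def by blast
    then show ?thesis using ubgD(4)[OF u] ubgD(5)[OF u xa(1)] by simp
  qed
  \<comment> \<open>For \<open>p = 0\<close> the enumeration of the pairs starts at the root, which
    makes \<open>e 1 = opp G a\<close>.\<close>
  obtain c where c: "0 < g \<Longrightarrow> c \<in> C" "p = 0 \<Longrightarrow> c = opp G a"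
  proof (cases "p = 0")
    case True
    then have "opp G a \<in> C" by (auto simp: C_def O'_def)
    then show thesis using that by blast
  next
    case False
    have "0 < g \<Longrightarrow> C \<noteq> {}" using cC by auto
    then show thesis using that False by (metis ex_in_conv)
  qed
  obtain h where h: "bij_betw h {..<2 * g} C" "\<And>j. j < g \<Longrightarrow> opp G (h (2 * j)) = h (2 * j + 1)"
    "0 < g \<Longrightarrow> h 0 = c"
    using pair_enumeration[OF cC fC c(1)] by blast
  define e where "e i = (if i \<le> p then s i else h (i - p - 1))" for i
  have "bij_betw e ({1..p} \<union> {p + 1..2 * g + p}) (s ` {1..p} \<union> C)"
  proof (rule bij_betw_combine)
    show "bij_betw e {1..p} (s ` {1..p})"
      using inj_on_imp_bij_betw[OF sinj] by (rule bij_betw_cong[THEN iffD1, rotated]) (simp add: e_def)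
    have "bij_betw (\<lambda>i. i - p - 1) {p + 1..2 * g + p} {..<2 * g}"
      by (rule bij_betw_byWitness[where f' = "\<lambda>i. i + p + 1"]) auto
    from bij_betw_trans[OF this h(1)] show "bij_betw e {p + 1..2 * g + p} C"
      by (rule bij_betw_cong[THEN iffD1, rotated]) (auto simp: e_def)
    show "s ` {1..p} \<inter> C = {}" by (auto simp: C_def)
  qed
  moreover have "{1..p} \<union> {p + 1..2 * g + p} = {1..2 * g + p}" by auto
  moreover have "s ` {1..p} \<union> C = O'" using sO by (auto simp: C_def)
  ultimately have e: "bij_betw e {1..2 * g + p} O'" by simp
  have e1: "e 1 = opp G a"
  proof (cases "p = 0")
    case True
    then show ?thesis using h(3) c n by (simp add: e_def)
  next
    case False
    then have 1: "1 \<in> {1..p}" by simp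
    have "opp G a \<in> O'" by (simp add: O'_def)
    then have a: "a \<in> arcs (dg G)" using Oarc(1) ubgD(6)[OF u] by blast
    have "head (dg G) (s 1) = tail (dg G) a"
      using s[OF 1] leg1[OF False] lab unfolding bij_betw_def inj_on_def by metis
    then have "s 1 = opp G a"
      using leg_unique[of "s 1" "opp G a"] s[OF 1] legval[OF 1] a ubgD(6,8)[OF u] by simp
    then show ?thesis using False by (simp add: e_def)
  qed
  have "marking g p G e"
    unfolding marking_def
  proof (intro conjI ballI allI impI)
    show "inj_on e {1..2 * g + p}" "e ` {1..2 * g + p} \<subseteq> arcs (dg G)"
      using e Oarc(1) by (auto simp: bij_betw_def)
    show "head (dg G) (e i) \<in> verts_of_valence G 1" "label G (head (dg G) (e i)) = i"
      if "i \<in> {1..p}" for i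
      using s[OF that] that by (simp_all add: e_def)
    show "opp G (e (p + 2 * j + 1)) = e (p + 2 * j + 2)" if "j < g" for j
      using h(2)[OF that] by (simp add: e_def)
  qed
  moreover define t where "t = map_btree (inv_into {1..2 * g + p} e) (undec d)"
  have inv: "e (inv_into {1..2 * g + p} e x) = x" if "x \<in> O'" for x
    using e that by (simp add: bij_betw_def f_inv_into_f)
  have "map_btree e t = undec d"
  proof -
    have "map_btree (e \<circ> inv_into {1..2 * g + p} e) s = s" if "set (leaf_list s) \<subseteq> O'" for s
      using that by (induction s) (auto simp: inv simp del: One_nat_def)
    then show ?thesis unfolding t_def by (simp add: btree.map_comp O'_def L_def subset_insertI)
  qed
  ultimately have rep: "rep g p G e t"
    unfolding rep_def using G d e1 ubgD(4)[OF u] by (intro conjI exI[of _ d]) (auto simp: d_def)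
  have inj: "inj_on (inv_into {1..2 * g + p} e) O'"
    using e by (metis bij_betw_def bij_betw_inv_into)
  have "distinct (leaf_list t)"
    unfolding t_def leaf_list_map distinct_map using dist inj_on_subset[OF inj, of "set L"]
    by (auto simp: L_def O'_def)
  moreover have "set (leaf_list t) = {2..2 * g + p}"
  proof -
    have "set L = O' - {e 1}" using dist e1 by (auto simp: O'_def)
    moreover have "inv_into {1..2 * g + p} e ` (O' - {e 1}) = {1..2 * g + p} - {1}"
    proof -
      have "bij_betw (inv_into {1..2 * g + p} e) O' {1..2 * g + p}" by (rule bij_betw_inv_into[OF e])
      moreover have "inv_into {1..2 * g + p} e (e 1) = 1"
        using e n by (auto simp: bij_betw_def intro!: inv_into_f_f)
      moreover have "e 1 \<in> O'" using e1 by (simp add: O'_def)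
      ultimately show ?thesis
        using inj_on_image_set_diff[OF inj, of O' "{e 1}"] by (simp add: bij_betw_def)
    qed
    ultimately show ?thesis unfolding t_def leaf_list_map L_def[symmetric] by auto
  qed
  ultimately show thesis using that rep by blast
qed


subsection \<open>Caterpillars\<close>

text \<open>
  A path of \<open>m\<close> trivalent vertices.  Its \<open>m + 2\<close> free half-edges are \<open>0, \<dots>, m + 1\<close>, in the order
  in which they hang off the path; the first \<open>p\<close> of them are joined to the legs \<open>3 m, \<dots>, 3 m + p - 1\<close> and
  the others to each other in consecutive pairs.  The half-edges \<open>m + 1 + i\<close> and \<open>2 m + i\<close> form the
  edge of the path between the vertices \<open>i - 1\<close> and \<open>i\<close>.
\<close>

definition cat_tail :: "nat \<Rightarrow> nat \<Rightarrow> nat" where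
  "cat_tail m h = (if h < m + 2 then min (h - 1) (m - 1) else if h < 2 * m + 1 then h - (m + 1)
     else if h < 3 * m then h - (2 * m + 1) else h - 2 * m)"

text \<open>Outside the arcs this is the identity, as \<open>bidirected_digraph\<close>
  requires.\<close>

definition cat_opp :: "nat \<Rightarrow> nat \<Rightarrow> nat \<Rightarrow> nat" where
  "cat_opp m p h = (if h < p then 3 * m + h
     else if h < m + 2 then (if even (h - p) then h + 1 else h - 1)
     else if h < 2 * m + 1 then h + (m - 1) else if h < 3 * m then h - (m - 1)
     else if h < 3 * m + p then h - 3 * m else h)"

definition caterpillar :: "nat \<Rightarrow> nat \<Rightarrow> lgraph" where
  "caterpillar m p = \<lparr>dg = \<lparr>verts = {..<m + p}, arcs = {..<3 * m + p}, tail = cat_tail m,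
     head = cat_tail m \<circ> cat_opp m p\<rparr>, opp = cat_opp m p, label = \<lambda>v. v + 1 - m\<rparr>"

lemma caterpillar_simps [simp]:
  "verts (dg (caterpillar m p)) = {..<m + p}" "arcs (dg (caterpillar m p)) = {..<3 * m + p}"
  "tail (dg (caterpillar m p)) = cat_tail m" "head (dg (caterpillar m p)) = cat_tail m \<circ> cat_opp m p"
  "opp (caterpillar m p) = cat_opp m p" "label (caterpillar m p) v = v + 1 - m"
  by (simp_all add: caterpillar_def)

lemma card_pairs:
  assumes "finite A" "\<And>x. x \<in> A \<Longrightarrow> f x \<in> A \<and> f x \<noteq> x \<and> f (f x) = x"
  shows "2 * card {{a, f a} |a. a \<in> A} = card A"
proof -
  define P where "P = (\<lambda>a. {a, f a}) ` A"
  have fA: "f a \<in> A" "f a \<noteq> a" "f (f a) = a" if "a \<in> A" for a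
    using assms(2)[OF that] by blast+
  have P: "\<Union>P = A" using fA(1) unfolding P_def by blast
  have "2 * card P = card (\<Union>P)"
  proof (rule card_partition)
    show "finite P" "finite (\<Union>P)" using assms(1) P by (simp_all add: P_def)
    show "card c = 2" if c: "c \<in> P" for c
    proof -
      obtain a where a: "c = {a, f a}" "a \<in> A" using c unfolding P_def by blast
      show ?thesis unfolding a(1) using fA(2)[OF a(2)] by (simp add: card_insert_if)
    qed
    show "c1 \<inter> c2 = {}" if c: "c1 \<in> P" "c2 \<in> P" "c1 \<noteq> c2" for c1 c2
    proof -
      obtain a b where a: "c1 = {a, f a}" "a \<in> A" and b: "c2 = {b, f b}" "b \<in> A"
        using c(1,2) unfolding P_def by blast
      have ne: "a \<noteq> b" using a(1) b(1) c(3) by blast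
      have "a \<noteq> f b"
      proof
        assume "a = f b"
        then have "f a = b" using fA(3)[OF b(2)] by simp
        then show False using \<open>a = f b\<close> a(1) b(1) c(3) by (simp add: insert_commute)
      qed
      moreover have "f a \<noteq> b"
      proof
        assume "f a = b"
        then have "f b = a" using fA(3)[OF a(2)] by simp
        then show False using \<open>f a = b\<close> a(1) b(1) c(3) by (simp add: insert_commute)
      qed
      moreover have "f a \<noteq> f b" using fA(3)[OF a(2)] fA(3)[OF b(2)] ne by metis
      ultimately show ?thesis using ne a(1) b(1) by simp
    qed
  qed
  moreover have "P = {{a, f a} |a. a \<in> A}" unfolding P_def by blast
  ultimately show ?thesis using P by simp
qed

locale cat_params =
  fixes g p m :: nat
  assumes m: "m + 2 = 2 * g + p" "1 \<le> m"
begin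

lemma p_le: "p \<le> m + 2" "even (m + 2 - p)"
  using m by auto

text \<open>The number \<open>m + 2 - p = 2 * g\<close> of half-edges to be glued is even, so the
  last one is not left without a partner.\<close>

lemma pair_less:
  assumes "p \<le> h" "h < m + 2" "even (h - p)"
  shows "h + 1 < m + 2"
proof (rule ccontr)
  assume "\<not> ?thesis"
  then have "m + 2 - p = Suc (h - p)" using assms by simp
  then show False using p_le assms(3) by simp
qed

lemma cat_opp: "h < 3 * m + p \<Longrightarrow> cat_opp m p h < 3 * m + p \<and> cat_opp m p h \<noteq> h"
  "cat_opp m p (cat_opp m p h) = h"
proof -
  note pair = pair_less
  consider "h < p" | "p \<le> h" "h < m + 2" "even (h - p)" | "p \<le> h" "h < m + 2" "odd (h - p)"
    | "m + 2 \<le> h" "h < 2 * m + 1" | "2 * m + 1 \<le> h" "h < 3 * m" | "3 * m \<le> h" "h < 3 * m + p"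
    | "3 * m + p \<le> h"
    by linarith
  then have "(h < 3 * m + p \<longrightarrow> cat_opp m p h < 3 * m + p \<and> cat_opp m p h \<noteq> h) \<and>
      cat_opp m p (cat_opp m p h) = h"
  proof cases
    case 2
    then have "cat_opp m p h = h + 1" "cat_opp m p (h + 1) = h"
      using pair[of h] by (auto simp: cat_opp_def Suc_diff_le)
    then show ?thesis using pair[OF 2] m by auto
  next
    case 3
    then have "p < h" by (cases "h = p") auto
    moreover from this have "even (h - 1 - p)" using 3(3) by (metis Suc_diff_Suc Suc_diff_diff diff_Suc_1 even_Suc diff_commute)
    ultimately have "cat_opp m p h = h - 1" "cat_opp m p (h - 1) = h"
      using 3 by (auto simp: cat_opp_def)
    then show ?thesis using 3 \<open>p < h\<close> by auto
  qed (use m p_le in \<open>auto simp: cat_opp_def\<close>)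
  then show "h < 3 * m + p \<Longrightarrow> cat_opp m p h < 3 * m + p \<and> cat_opp m p h \<noteq> h"
    "cat_opp m p (cat_opp m p h) = h" by blast+
qed

lemma cat_tail_less: "h < 3 * m + p \<Longrightarrow> cat_tail m h < m + p"
  using m p_le by (auto simp: cat_tail_def)

lemma ubg_caterpillar: "ubg (caterpillar m p)"
proof -
  have wf: "wf_digraph (dg (caterpillar m p))"
    by unfold_locales (auto intro: cat_tail_less simp: cat_opp(1))
  moreover have "bidirected_digraph (dg (caterpillar m p)) (opp (caterpillar m p))"
  proof (intro bidirected_digraph.intro wf bidirected_digraph_axioms.intro)
    show "a \<in> arcs (dg (caterpillar m p)) \<longleftrightarrow> opp (caterpillar m p) a \<noteq> a" for a
      using cat_opp(1)[of a] p_le m by (cases "a < 3 * m + p") (auto simp: cat_opp_def)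
  qed (auto simp: cat_opp)
  ultimately show ?thesis by (auto simp: ubg_def fin_digraph_def fin_digraph_axioms_def)
qed

lemma caterpillar_out_arcs:
  assumes "i < m"
  shows "out_arcs (dg (caterpillar m p)) i =
    {i + 1, if i = 0 then 0 else m + 1 + i, if i = m - 1 then m + 1 else 2 * m + 1 + i}"
proof -
  have "h < 3 * m + p \<and> cat_tail m h = i \<longleftrightarrow> h = i + 1 \<or> h = (if i = 0 then 0 else m + 1 + i) \<or>
      h = (if i = m - 1 then m + 1 else 2 * m + 1 + i)" for h
    using assms m(2) by (cases "h < m + 2"; cases "h < 2 * m + 1"; cases "h < 3 * m")
      (auto simp: cat_tail_def min_def)
  then show ?thesis by (auto simp: out_arcs_def set_eq_iff)
qed

lemma caterpillar_out_arcs_leg: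
  assumes "i < p"
  shows "out_arcs (dg (caterpillar m p)) (m + i) = {3 * m + i}"
proof -
  have "h < 3 * m + p \<and> cat_tail m h = m + i \<longleftrightarrow> h = 3 * m + i" for h
    using assms m(2) by (cases "h < m + 2"; cases "h < 2 * m + 1"; cases "h < 3 * m")
      (auto simp: cat_tail_def min_def)
  then show ?thesis by (auto simp: out_arcs_def set_eq_iff)
qed

lemma caterpillar_valence:
  "v < m \<Longrightarrow> valence (caterpillar m p) v = 3"
  "m \<le> v \<Longrightarrow> v < m + p \<Longrightarrow> valence (caterpillar m p) v = 1"
proof -
  show "valence (caterpillar m p) v = 3" if "v < m"
    using caterpillar_out_arcs[OF that] that by (simp add: out_degree_def)
  show "valence (caterpillar m p) v = 1" if "m \<le> v" "v < m + p"
    using caterpillar_out_arcs_leg[of "v - m"] that by (simp add: out_degree_def)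
qed

lemma caterpillar_verts_of_valence:
  "verts_of_valence (caterpillar m p) 3 = {..<m}" "verts_of_valence (caterpillar m p) 1 = {m..<m + p}"
proof -
  have "valence (caterpillar m p) v = 3 \<longleftrightarrow> v < m" "valence (caterpillar m p) v = 1 \<longleftrightarrow> m \<le> v"
    if "v < m + p" for v
    using caterpillar_valence[of v] that by (cases "v < m"; simp)+
  then show "verts_of_valence (caterpillar m p) 3 = {..<m}" "verts_of_valence (caterpillar m p) 1 = {m..<m + p}"
    by (auto simp: verts_of_valence_def)
qed

lemma caterpillar_adj_path:
  assumes "Suc i < m"
  shows "(i, Suc i) \<in> arcs_ends (dg (caterpillar m p))"
  unfolding arcs_ends_conv
proof (rule image_eqI)
  have "cat_opp m p (2 * m + 1 + i) = m + 2 + i" using assms p_le m by (auto simp: cat_opp_def)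
  then show "(i, Suc i) = (tail (dg (caterpillar m p)) (2 * m + 1 + i), head (dg (caterpillar m p)) (2 * m + 1 + i))"
    using assms by (auto simp: cat_tail_def)
qed (use assms in auto)

lemma caterpillar_leg_head: "i < p \<Longrightarrow> cat_opp m p (3 * m + i) = i"
  using p_le m by (auto simp: cat_opp_def)

lemma caterpillar_lgraphs: "caterpillar m p \<in> lgraphs g p"
proof -
  let ?G = "caterpillar m p"
  note u = ubg_caterpillar
  have to0: "(i, 0) \<in> (arcs_ends (dg ?G))\<^sup>*" if "i < m" for i
    using that
  proof (induction i)
    case (Suc i)
    have "(Suc i, i) \<in> arcs_ends (dg ?G)" by (rule ubg_adj_sym[OF u caterpillar_adj_path[OF Suc.prems]])
    moreover have "(i, 0) \<in> (arcs_ends (dg ?G))\<^sup>*" using Suc by simp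
    ultimately show ?case by (rule converse_rtrancl_into_rtrancl)
  qed simp
  have "(v, 0) \<in> (arcs_ends (dg ?G))\<^sup>*" if "v < m + p" for v
  proof (cases "v < m")
    case False
    define i where "i = v - m"
    have i: "v = m + i" "i < p" using that False by (simp_all add: i_def)
    have "(v, cat_tail m i) = (tail (dg ?G) (3 * m + i), head (dg ?G) (3 * m + i))"
      using i m caterpillar_leg_head[OF i(2)] by (simp add: cat_tail_def)
    moreover have "3 * m + i \<in> arcs (dg ?G)" using i by simp
    ultimately have "(v, cat_tail m i) \<in> arcs_ends (dg ?G)"
      unfolding arcs_ends_conv by (rule image_eqI)
    moreover have "cat_tail m i < m" using i p_le m by (auto simp: cat_tail_def)
    ultimately show ?thesis using to0 by (meson converse_rtrancl_into_rtrancl)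
  qed (rule to0)
  moreover have "sym ((arcs_ends (dg ?G))\<^sup>*)"
    by (intro sym_rtrancl symI) (rule ubg_adj_sym[OF u])
  ultimately have "(v, w) \<in> (arcs_ends (dg ?G))\<^sup>*" if "v < m + p" "w < m + p" for v w
    using that by (meson rtrancl_trans symE)
  moreover have "0 \<in> verts (dg ?G)" using m by simp
  ultimately have conn: "connected (dg ?G)" unfolding ubg_connected_iff[OF u] by auto
  \<comment> \<open>With \<open>(3 * m + p) / 2\<close> edges and \<open>m + p\<close> vertices the
    rank is \<open>(m - p) / 2 + 1 = g\<close>.\<close>
  have "2 * card {{a, opp ?G a} |a. a \<in> arcs (dg ?G)} = card (arcs (dg ?G))"
    by (rule card_pairs) (use cat_opp in auto)
  then have "2 * int (card {{a, opp ?G a} |a. a \<in> arcs (dg ?G)}) = 3 * int m + int p" by simp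
  moreover have "int m + 2 = 2 * int g + int p" using m(1) by linarith
  ultimately have rank: "graph_rank ?G = int g"
    unfolding graph_rank_def by simp
  have lab: "bij_betw (label ?G) {m..<m + p} {1..p}"
    by (rule bij_betw_byWitness[where f' = "\<lambda>i. i + m - 1"]) auto
  show ?thesis
    unfolding lgraphs_def mem_Collect_eq caterpillar_verts_of_valence
  proof (intro conjI ballI)
    show "valence ?G v = 1 \<or> valence ?G v = 3" if "v \<in> verts (dg ?G)" for v
      using that caterpillar_valence[of v] by (cases "v < m") simp_all
  qed (use u conn rank lab m(1) in \<open>simp_all add: ubg_def del: caterpillar_simps\<close>)
qed

text \<open>The position along the path, to which a leg is assigned by its vertex of attachment.\<close>

definition cat_pos :: "nat \<Rightarrow> nat" where
  "cat_pos v = (if v < m then v else min (v - m - 1) (m - 1))"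

text \<open>Half-edges are glued in consecutive pairs so that these edges, too, join positions at
  distance at most one.\<close>

lemma cat_pos_arc: "h < 3 * m + p \<Longrightarrow>
  cat_pos (cat_tail m h) \<le> Suc (cat_pos (cat_tail m (cat_opp m p h)))"
proof -
  have pos: "cat_pos v = v" if "v < m" for v using that by (simp add: cat_pos_def)
  have pos_min: "cat_pos (min x (m - 1)) = min x (m - 1)" for x by (rule pos) (use m(2) in linarith)
  assume "h < 3 * m + p"
  then consider "h < p" | "p \<le> h" "h < m + 2" "even (h - p)" | "p \<le> h" "h < m + 2" "odd (h - p)"
    | "m + 2 \<le> h" "h < 2 * m + 1" | "2 * m + 1 \<le> h" "h < 3 * m" | "3 * m \<le> h" "h < 3 * m + p"
    by linarith
  then show ?thesis
  proof cases
    case 1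
    then have "cat_opp m p h = 3 * m + h" "cat_tail m h = min (h - 1) (m - 1)" "cat_tail m (3 * m + h) = m + h"
      using p_le m by (simp_all add: cat_opp_def cat_tail_def)
    then show ?thesis using pos[of "min (h - 1) (m - 1)"] m by (simp add: cat_pos_def)
  next
    case 2
    then have "cat_opp m p h = h + 1" "cat_tail m h = min (h - 1) (m - 1)" "cat_tail m (h + 1) = min h (m - 1)"
      using pair_less[of h] by (simp_all add: cat_opp_def cat_tail_def)
    then show ?thesis using pos[of "min (h - 1) (m - 1)"] pos[of "min h (m - 1)"] m(2) by (auto simp: min_def)
  next
    case 3
    then have "cat_opp m p h = h - 1" "cat_tail m h = min (h - 1) (m - 1)" "cat_tail m (h - 1) = min (h - 1 - 1) (m - 1)"
      by (simp_all add: cat_opp_def cat_tail_def)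
    moreover have "min (h - 1) (m - 1) \<le> Suc (min (h - 1 - 1) (m - 1))" by linarith
    ultimately show ?thesis by (simp only: pos_min)
  next
    case 4
    then have "cat_opp m p h = h + (m - 1)" "cat_tail m h = h - (m + 1)" "cat_tail m (h + (m - 1)) = h - (m + 2)"
      using p_le by (simp_all add: cat_opp_def cat_tail_def)
    then show ?thesis using pos[of "h - (m + 1)"] pos[of "h - (m + 2)"] 4 m by simp
  next
    case 5
    then have "cat_opp m p h = h - (m - 1)" "cat_tail m h = h - (2 * m + 1)" "cat_tail m (h - (m - 1)) = h - 2 * m"
      using p_le by (simp_all add: cat_opp_def cat_tail_def mult_2)
    then show ?thesis using pos[of "h - (2 * m + 1)"] pos[of "h - 2 * m"] 5 m by simp
  next
    case 6
    then have "cat_opp m p h = h - 3 * m" "cat_tail m h = h - 2 * m"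
      "cat_tail m (h - 3 * m) = min (h - 3 * m - 1) (m - 1)"
      using p_le m by (simp_all add: cat_opp_def cat_tail_def)
    then show ?thesis using pos[of "min (h - 3 * m - 1) (m - 1)"] 6 m by (simp add: cat_pos_def)
  qed
qed

lemma caterpillar_near:
  assumes "near (caterpillar m p) k y z"
  shows "cat_pos y \<le> cat_pos z + k"
  using assms
proof (induction k arbitrary: z)
  case (Suc k)
  then obtain w where w: "near (caterpillar m p) k y w" "(w, z) \<in> arcs_ends (dg (caterpillar m p)) \<or> w = z"
    by (auto simp: near_Suc)
  from w(2) have "cat_pos w \<le> Suc (cat_pos z)"
  proof
    assume "(w, z) \<in> arcs_ends (dg (caterpillar m p))"
    then obtain h where "h < 3 * m + p" "w = cat_tail m h" "z = cat_tail m (cat_opp m p h)"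
      unfolding arcs_ends_conv by auto
    then show ?thesis using cat_pos_arc by simp
  qed simp
  then show ?case using Suc.IH[OF w(1)] by simp
qed simp

end


subsection \<open>Pairs of distinct graphs\<close>

lemma swap_lgraphs:
  assumes G: "G \<in> lgraphs g p"
    and u: "out_arcs (dg G) u = {opp G a, b', b}" "distinct [opp G a, b', b]"
    and v: "out_arcs (dg G) v = {a, c', c}" "distinct [a, c', c]"
    and uv: "u \<noteq> v"
  defines "H \<equiv> retail G (tail (dg G) \<circ> Transposition.transpose b c)"
  shows "H \<in> lgraphs g p" "verts_of_valence H k = verts_of_valence G k"
proof -
  note U = lgraphs_ubg[OF G]
  note M = swap_tails_move[OF U u v uv, folded H_def]
  have mem: "c \<in> out_arcs (dg G) v" "b \<in> out_arcs (dg G) u" "opp G a \<in> out_arcs (dg G) u"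
    "b' \<in> out_arcs (dg G) u" "a \<in> out_arcs (dg G) v" "c' \<in> out_arcs (dg G) v"
    unfolding u(1) v(1) by simp_all
  have ne: "c \<noteq> opp G a" "c \<noteq> b'" "b \<noteq> a" "b \<noteq> c'" using mem uv by auto
  have "simultaneous_move G H" using M(2) unfolding simul_def simultaneous_move_def by blast
  moreover have "valence H w = valence G w" for w
  proof -
    consider "w = u" | "w = v" | "w \<notin> {u, v}" by blast
    then show ?thesis
    proof cases
      case 1
      have "card {opp G a, b', c} = card {opp G a, b', b}" using u(2) ne by simp
      then show ?thesis unfolding out_degree_def 1 M(3) u(1) .
    next
      case 2
      have "card {a, c', b} = card {a, c', c}" using v(2) ne by simp
      then show ?thesis unfolding out_degree_def 2 M(4) v(1) .
    next
      case 3
      then show ?thesis using simul_out_arcs[OF U M(2) 3] by (simp add: out_degree_def)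
    qed
  qed
  ultimately show "H \<in> lgraphs g p" "verts_of_valence H k = verts_of_valence G k"
    using lgraphs_move[OF G] by blast+
qed

section \<open>Invariants that do not see the labels\<close>

definition loop_arcs :: "lgraph \<Rightarrow> nat set" where
  "loop_arcs G = {a \<in> arcs (dg G). tail (dg G) a = tail (dg G) (opp G a)}"

text \<open>The invariant for trees, where no loops are available: caterpillars of rank 0 have this
  property.\<close>

definition leafy :: "lgraph \<Rightarrow> bool" where
  "leafy G \<longleftrightarrow> (\<forall>v\<in>verts_of_valence G 3. \<exists>a\<in>out_arcs (dg G) v. valence G (head (dg G) a) = 1)"

lemma lgraph_iso_loops:
  assumes "ubg G" "lgraph_iso G H"
  shows "card (loop_arcs G) = card (loop_arcs H)"
proof -
  obtain f k where f: "bij_betw f (verts (dg G)) (verts (dg H))"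
    and k: "bij_betw k (arcs (dg G)) (arcs (dg H))"
    and c: "\<forall>a\<in>arcs (dg G). tail (dg H) (k a) = f (tail (dg G) a) \<and>
        head (dg H) (k a) = f (head (dg G) a) \<and> opp H (k a) = k (opp G a)"
    using assms(2) unfolding lgraph_iso_def by blast
  have eq: "k a \<in> loop_arcs H \<longleftrightarrow> a \<in> loop_arcs G" if a: "a \<in> arcs (dg G)" for a
  proof -
    have oa: "opp G a \<in> arcs (dg G)" using a ubgD(6)[OF assms(1)] by simp
    have "tail (dg H) (opp H (k a)) = f (tail (dg G) (opp G a))" using c a oa by simp
    moreover have "f (tail (dg G) a) = f (tail (dg G) (opp G a)) \<longleftrightarrow> tail (dg G) a = tail (dg G) (opp G a)"
      using f ubgD(9)[OF assms(1)] a oa unfolding bij_betw_def inj_on_def by metis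
    moreover have "k a \<in> arcs (dg H)" using k a unfolding bij_betw_def by blast
    ultimately show ?thesis using c a by (simp add: loop_arcs_def)
  qed
  have "k ` loop_arcs G = loop_arcs H"
  proof (intro equalityI subsetI)
    fix y assume "y \<in> k ` loop_arcs G"
    then show "y \<in> loop_arcs H" using eq by (auto simp: loop_arcs_def)
  next
    fix y assume y: "y \<in> loop_arcs H"
    then have "y \<in> k ` arcs (dg G)" using k by (auto simp: loop_arcs_def bij_betw_def)
    then show "y \<in> k ` loop_arcs G" using y eq by blast
  qed
  moreover have "inj_on k (loop_arcs G)"
    using k by (auto simp: bij_betw_def loop_arcs_def intro: inj_on_subset)
  ultimately show ?thesis by (metis card_image)
qed

lemma lgraph_iso_leafy:
  assumes "ubg G" "lgraph_iso G H" "leafy G"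
  shows "leafy H"
  unfolding leafy_def
proof
  obtain f k where f: "bij_betw f (verts (dg G)) (verts (dg H))"
    and k: "bij_betw k (arcs (dg G)) (arcs (dg H))"
    and c: "\<And>a. a \<in> arcs (dg G) \<Longrightarrow> tail (dg H) (k a) = f (tail (dg G) a) \<and>
        head (dg H) (k a) = f (head (dg G) a) \<and> opp H (k a) = k (opp G a)"
    using assms(2) unfolding lgraph_iso_def by blast
  have val: "valence H (f v) = valence G v" if "v \<in> verts (dg G)" for v
    using lgraph_iso_valence[OF ubgD(1)[OF assms(1)] f k _ that] c by blast
  fix w assume w: "w \<in> verts_of_valence H 3"
  then obtain v where v: "v \<in> verts (dg G)" "w = f v"
    using f by (auto simp: verts_of_valence_def bij_betw_def)
  then have "v \<in> verts_of_valence G 3" using w val by (simp add: verts_of_valence_def)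
  then obtain a where a: "a \<in> out_arcs (dg G) v" "valence G (head (dg G) a) = 1"
    using assms(3) by (auto simp: leafy_def)
  then have "k a \<in> out_arcs (dg H) w" "valence H (head (dg H) (k a)) = 1"
    using c k v val[of "head (dg G) a"] ubgD(10)[OF assms(1)] by (auto simp: bij_betw_def)
  then show "\<exists>a\<in>out_arcs (dg H) w. valence H (head (dg H) a) = 1" by blast
qed

text \<open>The loop of \<open>c\<close> and \<open>c'\<close> at \<open>v\<close> is destroyed, as
  \<open>c\<close> leaves while \<open>c'\<close> stays. No loop arises: \<open>b\<close> arrives at
  \<open>v\<close>, where its opposite could only be \<open>a\<close> or \<open>c'\<close>, but
  \<open>opp G a\<close> differs from \<open>b\<close> and \<open>opp G c'\<close> is
  \<open>c\<close>.\<close>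

lemma swap_loops:
  assumes G: "ubg G"
    and u: "out_arcs (dg G) u = {opp G a, b', b}" "distinct [opp G a, b', b]"
    and v: "out_arcs (dg G) v = {a, c', c}" "distinct [a, c', c]"
    and uv: "u \<noteq> v" and c: "opp G c = c'"
  defines "H \<equiv> retail G (tail (dg G) \<circ> Transposition.transpose b c)"
  shows "card (loop_arcs H) < card (loop_arcs G)"
proof (rule psubset_card_mono)
  show "finite (loop_arcs G)" using ubgD(3)[OF G] by (simp add: loop_arcs_def)
  have mem: "c \<in> out_arcs (dg G) v" "b \<in> out_arcs (dg G) u" "a \<in> out_arcs (dg G) v" "c' \<in> out_arcs (dg G) v"
    unfolding u(1) v(1) by simp_all
  then have t: "tail (dg G) c = v" "tail (dg G) c' = v" "tail (dg G) b = u" "tail (dg G) a = v"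
    "c \<in> arcs (dg G)" "b \<in> arcs (dg G)" by simp_all
  have ob: "opp G b \<noteq> a" "opp G b \<noteq> c" "opp G b \<noteq> c'" "opp G b \<noteq> b"
    using u(2) t uv c ubgD(4)[OF G] ubgD(5)[OF G t(6)] by (metis distinct_length_2_or_more)+
  have tH: "tail (dg H) x = (if x = b then v else if x = c then u else tail (dg G) x)" for x
    using t uv by (auto simp: H_def Transposition.transpose_def)
  have vx: "x = a \<or> x = c' \<or> x = c" if "x \<in> arcs (dg G)" "tail (dg G) x = v" for x
  proof -
    have "x \<in> out_arcs (dg G) v" using that by simp
    then show ?thesis unfolding v(1) by simp
  qed
  have arcs: "arcs (dg H) = arcs (dg G)" "opp H = opp G" by (simp_all add: H_def)
  have "c \<in> loop_arcs G" using t c by (simp add: loop_arcs_def)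
  moreover have "x \<in> loop_arcs G \<and> x \<noteq> c" if x: "x \<in> loop_arcs H" for x
  proof -
    have xa: "x \<in> arcs (dg G)" "tail (dg H) x = tail (dg H) (opp G x)"
      using x arcs by (simp_all add: loop_arcs_def)
    have oo: "opp G (opp G x) = x" by (rule ubgD(4)[OF G])
    have cb: "c' \<noteq> b" using t uv by auto
    have cc: "c' \<noteq> c" using v(2) by auto
    have "c \<noteq> b" using t uv by auto
    then have tc: "tail (dg H) c = u" "tail (dg H) c' = v" using tH[of c] tH[of c'] t(2) cb cc by simp_all
    have x1: "x \<noteq> c" using xa(2) tc uv c by auto
    have oc: "opp G c' = c" using c ubgD(4)[OF G] by metis
    have x2: "opp G x \<noteq> c"
    proof
      assume "opp G x = c"
      then have "x = c'" using oo c by metis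
      then show False using xa(2) tc uv oc by simp
    qed
    have tob: "tail (dg G) (opp G b) \<noteq> v"
      using vx[of "opp G b"] ob t(6) ubgD(6)[OF G] by auto
    have x3: "x \<noteq> b" using xa(2) tH[of b] tH[of "opp G b"] tob ob by auto
    have x4: "opp G x \<noteq> b"
    proof
      assume 1: "opp G x = b"
      then have "x = opp G b" using oo by metis
      then show False using xa(2) tH[of b] tH[of "opp G b"] tob ob 1 by auto
    qed
    show ?thesis using xa tH[of x] tH[of "opp G x"] x1 x2 x3 x4 by (simp add: loop_arcs_def)
  qed
  ultimately show "loop_arcs H \<subset> loop_arcs G" by blast
qed

lemma iso_rel_sym_invariants:
  assumes "(G, H) \<in> iso_rel_sym g p"
  shows "card (loop_arcs G) = card (loop_arcs H)" "leafy G \<Longrightarrow> leafy H"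
proof -
  obtain \<pi> where \<pi>: "lgraph_iso (relabel \<pi> G) H" and G: "G \<in> lgraphs g p"
    using assms by (auto simp: iso_rel_sym_def)
  have u: "ubg (relabel \<pi> G)" using lgraphs_ubg[OF G] by (simp add: ubg_def dg_relabel)
  show "card (loop_arcs G) = card (loop_arcs H)"
    using lgraph_iso_loops[OF u \<pi>] by (simp add: loop_arcs_def dg_relabel)
  show "leafy H" if "leafy G"
    using lgraph_iso_leafy[OF u \<pi>] that by (simp add: leafy_def verts_of_valence_def dg_relabel)
qed

context cat_params
begin

text \<open>For \<open>g > 0\<close> the half-edges \<open>m\<close> and \<open>m + 1\<close> form a
  loop at the last vertex. For \<open>g = 0\<close> the vertex 2 trades its leg for the edge leading
  to vertex 0 and then has only the trivalent neighbours 0, 1 and 3; vertex 3 exists since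
  \<open>m\<close> is at least 4.\<close>

lemma ex_not_iso_rel_sym:
  assumes "2 \<le> m" "g = 0 \<Longrightarrow> 4 \<le> m"
  shows "\<exists>G\<in>lgraphs g p. \<exists>H\<in>lgraphs g p. (G, H) \<notin> iso_rel_sym g p"
proof -
  let ?G = "caterpillar m p"
  note U = ubg_caterpillar and GL = caterpillar_lgraphs
  show ?thesis
  proof (cases "g = 0")
    case False
    let ?b' = "if m = 2 then 0 else 2 * m - 1"
    have "even m \<longleftrightarrow> even p" "p \<le> m" using m(1) False by presburger+
    then have oa: "opp ?G (2 * m) = 3 * m - 1" "opp ?G (m + 1) = m"
      using assms(1) by (auto simp: cat_opp_def)
    have ou: "out_arcs (dg ?G) (m - 2) = {opp ?G (2 * m), ?b', m - 1}"
    proof -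
      have "m - 2 < m" using assms(1) by simp
      note o = caterpillar_out_arcs[OF this]
      have e: "m - 2 + 1 = m - 1" "(m - 2 = 0) = (m = 2)" "m + 1 + (m - 2) = 2 * m - 1"
        "(m - 2 = m - 1) = False" "2 * m + 1 + (m - 2) = 3 * m - 1"
        using assms(1) by auto
      show ?thesis unfolding o oa e if_False by (rule trans[OF insert_commute]) (simp only: insert_commute)
    qed
    have ov: "out_arcs (dg ?G) (m - 1) = {2 * m, m, m + 1}"
    proof -
      have "m - 1 < m" using assms(1) by simp
      note o = caterpillar_out_arcs[OF this]
      have e: "m - 1 + 1 = m" "(m - 1 = 0) = False" "m + 1 + (m - 1) = 2 * m" "(m - 1 = m - 1) = True"
        using assms(1) by auto
      show ?thesis unfolding o e if_False if_True by (rule insert_commute)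
    qed
    have d: "distinct [opp ?G (2 * m), ?b', m - 1]" "distinct [2 * m, m, m + 1]" "m - 2 \<noteq> m - 1"
      unfolding oa using assms(1) by auto
    have "card (loop_arcs (retail ?G (tail (dg ?G) \<circ> Transposition.transpose (m - 1) (m + 1)))) < card (loop_arcs ?G)"
      by (rule swap_loops[OF U ou d(1) ov d(2,3) oa(2)])
    then show ?thesis
      using swap_lgraphs(1)[OF GL ou d(1) ov d(2,3)] GL iso_rel_sym_invariants(1) by (metis less_irrefl)
  next
    case True
    then have p: "p = m + 2" "4 \<le> m" using m(1) assms(2) by auto
    have oa: "opp ?G (m + 3) = 2 * m + 2" using p by (auto simp: cat_opp_def)
    have ou: "out_arcs (dg ?G) 1 = {opp ?G (m + 3), 2, m + 2}"
    proof -
      have "1 < m" using p by simp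
      note o = caterpillar_out_arcs[OF this]
      have e: "(1::nat) + 1 = 2" "((1::nat) = 0) = False" "m + 1 + 1 = m + 2"
        "(1 = m - 1) = False" "2 * m + 1 + 1 = 2 * m + 2"
        using p by auto
      show ?thesis unfolding o oa e if_False by (simp only: insert_commute)
    qed
    have ov: "out_arcs (dg ?G) 2 = {m + 3, 2 * m + 3, 3}"
    proof -
      have "2 < m" using p by simp
      note o = caterpillar_out_arcs[OF this]
      have e: "(2::nat) + 1 = 3" "((2::nat) = 0) = False" "m + 1 + 2 = m + 3"
        "(2 = m - 1) = False" "2 * m + 1 + 2 = 2 * m + 3"
        using p by auto
      show ?thesis unfolding o e if_False by (simp only: insert_commute)
    qed
    have d: "distinct [opp ?G (m + 3), 2, m + 2]" "distinct [m + 3, 2 * m + 3, 3]" "(1::nat) \<noteq> 2"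
      unfolding oa using p by auto
    define H where "H = retail ?G (tail (dg ?G) \<circ> Transposition.transpose (m + 2) 3)"
    note HL = swap_lgraphs[OF GL ou d(1) ov d(2,3), folded H_def]
    have "out_arcs (dg H) 2 = {m + 3, 2 * m + 3, m + 2}"
      using swap_tails_move(4)[OF U ou d(1) ov d(2,3)] by (simp add: H_def)
    moreover have "head (dg H) (m + 3) = 1" "head (dg H) (2 * m + 3) = 3" "head (dg H) (m + 2) = 0"
      using p by (auto simp: H_def cat_opp_def Transposition.transpose_def cat_tail_def)
    moreover have "valence H v = 3" if "v < m" for v
    proof -
      have "v \<in> verts_of_valence H 3" unfolding HL(2) caterpillar_verts_of_valence using that by simp
      then show ?thesis by (simp add: verts_of_valence_def)
    qed
    moreover have "2 \<in> verts_of_valence H 3" unfolding HL(2) caterpillar_verts_of_valence using p by simp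
    ultimately have "\<not> leafy H" using p unfolding leafy_def by force
    moreover have "leafy ?G"
      unfolding leafy_def caterpillar_verts_of_valence
    proof
      fix i assume "i \<in> {..<m}"
      then have i: "i < m" by simp
      then have "i + 1 \<in> out_arcs (dg ?G) i" unfolding caterpillar_out_arcs[OF i] by simp
      moreover have "head (dg ?G) (i + 1) = m + (i + 1)" using i p by (simp add: cat_opp_def cat_tail_def)
      moreover have "valence ?G (m + (i + 1)) = 1" using caterpillar_valence(2) i p by simp
      ultimately show "\<exists>a\<in>out_arcs (dg ?G) i. valence ?G (head (dg ?G) a) = 1" by metis
    qed
    ultimately show ?thesis using iso_rel_sym_invariants(2) HL(1) GL by blast
  qed
qed

text \<open>Trees with 4 or 5 legs can differ only in their labels. In the caterpillar the legs 1
  and 2 hang at the same vertex; after exchanging the labels 2 and 3 they do not.\<close>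

lemma ex_not_iso_rel:
  assumes "2 \<le> m" "g = 0"
  shows "\<exists>G\<in>lgraphs g p. \<exists>H\<in>lgraphs g p. (G, H) \<notin> iso_rel g p"
proof -
  let ?G = "caterpillar m p"
  have p: "p = m + 2" using m(1) assms(2) by simp
  define \<pi> where "\<pi> = Transposition.transpose (2::nat) 3"
  have \<pi>: "\<pi> permutes {1..p}" unfolding \<pi>_def by (rule permutes_swap_id) (use p assms in auto)
  let ?H = "relabel \<pi> ?G"
  have "bij_betw (\<pi> \<circ> label ?G) (verts_of_valence ?G 1) {1..p}"
    using bij_betw_trans[OF _ permutes_imp_bij[OF \<pi>]] caterpillar_lgraphs by (auto simp: lgraphs_def)
  then have HL: "?H \<in> lgraphs g p"
    using caterpillar_lgraphs unfolding lgraphs_def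
    by (simp add: relabel_def verts_of_valence_def graph_rank_def)
  have "\<not> lgraph_iso ?G ?H"
  proof
    assume "lgraph_iso ?G ?H"
    then obtain f k where f: "bij_betw f (verts (dg ?G)) (verts (dg ?H))"
      and k: "bij_betw k (arcs (dg ?G)) (arcs (dg ?H))"
      and c: "\<And>a. a \<in> arcs (dg ?G) \<Longrightarrow> tail (dg ?H) (k a) = f (tail (dg ?G) a) \<and>
          head (dg ?H) (k a) = f (head (dg ?G) a) \<and> opp ?H (k a) = k (opp ?G a)"
      and l: "\<And>v. v \<in> verts_of_valence ?G 1 \<Longrightarrow> label ?H (f v) = label ?G v"
      unfolding lgraph_iso_def by blast
    have val: "valence ?G (f v) = valence ?G v" if "v < m + p" for v
    proof -
      have "valence ?H (f v) = valence ?G v"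
        by (rule lgraph_iso_valence[OF ubgD(1)[OF ubg_caterpillar] f k]) (use c that in auto)
      then show ?thesis by (simp add: dg_relabel)
    qed
    have fV: "f v < m + p" if "v < m + p" for v
      using f that by (auto simp: dg_relabel bij_betw_def)
    have "\<pi> (f v + 1 - m) = v + 1 - m \<and> m \<le> f v" if v: "m \<le> v" "v < m + p" for v
    proof
      have "v \<in> verts_of_valence ?G 1" using v caterpillar_verts_of_valence by simp
      from l[OF this] show "\<pi> (f v + 1 - m) = v + 1 - m" by (simp add: relabel_def)
      have "valence ?G (f v) = 1" using val caterpillar_valence(2) v by simp
      then show "m \<le> f v" using caterpillar_valence(1)[of "f v"] by (metis not_less numeral_eq_one_iff semiring_norm(86))
    qed
    from this[of m] this[of "m + 1"] have "\<pi> (f m + 1 - m) = 1" "\<pi> (f (m + 1) + 1 - m) = 2"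
      "m \<le> f m" "m \<le> f (m + 1)"
      using p by auto
    then have fm: "f m = m" "f (m + 1) = m + 2"
      by (auto simp: \<pi>_def Transposition.transpose_def split: if_splits)
    have hk: "cat_tail m (cat_opp m p (k h)) = f (cat_tail m (cat_opp m p h))" "cat_tail m (k h) = f (cat_tail m h)"
      "k h < 3 * m + p" if "h < 3 * m + p" for h
      using c[of h] k that by (auto simp: dg_relabel bij_betw_def)
    have "cat_tail m (cat_opp m p 0) = m" "cat_tail m (cat_opp m p 1) = m + 1"
      using p assms by (auto simp: cat_opp_def cat_tail_def)
    then have 1: "cat_tail m (cat_opp m p (k 0)) = m" "cat_tail m (cat_opp m p (k 1)) = m + 2"
      using hk(1)[of 0] hk(1)[of 1] fm p by auto
    have leg: "x = 3 * m + i" if "cat_tail m x = m + i" "x < 3 * m + p" "i < p" for x i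
    proof -
      have "x \<in> out_arcs (dg ?G) (m + i)" using that by simp
      then show ?thesis unfolding caterpillar_out_arcs_leg[OF that(3)] by simp
    qed
    have k01: "k 0 < 3 * m + p" "k 1 < 3 * m + p" using hk(3)[of 0] hk(3)[of 1] p by simp_all
    have "cat_opp m p (k 0) = 3 * m + 0"
      by (rule leg) (use 1(1) cat_opp(1)[OF k01(1)] p in simp_all)
    moreover have "cat_opp m p (k 1) = 3 * m + 2"
      by (rule leg) (use 1(2) cat_opp(1)[OF k01(2)] p assms(1) in simp_all)
    ultimately have "cat_opp m p (k 0) = 3 * m + 0" "cat_opp m p (k 1) = 3 * m + 2" by blast+
    then have "k 0 = 0" "k 1 = 2"
      using cat_opp(2)[of "k 0"] cat_opp(2)[of "k 1"] caterpillar_leg_head[of 0] caterpillar_leg_head[of 2]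
        p assms(1) by auto
    then have "cat_tail m 0 = cat_tail m 2"
      using hk(2)[of 0] hk(2)[of 1] p assms(1) by (simp add: cat_tail_def)
    then show False using assms(1) by (simp add: cat_tail_def)
  qed
  then have "(?G, ?H) \<notin> iso_rel g p" by (simp add: iso_rel_def)
  then show ?thesis using HL caterpillar_lgraphs by blast
qed

end


subsection \<open>Diameters of graphs\<close>

definition diam_le :: "lgraph \<Rightarrow> nat \<Rightarrow> bool" where
  "diam_le G k \<longleftrightarrow> (\<forall>y\<in>verts (dg G). \<forall>z\<in>verts (dg G). near G k y z)"

lemma lgraph_iso_diam_le:
  assumes "lgraph_iso G H" "diam_le G k"
  shows "diam_le H k"
proof -
  obtain f h where f: "bij_betw f (verts (dg G)) (verts (dg H))"
    and h: "bij_betw h (arcs (dg G)) (arcs (dg H))"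
    and c: "\<forall>a\<in>arcs (dg G). tail (dg H) (h a) = f (tail (dg G) a) \<and>
        head (dg H) (h a) = f (head (dg G) a) \<and> opp H (h a) = h (opp G a)"
    using assms(1) unfolding lgraph_iso_def by blast
  have adj: "(f y, f z) \<in> arcs_ends (dg H)" if yz: "(y, z) \<in> arcs_ends (dg G)" for y z
  proof -
    obtain a where "a \<in> arcs (dg G)" "y = tail (dg G) a" "z = head (dg G) a"
      using yz by (auto simp: arcs_ends_conv)
    then have "h a \<in> arcs (dg H)" "f y = tail (dg H) (h a)" "f z = head (dg H) (h a)"
      using c h by (auto simp: bij_betw_def)
    then show ?thesis by (auto simp: arcs_ends_conv)
  qed
  have "near H k (f y) (f z)" if "near G k y z" for k y z
    using that
  proof (induction k arbitrary: z)
    case (Suc k)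
    then obtain w where "near G k y w" "(w, z) \<in> arcs_ends (dg G) \<or> w = z" by (auto simp: near_Suc)
    then have "near H k (f y) (f w)" "(f w, f z) \<in> arcs_ends (dg H) \<or> f w = f z"
      using Suc.IH adj by auto
    then show ?case unfolding near_Suc by blast
  qed simp
  moreover have "verts (dg H) = f ` verts (dg G)" using f by (simp add: bij_betw_def)
  ultimately show ?thesis using assms(2) by (simp add: diam_le_def)
qed

lemma spans_near:
  assumes u: "ubg G"
  shows "spans G d \<Longrightarrow> v \<in> set (dverts d) \<Longrightarrow> near G (ht (undec d)) (hd (dverts d)) v"
proof (induction d)
  case (DLeaf x)
  then show ?case by simp
next
  case (DNode a w l r)
  have child: "near G (Suc (ht (undec c))) w v"
    if c: "v \<in> set (dverts c)" "root_arc c \<in> out_arcs (dg G) w" "spans G c"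
      "near G (ht (undec c)) (hd (dverts c)) v" for c
  proof (cases c)
    case c': (DNode b w' l' r')
    have "opp G b \<in> out_arcs (dg G) w'" using c(3) c' by simp
    then have "opp G b \<in> arcs (dg G)" "tail (dg G) (opp G b) = w'" by simp_all
    moreover have "b \<in> arcs (dg G)" "tail (dg G) b = w" using c(2) c' by simp_all
    ultimately have "(w, w') \<in> arcs_ends (dg G)"
      unfolding arcs_ends_conv using ubgD(7)[OF u, of b] by (intro image_eqI[of _ _ b]) simp_all
    then have "near G 1 w w'" by (simp add: near_1)
    from near_add[OF this, of _ v] show ?thesis using c(4) c' by simp
  qed (use c in simp)
  have out: "root_arc l \<in> out_arcs (dg G) w" "root_arc r \<in> out_arcs (dg G) w" "spans G l" "spans G r"
    using DNode.prems(1) by (simp_all del: in_out_arcs_conv)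
  consider "v = w" | "v \<in> set (dverts l)" | "v \<in> set (dverts r)" using DNode.prems(2) by auto
  then show ?case
  proof cases
    case 1
    then show ?thesis by (simp add: near_refl)
  next
    case 2
    have "near G (Suc (ht (undec l))) w v"
      by (rule child[OF 2 out(1,3)]) (use DNode.IH(1) 2 out(3) in blast)
    then have "near G (ht (undec (DNode a w l r))) w v" by (rule near_mono) simp
    then show ?thesis by simp
  next
    case 3
    have "near G (Suc (ht (undec r))) w v"
      by (rule child[OF 3 out(2,4)]) (use DNode.IH(2) 3 out(4) in blast)
    then have "near G (ht (undec (DNode a w l r))) w v" by (rule near_mono) simp
    then show ?thesis by simp
  qed
qed

lemma ht_map: "ht (map_btree f t) = ht t"
  by (induction t) auto

text \<open>From any vertex to the root vertex there are at most \<open>J\<close> tree edges, plus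
  one edge if the vertex is the end of a leg.\<close>

lemma rep_diam_le:
  assumes n: "3 \<le> 2 * g + p" and "rep g p G e t" "ht t \<le> J"
  shows "diam_le G (2 * J + 2)"
proof -
  obtain d where G: "G \<in> lgraphs g p" and d: "spans G d" "set (dverts d) = verts_of_valence G 3"
    "undec d = map_btree e t"
    using assms(2) by (auto simp: rep_def)
  note u = lgraphs_ubg[OF G]
  have "card (verts_of_valence G 3) \<noteq> 0" using lgraphs_card[OF G n] n by linarith
  then have "dverts d \<noteq> []" using d(2) by auto
  then obtain a w l r where dd: "d = DNode a w l r" by (cases d) auto
  have root: "near G J w v" if "v \<in> verts_of_valence G 3" for v
  proof -
    have "near G (ht (undec d)) (hd (dverts d)) v" using spans_near[OF u d(1)] that d(2) by simp
    moreover have "ht (undec d) \<le> J" using assms(3) d(3) by (simp add: ht_map)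
    ultimately show ?thesis using near_mono dd by fastforce
  qed
  have any: "near G (J + 1) w v" if v: "v \<in> verts (dg G)" for v
  proof (cases "v \<in> verts_of_valence G 3")
    case True
    then show ?thesis using near_mono[OF root] by simp
  next
    case False
    then have v1: "v \<in> verts_of_valence G 1" "valence G v = 1"
      using v G by (auto simp: lgraphs_def verts_of_valence_def)
    then obtain a where a: "a \<in> arcs (dg G)" "tail (dg G) a = v" using ex_out_arc[of v G 1] by auto
    then have "head (dg G) a \<in> verts_of_valence G 3" using leg_head[OF G n] v1 by simp
    moreover have "near G 1 v (head (dg G) a)" using a by (auto simp: near_1 arcs_ends_conv)
    ultimately show ?thesis using near_add[OF root near_sym[OF u]] by blast
  qed
  show ?thesis
    unfolding diam_le_def
  proof (intro ballI)
    fix y z assume "y \<in> verts (dg G)" "z \<in> verts (dg G)"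
    then have "near G ((J + 1) + (J + 1)) y z" using near_add[OF near_sym[OF u any] any] by blast
    then show "near G (2 * J + 2) y z" by (rule near_mono) simp
  qed
qed

subsection \<open>Diameters of the graphs of graphs\<close>

lemma dist_S_le: "(move_on Q ^^ n) X Y \<Longrightarrow> dist_S Q X Y \<le> enat n"
  unfolding dist_S_def by (rule INF_lower) simp

lemma diam_S_leI:
  assumes "\<And>X Y. X \<in> Q \<Longrightarrow> Y \<in> Q \<Longrightarrow> \<exists>n\<le>k. (move_on Q ^^ n) X Y"
  shows "diam_S Q \<le> ereal (real k)"
proof -
  have "(SUP X\<in>Q. SUP Y\<in>Q. dist_S Q X Y) \<le> enat k"
  proof (intro SUP_least)
    fix X Y assume "X \<in> Q" "Y \<in> Q"
    then obtain n where "n \<le> k" "(move_on Q ^^ n) X Y" using assms by blast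
    then show "dist_S Q X Y \<le> enat k" using dist_S_le by (meson enat_ord_simps(1) order_trans)
  qed
  then show ?thesis unfolding diam_S_def by (metis ereal_of_enat_le_iff ereal_of_enat_simps(1))
qed

lemma diam_S_geI:
  assumes "X \<in> Q" "Y \<in> Q" "\<And>n. (move_on Q ^^ n) X Y \<Longrightarrow> k \<le> n"
  shows "ereal (real k) \<le> diam_S Q"
proof -
  have "enat k \<le> dist_S Q X Y" unfolding dist_S_def using assms(3) by (intro INF_greatest) simp
  also have "\<dots> \<le> (SUP X\<in>Q. SUP Y\<in>Q. dist_S Q X Y)"
    using assms(1,2) by (meson SUP_upper SUP_upper2)
  finally show ?thesis unfolding diam_S_def by (metis ereal_of_enat_le_iff ereal_of_enat_simps(1))
qed

lemma diam_S_nonneg: "0 \<le> diam_S Q"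
  by (simp add: diam_S_def)

lemma diam_S_ge_1:
  assumes "equiv A r" "G \<in> A" "H \<in> A" "(G, H) \<notin> r"
  shows "1 \<le> diam_S (A // r)"
proof -
  have "r `` {G} \<noteq> r `` {H}" using assms by (simp add: eq_equiv_class_iff)
  then have "ereal (real 1) \<le> diam_S (A // r)"
    using assms(2,3) by (intro diam_S_geI[of "r `` {G}" _ "r `` {H}"]) (auto intro: quotientI simp: Suc_le_eq intro!: gr0I)
  then show ?thesis by (simp add: one_ereal_def)
qed

lemma relpowp_map:
  assumes "\<And>x y. R x y \<Longrightarrow> S (f x) (f y)"
  shows "(R ^^ n) x y \<Longrightarrow> (S ^^ n) (f x) (f y)"
proof (induction n arbitrary: y)
  case (Suc n)
  then obtain z where "(R ^^ n) x z" "R z y" by auto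
  then have "(S ^^ n) (f x) (f z)" "S (f z) (f y)" using Suc.IH assms by blast+
  then show ?case by auto
qed simp

lemma quotient_class_eq:
  assumes "equiv A r" "X \<in> A // r" "x \<in> X"
  shows "X = r `` {x}"
proof -
  obtain y where "X = r `` {y}" using assms(2) by (rule quotientE)
  then show ?thesis using assms(1,3) equiv_class_eq by fastforce
qed

text \<open>Passing to orbits is surjective on classes and carries moves to moves, so it does not
  increase distances.\<close>

lemma diam_S_Graph_mod_Sym_le: "diam_S (Graph_mod_Sym g p) \<le> diam_S (Graph g p)"
proof -
  let ?Q = "Graph g p" and ?Q' = "Graph_mod_Sym g p" and ?\<pi> = "\<lambda>X. iso_rel_sym g p `` X"
  have "iso_rel g p \<subseteq> iso_rel_sym g p"
    by (auto simp: iso_rel_def iso_rel_sym_def relabel_id intro!: exI[of _ id] permutes_id)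
  then have proj: "?\<pi> (iso_rel g p `` {G}) = iso_rel_sym g p `` {G}" if "G \<in> lgraphs g p" for G
    using that equiv_iso_rel equiv_iso_rel_sym unfolding equiv_def refl_on_def trans_def by blast
  have mv: "move_on ?Q' (?\<pi> X) (?\<pi> Y)" if mXY: "move_on ?Q X Y" for X Y
  proof -
    obtain G H where XY: "G \<in> X" "H \<in> Y" "X \<in> ?Q" "Y \<in> ?Q" "simultaneous_move G H"
      using mXY by (auto simp: move_on_def)
    then have GH: "G \<in> lgraphs g p" "H \<in> lgraphs g p"
      using in_quotient_imp_subset[OF equiv_iso_rel] unfolding Graph_def by blast+
    have X: "X = iso_rel g p `` {G}" "Y = iso_rel g p `` {H}"
      using XY quotient_class_eq[OF equiv_iso_rel] unfolding Graph_def by blast+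
    show ?thesis
      unfolding move_on_def X proj[OF GH(1)] proj[OF GH(2)]
      using GH XY(5) equiv_class_self[OF equiv_iso_rel_sym] unfolding Graph_mod_Sym_def
      by (blast intro: quotientI)
  qed
  have "(SUP X\<in>?Q'. SUP Y\<in>?Q'. dist_S ?Q' X Y) \<le> (SUP X\<in>?Q. SUP Y\<in>?Q. dist_S ?Q X Y)"
  proof (intro SUP_least)
    fix X Y assume "X \<in> ?Q'" "Y \<in> ?Q'"
    then obtain G H where G: "G \<in> lgraphs g p" "X = iso_rel_sym g p `` {G}"
      and H: "H \<in> lgraphs g p" "Y = iso_rel_sym g p `` {H}"
      unfolding Graph_mod_Sym_def by (metis quotientE)
    let ?X = "iso_rel g p `` {G}" and ?Y = "iso_rel g p `` {H}"
    have "dist_S ?Q' X Y \<le> dist_S ?Q ?X ?Y"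
      unfolding dist_S_def
    proof (rule INF_superset_mono)
      show "{n. (move_on ?Q ^^ n) ?X ?Y} \<subseteq> {n. (move_on ?Q' ^^ n) X Y}"
      proof
        fix n assume "n \<in> {n. (move_on ?Q ^^ n) ?X ?Y}"
        then have "(move_on ?Q' ^^ n) (?\<pi> ?X) (?\<pi> ?Y)"
          using relpowp_map[of "move_on ?Q" "move_on ?Q'" ?\<pi>, OF mv] by blast
        then show "n \<in> {n. (move_on ?Q' ^^ n) X Y}"
          unfolding proj[OF G(1)] proj[OF H(1)] G(2) H(2) by blast
      qed
    qed simp
    also have "\<dots> \<le> (SUP X\<in>?Q. SUP Y\<in>?Q. dist_S ?Q X Y)"
      using G H unfolding Graph_def by (meson SUP_upper SUP_upper2 quotientI)
    finally show "dist_S ?Q' X Y \<le> (SUP X\<in>?Q. SUP Y\<in>?Q. dist_S ?Q X Y)" .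
  qed
  then show ?thesis unfolding diam_S_def by (simp add: ereal_of_enat_le_iff)
qed

text \<open>Both trees reach the same trie in \<open>42 * J\<close> steps. Following the second path
  backwards with the marking of \<open>G\<close> ends in a graph with the labelled tree of
  \<open>H\<close>, hence isomorphic to \<open>H\<close>.\<close>

lemma Graph_moves:
  assumes n: "3 \<le> 2 * g + p" "2 * g + p < 2 ^ J" and XY: "X \<in> Graph g p" "Y \<in> Graph g p"
  shows "(move_on (Graph g p) ^^ (84 * J)) X Y"
proof -
  obtain G H where G: "G \<in> lgraphs g p" "X = iso_rel g p `` {G}"
    and H: "H \<in> lgraphs g p" "Y = iso_rel g p `` {H}"
    using XY unfolding Graph_def by (metis quotientE)
  obtain e t where t: "rep g p G e t" "distinct (leaf_list t)" "set (leaf_list t) = {2..2 * g + p}"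
    using ex_rep[OF G(1) n(1)] by blast
  obtain e' t' where t': "rep g p H e' t'" "distinct (leaf_list t')" "set (leaf_list t') = {2..2 * g + p}"
    using ex_rep[OF H(1) n(1)] by blast
  have "{2..2 * g + p} \<subseteq> {..<2 ^ J}" "{2..2 * g + p} \<noteq> {}" using n by auto
  then obtain u where u: "\<And>t. distinct (leaf_list t) \<Longrightarrow> set (leaf_list t) = {2..2 * g + p} \<Longrightarrow> steps (42 * J) t u"
    using steps_to_trie by metis
  have "steps (42 * J + 42 * J) t t'" by (rule steps_add[OF u[OF t(2,3)] steps_sym[OF u[OF t'(2,3)]]])
  then have "steps (84 * J) t t'" by simp
  from rep_steps[OF t(1) this] obtain I where I: "((\<lambda>G H. G \<in> lgraphs g p \<and> H \<in> lgraphs g p \<and> simultaneous_move G H) ^^ (84 * J)) G I"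
    "rep g p I e t'"
    by blast
  have "lgraph_iso I H" by (rule rep_iso[OF n(1) I(2) t'(1,3)])
  moreover have "I \<in> lgraphs g p" using I(2) by (simp add: rep_def)
  ultimately have "(I, H) \<in> iso_rel g p" using H(1) by (simp add: iso_rel_def)
  then have "iso_rel g p `` {I} = Y" unfolding H(2) by (rule equiv_class_eq[OF equiv_iso_rel])
  moreover have "(move_on (Graph g p) ^^ (84 * J)) (iso_rel g p `` {G}) (iso_rel g p `` {I})"
  proof (rule relpowp_map[OF _ I(1)])
    fix A B assume AB: "A \<in> lgraphs g p \<and> B \<in> lgraphs g p \<and> simultaneous_move A B"
    then show "move_on (Graph g p) (iso_rel g p `` {A}) (iso_rel g p `` {B})"
      unfolding move_on_def Graph_def
      using equiv_class_self[OF equiv_iso_rel] by (blast intro: quotientI)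
  qed
  ultimately show ?thesis unfolding G(2) by simp
qed

lemma diam_S_Graph_le:
  assumes "3 \<le> 2 * g + p" "2 * g + p < 2 ^ J"
  shows "diam_S (Graph g p) \<le> ereal (real (84 * J))"
  using Graph_moves[OF assms] by (intro diam_S_leI) blast

text \<open>A single trivalent vertex admits no Whitehead move, yet \<open>Graph_moves\<close> joins
  any two classes; so all classes coincide.\<close>

lemma diam_S_Graph_trivial:
  assumes n: "2 * g + p = 3"
  shows "diam_S (Graph g p) \<le> 0"
proof -
  have triv: "X = Y" if XY: "move_on (Graph g p) X Y" for X Y
  proof -
    obtain G H where GH: "G \<in> X" "H \<in> Y" "X \<in> Graph g p" "Y \<in> Graph g p" "simultaneous_move G H"
      using XY by (auto simp: move_on_def)
    then have G: "G \<in> lgraphs g p"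
      using in_quotient_imp_subset[OF equiv_iso_rel] unfolding Graph_def by blast
    note u = lgraphs_ubg[OF G]
    have "\<not> whitehead_move G a G'" for a G'
    proof
      assume w: "whitehead_move G a G'"
      note D = whitehead_moveD[OF u w]
      have "{tail (dg G) a, head (dg G) a} \<subseteq> verts_of_valence G 3"
        using D ubgD(9,10)[OF u D(1)] by (simp add: verts_of_valence_def)
      moreover have "finite (verts_of_valence G 3)" using ubgD(2)[OF u] by (simp add: verts_of_valence_def)
      ultimately have "card {tail (dg G) a, head (dg G) a} \<le> card (verts_of_valence G 3)"
        by (rule card_mono[rotated])
      then show False using D(5) lgraphs_card[OF G] n by simp
    qed
    then have "H = G"
      using GH(5) unfolding simultaneous_move_def by (metis whitehead_moves.cases)
    then show ?thesis using GH unfolding Graph_def by (metis equiv_iso_rel quotient_disj disjoint_iff)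
  qed
  have "(move_on (Graph g p) ^^ n) X Y \<Longrightarrow> X = Y" for n X Y
    by (induction n arbitrary: Y) (auto dest: triv)
  then have "X = Y" if "X \<in> Graph g p" "Y \<in> Graph g p" for X Y
    using Graph_moves[of g p 2 X Y] that n by simp
  then have "\<exists>n\<le>0. (move_on (Graph g p) ^^ n) X Y" if "X \<in> Graph g p" "Y \<in> Graph g p" for X Y
    using that by auto
  then have "diam_S (Graph g p) \<le> ereal (real 0)" by (rule diam_S_leI)
  then show ?thesis by (simp add: zero_ereal_def)
qed

lemma iso_rel_sym_diam_le:
  assumes "(G, H) \<in> iso_rel_sym g p" "diam_le G k"
  shows "diam_le H k"
proof -
  obtain \<pi> where \<pi>: "lgraph_iso (relabel \<pi> G) H" using assms(1) by (auto simp: iso_rel_sym_def)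
  have "diam_le (relabel \<pi> G) k" using assms(2) by (simp add: diam_le_def near_def dg_relabel)
  then show ?thesis by (rule lgraph_iso_diam_le[OF \<pi>])
qed

lemma diam_le_moves:
  assumes "(move_on (Graph_mod_Sym g p) ^^ n) X Y" "\<forall>G\<in>X. diam_le G k"
  shows "\<forall>G\<in>Y. diam_le G (3 ^ n * k)"
  using assms(1)
proof (induction n arbitrary: Y)
  case 0
  then show ?case using assms(2) by simp
next
  case (Suc n)
  then obtain Z where Z: "(move_on (Graph_mod_Sym g p) ^^ n) X Z" "move_on (Graph_mod_Sym g p) Z Y"
    by auto
  then obtain G H where GH: "G \<in> Z" "H \<in> Y" "Z \<in> Graph_mod_Sym g p" "Y \<in> Graph_mod_Sym g p"
    "simultaneous_move G H"
    by (auto simp: move_on_def)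
  then have "G \<in> lgraphs g p"
    using in_quotient_imp_subset[OF equiv_iso_rel_sym] unfolding Graph_mod_Sym_def by blast
  note D = simultaneous_moveD[OF lgraphs_ubg[OF this] GH(5)]
  have "diam_le G (3 ^ n * k)" using Suc.IH[OF Z(1)] GH(1) by blast
  then have "diam_le H (3 ^ Suc n * k)" using D(1,3) by (simp add: diam_le_def same_def mult.assoc)
  moreover have "(H, H') \<in> iso_rel_sym g p" if "H' \<in> Y" for H'
    using GH(2,4) that quotient_eq_iff[OF equiv_iso_rel_sym] unfolding Graph_mod_Sym_def by blast
  ultimately show ?case using iso_rel_sym_diam_le by blast
qed

text \<open>The graph \<open>S\<close> of small diameter comes from moving the caterpillar itself to
  a trie. Moves from \<open>S\<close> back to the caterpillar must stretch the diameter from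
  \<open>2 * J + 2\<close> to at least \<open>2 * g + p - 3\<close>, the distance of the ends of the
  path.\<close>

lemma diam_S_Graph_mod_Sym_ge:
  assumes n: "3 \<le> 2 * g + p" "2 * g + p < 2 ^ J"
    and k: "\<And>j. 2 * g + p - 3 \<le> 3 ^ j * (2 * J + 2) \<Longrightarrow> k \<le> j"
  shows "ereal (real k) \<le> diam_S (Graph_mod_Sym g p)"
proof -
  define m where "m = 2 * g + p - 2"
  interpret cat_params g p m by unfold_locales (use n in \<open>auto simp: m_def\<close>)
  let ?C = "caterpillar m p"
  obtain e t where t: "rep g p ?C e t" "distinct (leaf_list t)" "set (leaf_list t) = {2..2 * g + p}"
    using ex_rep[OF caterpillar_lgraphs n(1)] by blast
  have "{2..2 * g + p} \<subseteq> {..<2 ^ J}" "{2..2 * g + p} \<noteq> {}" using n by auto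
  then obtain u where u: "ht u \<le> J" "steps (42 * J) t u"
    using steps_to_trie t(2,3) by metis
  obtain S where S: "rep g p S e u" using rep_steps[OF t(1) u(2)] by blast
  then have SL: "S \<in> lgraphs g p" by (simp add: rep_def)
  let ?X = "iso_rel_sym g p `` {S}" and ?Y = "iso_rel_sym g p `` {?C}"
  have "diam_le S (2 * J + 2)" by (rule rep_diam_le[OF n(1) S u(1)])
  then have X: "\<forall>G\<in>?X. diam_le G (2 * J + 2)" using iso_rel_sym_diam_le by blast
  show ?thesis
  proof (rule diam_S_geI)
    show "?X \<in> Graph_mod_Sym g p" "?Y \<in> Graph_mod_Sym g p"
      using SL caterpillar_lgraphs by (auto simp: Graph_mod_Sym_def intro: quotientI)
    fix j assume "(move_on (Graph_mod_Sym g p) ^^ j) ?X ?Y"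
    then have "\<forall>G\<in>?Y. diam_le G (3 ^ j * (2 * J + 2))" using X by (rule diam_le_moves)
    moreover have "?C \<in> ?Y" using equiv_class_self[OF equiv_iso_rel_sym caterpillar_lgraphs] .
    ultimately have "near ?C (3 ^ j * (2 * J + 2)) (m - 1) 0" using m by (auto simp: diam_le_def)
    from caterpillar_near[OF this] have "m - 1 \<le> 3 ^ j * (2 * J + 2)" using m by (simp add: cat_pos_def)
    then show "k \<le> j" by (intro k) (simp add: m_def)
  qed
qed

subsection \<open>The logarithmic bounds\<close>

text \<open>\<open>6 * ln N / ln 2 + 2\<close> bounds \<open>2 * J + 2\<close> for the
  \<open>J\<close> of \<open>ex_log_height\<close>; cancelling it leaves
  \<open>sqrt N \<le> 3 ^ j\<close>.\<close>

lemma log_bound_eventually: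
  "\<exists>N0 :: nat. \<forall>N\<ge>N0. sqrt (real N) * (6 * ln (real N) / ln 2 + 2) \<le> real N - 3"
proof -
  have "eventually (\<lambda>N :: nat. sqrt (real N) * (6 * ln (real N) / ln 2 + 2) \<le> real N - 3) at_top"
    by real_asymp
  then show ?thesis by (simp add: eventually_at_top_linorder)
qed

text \<open>For the least \<open>J\<close> one has
  \<open>2 ^ (J - 1) \<le> n \<le> 2 * N \<le> N ^ 2\<close>, so \<open>J - 1\<close> is at most
  twice the binary logarithm of \<open>N\<close>, which itself is at least 1.\<close>

lemma ex_log_height:
  assumes "1 \<le> n" "n \<le> 2 * N" "2 \<le> N"
  obtains J where "n < 2 ^ J" "real J \<le> 3 * ln (real N) / ln 2"
proof -
  define J where "J = (LEAST J. n < 2 ^ J)"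
  have J: "n < 2 ^ J" unfolding J_def by (rule LeastI[of _ n]) (rule less_exp)
  have "J \<noteq> 0" using J assms(1) by (cases J) auto
  then obtain i where i: "J = Suc i" by (cases J) auto
  have "\<not> n < 2 ^ i" using not_less_Least[of i "\<lambda>J. n < 2 ^ J"] i by (simp add: J_def)
  then have "2 ^ i \<le> n" by simp
  also have "n \<le> N ^ 2" using assms(2,3) by (metis le_trans mult_le_mono1 power2_eq_square)
  finally have "(2::real) ^ i \<le> real N ^ 2" by (metis of_nat_le_iff of_nat_numeral of_nat_power)
  then have "ln ((2::real) ^ i) \<le> ln (real N ^ 2)" using assms(3) by (subst ln_le_cancel_iff) auto
  then have "real i * ln 2 \<le> 2 * ln (real N)" using assms(3) by (simp add: ln_realpow)
  moreover have "ln 2 \<le> ln (real N)" using assms(3) by simp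
  ultimately have "real J * ln 2 \<le> 3 * ln (real N)" by (simp add: i algebra_simps)
  then have "real J \<le> 3 * ln (real N) / ln 2" by (simp add: pos_le_divide_eq)
  then show thesis using that J by blast
qed

lemma diam_S_ge_log:
  "\<exists>A\<ge>1. \<forall>g p. 2 * int g - 2 + int p > 0 \<longrightarrow>
    ((g, p) \<notin> {(0, 3), (1, 1), (0, 4), (0, 5)} \<longrightarrow>
      ereal (ln (real (g + p)) / A) \<le> diam_S (Graph_mod_Sym g p)) \<and>
    ((g, p) \<notin> {(0, 3), (1, 1)} \<longrightarrow> ereal (ln (real (g + p)) / A) \<le> diam_S (Graph g p))"
proof -
  obtain N0 :: nat where N0: "\<And>N. N0 \<le> N \<Longrightarrow> sqrt (real N) * (6 * ln (real N) / ln 2 + 2) \<le> real N - 3"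
    using log_bound_eventually by blast
  \<comment> \<open>\<open>2 * ln 3\<close> serves large \<open>N\<close>. For \<open>N\<close> up
    to \<open>N0 + 5\<close> the lower bound becomes at most 1, which two distinct classes
    guarantee; the 5 takes in the trees with 4 and 5 legs.\<close>
  define A where "A = max 1 (max (2 * ln 3) (ln (real (N0 + 5))))"
  have A: "1 \<le> A" "2 * ln 3 \<le> A" "ln (real (N0 + 5)) \<le> A" by (simp_all add: A_def)
  have small: "ereal (ln (real N) / A) \<le> D" if "1 \<le> D" "N \<le> N0 + 5" "1 \<le> N" for N D
  proof -
    have "ln (real N) \<le> ln (real (N0 + 5))" using that(2,3) by (subst ln_le_cancel_iff) auto
    then have "ln (real N) \<le> A" using A(3) by linarith
    then have "ln (real N) / A \<le> 1" using A(1) by simp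
    then show ?thesis using that(1) by (metis dual_order.trans ereal_less_eq(3) one_ereal_def)
  qed
  have mod: "ereal (ln (real (g + p)) / A) \<le> diam_S (Graph_mod_Sym g p)"
    if n: "3 \<le> 2 * g + p" and ex: "(g, p) \<notin> {(0, 3), (1, 1), (0, 4), (0, 5)}" for g p
  proof -
    define N where "N = g + p"
    have N: "2 \<le> N" "2 * g + p \<le> 2 * N" "N \<le> 2 * g + p" using n by (auto simp: N_def)
    define m where "m = 2 * g + p - 2"
    interpret cat_params g p m by unfold_locales (use n in \<open>auto simp: m_def\<close>)
    have "4 \<le> m" if "g = 0"
    proof -
      have "p \<notin> {3, 4, 5}" using ex that by auto
      then show ?thesis using n that by (auto simp: m_def)
    qed
    moreover have "2 \<le> m"
    proof (cases "g = 0")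
      case False
      then have "2 * g + p \<noteq> 3" using ex by (cases "g = 1") auto
      then show ?thesis using n by (simp add: m_def)
    qed (use calculation in simp)
    ultimately obtain G H where "G \<in> lgraphs g p" "H \<in> lgraphs g p" "(G, H) \<notin> iso_rel_sym g p"
      using ex_not_iso_rel_sym by blast
    then have one: "1 \<le> diam_S (Graph_mod_Sym g p)"
      unfolding Graph_mod_Sym_def by (rule diam_S_ge_1[OF equiv_iso_rel_sym])
    show ?thesis
    proof (cases "N0 \<le> N")
      case False
      then show ?thesis using small[OF one, of N] N by (simp add: N_def)
    next
      case True
      obtain J where J: "2 * g + p < 2 ^ J" "real J \<le> 3 * ln (real N) / ln 2"
        using ex_log_height[OF _ N(2,1)] n by auto
      define k where "k = nat \<lceil>ln (real N) / (2 * ln 3)\<rceil>"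
      have "ereal (real k) \<le> diam_S (Graph_mod_Sym g p)"
      proof (rule diam_S_Graph_mod_Sym_ge[OF n J(1)])
        fix j assume "2 * g + p - 3 \<le> 3 ^ j * (2 * J + 2)"
        then have "real (2 * g + p - 3) \<le> real (3 ^ j * (2 * J + 2))" by (simp only: of_nat_le_iff)
        moreover have "real N \<le> real (2 * g + p)" using N(3) by (simp only: of_nat_le_iff)
        then have "real N - 3 \<le> real (2 * g + p - 3)" using n by (simp add: of_nat_diff)
        moreover have "real (3 ^ j * (2 * J + 2)) = 3 ^ j * (2 * real J + 2)" by (simp add: algebra_simps)
        ultimately have "real N - 3 \<le> 3 ^ j * (2 * real J + 2)" by linarith
        also have "\<dots> \<le> 3 ^ j * (6 * ln (real N) / ln 2 + 2)"
          using J(2) by (intro mult_left_mono) auto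
        finally have "sqrt (real N) * (6 * ln (real N) / ln 2 + 2) \<le> 3 ^ j * (6 * ln (real N) / ln 2 + 2)"
          using N0[OF True] by linarith
        moreover have "0 < 6 * ln (real N) / ln 2 + 2" using N(1) by (intro add_nonneg_pos) auto
        ultimately have "sqrt (real N) \<le> 3 ^ j" by (simp only: mult_le_cancel_right_pos)
        then have "ln (sqrt (real N)) \<le> ln (3 ^ j)" using N(1) by (subst ln_le_cancel_iff) auto
        then have "ln (real N) / 2 \<le> real j * ln 3" using N(1) by (simp add: ln_sqrt ln_realpow)
        then have "ln (real N) / (2 * ln 3) \<le> real j" by (simp add: field_simps)
        then show "k \<le> j" by (simp add: k_def ceiling_le_iff nat_le_iff)
      qed
      moreover have "ln (real N) / A \<le> real k"
      proof -
        have "ln (real N) / A \<le> ln (real N) / (2 * ln 3)" using A(1,2) N(1) by (intro divide_left_mono) auto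
        also have "\<dots> \<le> real k" unfolding k_def by (rule real_nat_ceiling_ge)
        finally show ?thesis .
      qed
      ultimately show ?thesis unfolding N_def by (meson ereal_less_eq(3) order_trans)
    qed
  qed
  have graph: "ereal (ln (real (g + p)) / A) \<le> diam_S (Graph g p)"
    if n: "3 \<le> 2 * g + p" and ex: "(g, p) \<notin> {(0, 3), (1, 1)}" for g p
  proof (cases "(g, p) \<in> {(0, 4), (0, 5)}")
    case True
    define m where "m = 2 * g + p - 2"
    interpret cat_params g p m by unfold_locales (use n in \<open>auto simp: m_def\<close>)
    have "2 \<le> m" "g = 0" using True by (auto simp: m_def)
    then obtain G H where "G \<in> lgraphs g p" "H \<in> lgraphs g p" "(G, H) \<notin> iso_rel g p"
      using ex_not_iso_rel by blast
    then have "1 \<le> diam_S (Graph g p)" unfolding Graph_def by (rule diam_S_ge_1[OF equiv_iso_rel])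
    then show ?thesis using True by (intro small) auto
  next
    case False
    then show ?thesis using mod[OF n] ex diam_S_Graph_mod_Sym_le order_trans by (metis insert_iff)
  qed
  show ?thesis
    using A(1) mod graph by (intro exI[of _ A]) auto
qed

text \<open>The exceptions are the cases of vanishing diameters. For (0, 3) and (1, 1) there is a
  single graph, although the logarithm is positive; for (0, 4) and (0, 5) there is a single graph up
  to relabelling, but several labelled ones.\<close>

theorem theorem4:
  shows "\<exists>K::real. K > 0 \<and> (\<forall>g p :: nat. 2 * int g - 2 + int p > 0 \<longrightarrow>
    diam_S (Graph_mod_Sym g p) \<le> ereal K * diam_S (Graph g p) \<and>
    ((g, p) \<notin> {(0, 4), (0, 5)} \<longrightarrow>
       ereal (1 / K) * diam_S (Graph g p) \<le> diam_S (Graph_mod_Sym g p)) \<and>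
    diam_S (Graph g p) \<le> ereal (K * ln (real (g + p))) \<and>
    ((g, p) \<notin> {(0, 3), (1, 1)} \<longrightarrow>
       ereal (1 / K * ln (real (g + p))) \<le> diam_S (Graph g p)))"
proof -
  obtain A where A: "1 \<le> A" and ge: "\<And>g p. 2 * int g - 2 + int p > 0 \<Longrightarrow>
    ((g, p) \<notin> {(0, 3), (1, 1), (0, 4), (0, 5)} \<longrightarrow>
      ereal (ln (real (g + p)) / A) \<le> diam_S (Graph_mod_Sym g p)) \<and>
    ((g, p) \<notin> {(0, 3), (1, 1)} \<longrightarrow> ereal (ln (real (g + p)) / A) \<le> diam_S (Graph g p))"
    using diam_S_ge_log by blast
  \<comment> \<open>\<open>252 = 84 * 3\<close>: there are \<open>84 * J\<close> moves, with
    \<open>J\<close> at most \<open>3 * ln (g + p) / ln 2\<close>.\<close>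
  define B where "B = 252 / ln (2::real)"
  have B: "0 < B" by (simp add: B_def)
  \<comment> \<open>\<open>A * B\<close> bounds the ratio of the two diameters, \<open>A\<close> and
    \<open>B\<close> their comparison with the logarithm.\<close>
  define K where "K = A * B + A + B"
  have "0 < A * B" using A B by simp
  then have K: "1 \<le> K" "A \<le> K" "B \<le> K" "A * B \<le> K"
    unfolding K_def using A B by linarith+
  show ?thesis
  proof (intro exI[of _ K] conjI allI impI)
    show "0 < K" using K(1) by simp
    fix g p :: nat assume gp: "2 * int g - 2 + int p > 0"
    then have n: "3 \<le> 2 * g + p" by linarith
    define L where "L = ln (real (g + p))"
    have N: "2 \<le> g + p" "2 * g + p \<le> 2 * (g + p)" using n by auto
    have L: "0 < L" using N(1) by (simp add: L_def)
    obtain J where J: "2 * g + p < 2 ^ J" "real J \<le> 3 * L / ln 2"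
      unfolding L_def using ex_log_height[OF _ N(2,1)] n by auto
    have "real (84 * J) \<le> B * L" using J(2) by (simp add: B_def)
    then have ub: "diam_S (Graph g p) \<le> ereal (B * L)"
      using diam_S_Graph_le[OF n J(1)] by (meson ereal_less_eq(3) order_trans)
    obtain y where y: "diam_S (Graph g p) = ereal y"
      using ub diam_S_nonneg[of "Graph g p"] by (cases "diam_S (Graph g p)") auto
    obtain x where x: "diam_S (Graph_mod_Sym g p) = ereal x"
      using diam_S_Graph_mod_Sym_le[of g p] diam_S_nonneg[of "Graph_mod_Sym g p"] y
      by (cases "diam_S (Graph_mod_Sym g p)") auto
    have xy: "0 \<le> x" "x \<le> y" "y \<le> B * L"
      using diam_S_Graph_mod_Sym_le[of g p] diam_S_nonneg[of "Graph_mod_Sym g p"] ub by (simp_all add: x y)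
    have "x \<le> K * y" using xy K(1) mult_right_mono[of 1 K y] by linarith
    then show "diam_S (Graph_mod_Sym g p) \<le> ereal K * diam_S (Graph g p)" by (simp add: x y)
    have "y \<le> K * L" using xy(3) mult_right_mono[OF K(3), of L] L by linarith
    then show "diam_S (Graph g p) \<le> ereal (K * ln (real (g + p)))" by (simp add: y L_def)
    show "ereal (1 / K * ln (real (g + p))) \<le> diam_S (Graph g p)" if "(g, p) \<notin> {(0, 3), (1, 1)}"
    proof -
      have "L / A \<le> y" using ge[OF gp] that by (simp add: L_def y)
      moreover have "L / K \<le> L / A" using L A K(2) by (intro divide_left_mono) auto
      ultimately show ?thesis by (simp add: y L_def)
    qed
    show "ereal (1 / K) * diam_S (Graph g p) \<le> diam_S (Graph_mod_Sym g p)"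
      if ex: "(g, p) \<notin> {(0, 4), (0, 5)}"
    proof (cases "(g, p) \<in> {(0, 3), (1, 1)}")
      case True
      then have "diam_S (Graph g p) \<le> 0" by (intro diam_S_Graph_trivial) auto
      then have "y = 0" using xy by (simp add: y)
      then show ?thesis using xy by (simp add: x y)
    next
      case False
      then have "L / A \<le> x" using ge[OF gp] ex by (simp add: L_def x)
      then have "L \<le> A * x" using A by (simp add: field_simps)
      then have "B * L \<le> B * (A * x)" using B by simp
      then have "y \<le> (A * B) * x" using xy(3) by (simp add: algebra_simps)
      also have "\<dots> \<le> K * x" using K(4) xy(1) by (rule mult_right_mono)
      finally show ?thesis using K(1) by (simp add: x y field_simps)
    qed
  qed
qed

end
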